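(* There is an absolute constant $K>0$ such that the following holds. Given a graph $G=(V,E)$ with $n$ vertices, $m$ edges, maximum degree $d$, and $\epsilon\in(0,1)$, there is a polynomial time deterministic algorithm that finds a subset $F\subseteq E$ of edges with size $\tilde m=|F|=O(n/\epsilon^2)$ such that $\tilde G=(V,F)$ satisfies \[2\frac{m}{\tilde m}D_{\tilde G}-2D_G-K\epsilon\, d\, I_n\preceq\frac{m}{\tilde m}L_{\tilde G}-L_G\preceq K\epsilon\, d\, I_n.\]
   Context: $L_H$ is the graph Laplacian $\sum_{uv\in E(H)}(\chi_u-\chi_v)(\chi_u-\chi_v)^T$ and $D_H$ the diagonal degree matrix of a graph $H$; $\preceq$ is the positive semidefinite order. $F$ is a set (no repeated edges). *)

theory Defs
  imports
    "Jordan_Normal_Form.Matrix"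
    "HOL-Computational_Algebra.Polynomial"
    "HOL-Library.Log_Nat"
begin

section \<open>Graphs and their matrices\<close>

text \<open>A simple undirected graph on the vertex set \<open>{..<n}\<close> is given by its edge set, where an
  undirected edge is represented by its unique ordered pair \<open>(u, v)\<close> with \<open>u < v\<close>.\<close>

definition simple_graph :: "nat \<Rightarrow> (nat \<times> nat) set \<Rightarrow> bool" where
  "simple_graph n E \<longleftrightarrow> (\<forall>(u, v) \<in> E. u < v \<and> v < n)"

definition degree :: "(nat \<times> nat) set \<Rightarrow> nat \<Rightarrow> nat" where
  "degree E v = card {e \<in> E. fst e = v \<or> snd e = v}"

text \<open>The \<open>0\<close> only matters for \<open>n = 0\<close>.\<close>

definition max_degree :: "nat \<Rightarrow> (nat \<times> nat) set \<Rightarrow> nat" where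
  "max_degree n E = Max (insert 0 (degree E ` {..<n}))"

definition degree_matrix :: "nat \<Rightarrow> (nat \<times> nat) set \<Rightarrow> real mat" where
  "degree_matrix n E = mat_diag n (\<lambda>v. real (degree E v))"

text \<open>The entries of \<open>\<Sum>uv \<in> E. (\<chi>\<^sub>u - \<chi>\<^sub>v) (\<chi>\<^sub>u - \<chi>\<^sub>v)\<^sup>T\<close>; the type of
  matrices of all dimensions is not a monoid under addition, so that sum is taken entrywise.\<close>

definition laplacian :: "nat \<Rightarrow> (nat \<times> nat) set \<Rightarrow> real mat" where
  "laplacian n E = Matrix.mat n n (\<lambda>(i, j). \<Sum>(u, v)\<in>E.
     (unit_vec n u - unit_vec n v) $ i * (unit_vec n u - unit_vec n v) $ j)"

definition positive_semidefinite :: "nat \<Rightarrow> real mat \<Rightarrow> bool" where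
  "positive_semidefinite n A \<longleftrightarrow> A \<in> carrier_mat n n \<and> transpose_mat A = A \<and>
     (\<forall>x \<in> carrier_vec n. 0 \<le> x \<bullet> (A *\<^sub>v x))"

definition loewner_le :: "nat \<Rightarrow> real mat \<Rightarrow> real mat \<Rightarrow> bool" where
  "loewner_le n A B \<longleftrightarrow> A \<in> carrier_mat n n \<and> B \<in> carrier_mat n n \<and>
     positive_semidefinite n (B - A)"


section \<open>Deterministic algorithms and their running time\<close>

text \<open>The model of computation is a deterministic while language over arrays of integers of
  arbitrary size, with the logarithmic cost criterion: every operation is charged the binary lengths
  of the numbers it touches, array indices included. (Unit cost would be too generous: repeated
  squaring produces exponentially long numbers in linearly many steps.) Under this criterion the
  language and Turing machines simulate each other with polynomial overhead. Scalar variables are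
  cells with index \<open>0\<close>.\<close>

type_synonym vname = string
type_synonym state = "vname \<Rightarrow> int \<Rightarrow> int"

datatype aexp =
    Num int
  | Read vname aexp
  | Add aexp aexp
  | Sub aexp aexp
  | Mul aexp aexp
  | Div aexp aexp

datatype bexp =
    Less aexp aexp
  | Not bexp
  | And bexp bexp

datatype com =
    Skip
  | Assign vname aexp aexp
  | Seq com com
  | If bexp com com
  | While bexp com

fun aval :: "aexp \<Rightarrow> state \<Rightarrow> int" where
  "aval (Num k) s = k"
| "aval (Read x e) s = s x (aval e s)"
| "aval (Add a b) s = aval a s + aval b s"
| "aval (Sub a b) s = aval a s - aval b s"
| "aval (Mul a b) s = aval a s * aval b s"
| "aval (Div a b) s = aval a s div aval b s"

fun bval :: "bexp \<Rightarrow> state \<Rightarrow> bool" where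
  "bval (Less a b) s \<longleftrightarrow> aval a s < aval b s"
| "bval (Not b) s \<longleftrightarrow> \<not> bval b s"
| "bval (And a b) s \<longleftrightarrow> bval a s \<and> bval b s"

text \<open>Number of binary digits of \<open>\<bar>k\<bar>\<close> plus one for the sign.\<close>

definition bit_size :: "int \<Rightarrow> nat" where
  "bit_size k = floorlog 2 (nat \<bar>k\<bar>) + 1"

fun acost :: "aexp \<Rightarrow> state \<Rightarrow> nat" where
  "acost (Num k) s = bit_size k"
| "acost (Read x e) s = acost e s + bit_size (aval e s) + bit_size (s x (aval e s))"
| "acost (Add a b) s = acost a s + acost b s + bit_size (aval a s) + bit_size (aval b s)"
| "acost (Sub a b) s = acost a s + acost b s + bit_size (aval a s) + bit_size (aval b s)"
| "acost (Mul a b) s = acost a s + acost b s + bit_size (aval a s) * bit_size (aval b s)"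
| "acost (Div a b) s = acost a s + acost b s + bit_size (aval a s) * bit_size (aval b s)"

fun bcost :: "bexp \<Rightarrow> state \<Rightarrow> nat" where
  "bcost (Less a b) s = acost a s + acost b s + bit_size (aval a s) + bit_size (aval b s)"
| "bcost (Not b) s = bcost b s + 1"
| "bcost (And a b) s = bcost a s + bcost b s + 1"

text \<open>\<open>exec c s t s'\<close>: started in state \<open>s\<close>, the program \<open>c\<close> halts in state \<open>s'\<close> with running
  time \<open>t\<close>. The assignment \<open>Assign x i a\<close> is \<open>x[i] := a\<close>.\<close>

inductive exec :: "com \<Rightarrow> state \<Rightarrow> nat \<Rightarrow> state \<Rightarrow> bool" where
  Skip: "exec Skip s 1 s"
| Assign: "exec (Assign x i a) s
     (acost i s + acost a s + bit_size (aval i s) + bit_size (aval a s))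
     (s(x := (s x)(aval i s := aval a s)))"
| Seq: "exec c1 s1 t1 s2 \<Longrightarrow> exec c2 s2 t2 s3 \<Longrightarrow> exec (Seq c1 c2) s1 (t1 + t2) s3"
| IfTrue: "bval b s \<Longrightarrow> exec c1 s t s' \<Longrightarrow> exec (If b c1 c2) s (bcost b s + t) s'"
| IfFalse: "\<not> bval b s \<Longrightarrow> exec c2 s t s' \<Longrightarrow> exec (If b c1 c2) s (bcost b s + t) s'"
| WhileFalse: "\<not> bval b s \<Longrightarrow> exec (While b c) s (bcost b s) s"
| WhileTrue: "bval b s1 \<Longrightarrow> exec c s1 t1 s2 \<Longrightarrow> exec (While b c) s2 t2 s3 \<Longrightarrow>
     exec (While b c) s1 (bcost b s1 + t1 + t2) s3"

lemma exec_deterministic: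
  "exec c s t s' \<Longrightarrow> exec c s u s'' \<Longrightarrow> u = t \<and> s'' = s'"
proof (induction arbitrary: u s'' rule: exec.induct)
  case (Skip s)
  from Skip.prems show ?case by cases simp
next
  case (Assign x i a s)
  from Assign.prems show ?case by cases simp
next
  case (Seq c1 s1 t1 s2 c2 t2 s3)
  from Seq.prems obtain u1 u2 r where
    r: "exec c1 s1 u1 r" "exec c2 r u2 s''" "u = u1 + u2"
    by cases
  with Seq.IH(1)[OF r(1)] Seq.IH(2)[of u2 s''] show ?case by simp
next
  case (IfTrue b s c1 t s' c2)
  from IfTrue.prems IfTrue.hyps(1) obtain u1 where
    r: "exec c1 s u1 s''" "u = bcost b s + u1"
    by cases simp_all
  with IfTrue.IH[OF r(1)] show ?case by simp
next
  case (IfFalse b s c2 t s' c1)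
  from IfFalse.prems IfFalse.hyps(1) obtain u1 where
    r: "exec c2 s u1 s''" "u = bcost b s + u1"
    by cases simp_all
  with IfFalse.IH[OF r(1)] show ?case by simp
next
  case (WhileFalse b s c)
  from WhileFalse.prems WhileFalse.hyps show ?case by cases simp_all
next
  case (WhileTrue b s1 c t1 s2 t2 s3)
  from WhileTrue.prems WhileTrue.hyps(1) obtain u1 u2 r where
    r: "exec c s1 u1 r" "exec (While b c) r u2 s''" "u = bcost b s1 + u1 + u2"
    by cases simp_all
  with WhileTrue.IH(1)[OF r(1)] WhileTrue.IH(2)[of u2 s''] show ?case by simp
qed


section \<open>Encoding of inputs and outputs\<close>

text \<open>The input is the number \<open>n\<close> of vertices, the list \<open>es\<close> of edges and the fraction \<open>p / q\<close>;
  all other cells are \<open>0\<close>.\<close>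

definition input_state :: "nat \<Rightarrow> (nat \<times> nat) list \<Rightarrow> nat \<Rightarrow> nat \<Rightarrow> state" where
  "input_state n es p q = (\<lambda>x i.
     if x = ''n'' \<and> i = 0 then int n
     else if x = ''m'' \<and> i = 0 then int (length es)
     else if x = ''p'' \<and> i = 0 then int p
     else if x = ''q'' \<and> i = 0 then int q
     else if x = ''src'' \<and> 0 \<le> i \<and> i < int (length es) then int (fst (es ! nat i))
     else if x = ''dst'' \<and> 0 \<le> i \<and> i < int (length es) then int (snd (es ! nat i))
     else 0)"

text \<open>The size of the graph is its number of vertices and edges, that of a number its binary length.\<close>

definition input_size :: "nat \<Rightarrow> (nat \<times> nat) list \<Rightarrow> nat \<Rightarrow> nat \<Rightarrow> nat" where
  "input_size n es p q = n + length es + bit_size (int p) + bit_size (int q)"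

text \<open>The array \<open>''out''\<close> is the indicator vector of the selected edges.\<close>

definition output_edges :: "(nat \<times> nat) list \<Rightarrow> state \<Rightarrow> (nat \<times> nat) set" where
  "output_edges es s = {es ! i | i. i < length es \<and> s ''out'' (int i) \<noteq> 0}"

text \<open>A real \<open>\<epsilon>\<close> is passed to an algorithm as a positive fraction that is exact up to a factor
  of \<open>2\<close>. Every \<open>\<epsilon> \<in> (0, 1)\<close> has such a fraction with \<open>O(log (1/\<epsilon>))\<close> bits, and a rational \<open>\<epsilon>\<close>
  may be passed as itself.\<close>

definition represents_eps :: "nat \<Rightarrow> nat \<Rightarrow> real \<Rightarrow> bool" where
  "represents_eps p q \<epsilon> \<longleftrightarrow>
     0 < p \<and> 0 < q \<and> \<epsilon> / 2 \<le> real p / real q \<and> real p / real q \<le> \<epsilon>"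

end

theory Submission
imports Defs "HOL-Analysis.Inner_Product"
begin

text \<open>Writing \<open>r = m / \<bar>F\<bar>\<close>, both inequalities are upper bounds \<open>r M\<^sub>F - M\<^sub>G \<preceq> K \<epsilon> d I\<close>, where \<open>M\<close> is the
  signed or the unsigned Laplacian, the sum of the rank one matrices of the vectors \<open>\<chi>\<^sub>u \<plusminus> \<chi>\<^sub>v\<close>. If
  \<open>m = O(n / \<epsilon>\<^sup>2)\<close>, take all edges. Otherwise pick \<open>k = \<Theta>(n / \<epsilon>\<^sup>2)\<close> edges one at a time without replacement,
  as in the upper barrier argument of Batson, Spielman and Srivastava: the potential is the
  sum of the traces of the inverses of the two distances to the barrier, and each step raises the barrier a little.
  The weights are chosen such that the change is centred for a uniformly random remaining edge;
  hence an averaging argument yields an edge that does not increase the potential.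

  The algorithm replaces the inverse by a truncated Neumann series, whose trace is computed exactly
  in integers after scaling, and picks an edge that minimizes it. In the case where edges have to
  be picked, the condition number is polynomial in \<open>m\<close>, so polynomially many terms
  of the series suffice, and the error is absorbed by a part of the shift of the barrier.\<close>

section \<open>Operators on inner product spaces\<close>

no_notation scalar_prod (infix "\<bullet>" 70)
notation inner (infix "\<bullet>" 70)

text \<open>The invariant bounds the truncated series, the quantity that the program compares, and
  not the exact trace. An even truncation never exceeds the trace, and the trace exceeds it at most
  by a factor \<open>1 + c / (\<mu> * N)\<close>; this rests on no spectral theorem, only on the
  decrease of the traces of powers. A bounded trace of an inverse would not show that an operator is
  positive, whereas a bounded series with enough terms does: a direction with a small or negative
  form would make many terms large. Both signs share one potential, because one edge has to serve
  both inequalities. The multiple of the identity starts at \<open>\<eta> * d * k / m\<close>, rises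
  by \<open>\<eta> * d / m\<close> in each step and has doubled at the end; multiplication by
  \<open>(m - k) / k\<close> then turns the weights into those of L_G - (m / k) L_F and this
  multiple into at most \<open>2 * \<eta> * d\<close>, whence K = 2. Types cannot depend on
  \<open>n\<close>, so the operators act on one space of infinite dimension, traces run over its
  first \<open>n\<close> basis vectors, and inverses, which do not exist there automatically, are
  built from rank-one updates.\<close>

definition self_adjoint :: "('a::real_inner \<Rightarrow> 'a) \<Rightarrow> bool" where
  "self_adjoint f \<longleftrightarrow> linear f \<and> (\<forall>x y. f x \<bullet> y = x \<bullet> f y)"

definition psd :: "('a::real_inner \<Rightarrow> 'a) \<Rightarrow> bool" where
  "psd f \<longleftrightarrow> self_adjoint f \<and> (\<forall>x. 0 \<le> x \<bullet> f x)"

text \<open>A relation between two maps, because in infinite dimension a positive definite operator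
  need not be onto; inverses are supplied as explicit witnesses.\<close>

definition inverse_of :: "('a \<Rightarrow> 'a) \<Rightarrow> ('a \<Rightarrow> 'a) \<Rightarrow> bool" where
  "inverse_of M R \<longleftrightarrow> (\<forall>x. M (R x) = x) \<and> (\<forall>x. R (M x) = x)"

lemma self_adjointD: "self_adjoint f \<Longrightarrow> linear f" "self_adjoint f \<Longrightarrow> f x \<bullet> y = x \<bullet> f y"
  by (auto simp: self_adjoint_def)

lemma psdD: "psd f \<Longrightarrow> linear f" "psd f \<Longrightarrow> f x \<bullet> y = x \<bullet> f y" "psd f \<Longrightarrow> 0 \<le> x \<bullet> f x"
  "psd f \<Longrightarrow> self_adjoint f"
  by (auto simp: psd_def self_adjoint_def)

text \<open>The form is nonnegative at \<open>x - t *\<^sub>R y\<close> for all \<open>t\<close>, in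
  particular at the minimizing \<open>t\<close>. It may be degenerate at \<open>y\<close>; the
  polynomial in \<open>t\<close> is then affine, and a nonzero slope is refuted by a
  \<open>t\<close> at which its value is \<open>- 1\<close>.\<close>

lemma psd_Cauchy_Schwarz:
  assumes "psd f"
  shows "(x \<bullet> f y)\<^sup>2 \<le> (x \<bullet> f x) * (y \<bullet> f y)"
proof -
  have lin: "linear f" and sym: "f u \<bullet> v = u \<bullet> f v" and pos: "0 \<le> u \<bullet> f u" for u v
    using psdD[OF assms] by auto
  have yx: "y \<bullet> f x = x \<bullet> f y"
    by (metis inner_commute sym)
  have q: "0 \<le> x \<bullet> f x - 2 * t * (x \<bullet> f y) + t\<^sup>2 * (y \<bullet> f y)" for t
  proof -
    have "0 \<le> (x - t *\<^sub>R y) \<bullet> f (x - t *\<^sub>R y)" by (rule pos)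
    also have "\<dots> = x \<bullet> f x - 2 * t * (x \<bullet> f y) + t\<^sup>2 * (y \<bullet> f y)"
      by (simp add: linear_diff[OF lin] linear_cmul[OF lin] inner_diff_left inner_diff_right yx
          power2_eq_square algebra_simps)
    finally show ?thesis .
  qed
  show ?thesis
  proof (cases "y \<bullet> f y = 0")
    case True
    have "x \<bullet> f y = 0"
    proof (rule ccontr)
      assume "x \<bullet> f y \<noteq> 0"
      with q[of "(x \<bullet> f x + 1) / (2 * (x \<bullet> f y))"] True show False
        by simp
    qed
    then show ?thesis using True by simp
  next
    case False
    with pos[of y] have C: "0 < y \<bullet> f y" by simp
    with q[of "(x \<bullet> f y) / (y \<bullet> f y)"] show ?thesis
      by (simp add: power2_eq_square field_simps)
  qed
qed

section \<open>Quadratic forms of operator powers\<close>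

lemma self_adjoint_funpow:
  assumes "self_adjoint f"
  shows "self_adjoint (f ^^ j)"
proof (induction j)
  case 0
  show ?case by (simp add: self_adjoint_def linear_iff)
next
  case (Suc j)
  have "linear (f \<circ> (f ^^ j))"
    using linear_compose[OF self_adjointD(1)[OF Suc] self_adjointD(1)[OF assms]] .
  moreover have "(f ^^ Suc j) x \<bullet> y = x \<bullet> (f ^^ Suc j) y" for x y
    using self_adjointD(2)[OF assms] self_adjointD(2)[OF Suc] by (simp add: funpow_swap1)
  ultimately show ?case by (simp add: self_adjoint_def o_def)
qed

lemma self_adjoint_funpow_add:
  assumes "self_adjoint f"
  shows "x \<bullet> (f ^^ (i + j)) y = (f ^^ i) x \<bullet> (f ^^ j) y"
  by (simp add: funpow_add self_adjointD(2)[OF self_adjoint_funpow[OF assms]])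

text \<open>Moving half of the factors to the left argument leaves a squared norm for even
  \<open>j\<close> and a single \<open>f\<close> in the middle for odd \<open>j\<close>.\<close>

lemma psd_funpow:
  assumes "psd f"
  shows "psd (f ^^ j)"
proof -
  note sa = psdD(4)[OF assms]
  have "0 \<le> x \<bullet> (f ^^ j) x" for x
  proof (cases "even j")
    case True
    then obtain h where "j = h + h" by (metis evenE mult_2)
    then show ?thesis by (simp add: self_adjoint_funpow_add[OF sa])
  next
    case False
    then obtain h where "j = h + Suc h" by (metis oddE add_Suc_right mult_2 Suc_eq_plus1)
    then have "x \<bullet> (f ^^ j) x = (f ^^ h) x \<bullet> f ((f ^^ h) x)"
      by (simp only: self_adjoint_funpow_add[OF sa]) simp
    then show ?thesis using psdD(3)[OF assms] by simp
  qed
  then show ?thesis using self_adjoint_funpow[OF sa] by (simp add: psd_def)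
qed

text \<open>The Bernoulli inequality for operators. The moments
  \<open>x \<bullet> (f ^^ j) x\<close> are convex in \<open>j\<close>, since their second
  difference is the form of \<open>f ^^ j\<close> at \<open>f x - x\<close>; hence they lie above
  the line through the first two.\<close>

lemma psd_funpow_convex:
  assumes "psd f"
  shows "x \<bullet> x + real j * (x \<bullet> f x - x \<bullet> x) \<le> x \<bullet> (f ^^ j) x"
proof -
  define a where "a j = x \<bullet> (f ^^ j) x" for j
  note sa = psdD(4)[OF assms]
  have conv: "2 * a (Suc j) \<le> a (Suc (Suc j)) + a j" for j
  proof -
    have lin: "linear (f ^^ j)" using self_adjoint_funpow[OF sa] by (rule self_adjointD)
    have "0 \<le> (f x - x) \<bullet> (f ^^ j) (f x - x)"
      using psdD(3)[OF psd_funpow[OF assms]] .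
    also have "\<dots> = f x \<bullet> (f ^^ j) (f x) - x \<bullet> (f ^^ j) (f x) - f x \<bullet> (f ^^ j) x + x \<bullet> (f ^^ j) x"
      by (simp add: linear_diff[OF lin] inner_diff_left inner_diff_right)
    also have "f x \<bullet> (f ^^ j) (f x) = a (Suc (Suc j))"
      using self_adjointD(2)[OF sa] by (simp add: a_def funpow_swap1)
    also have "f x \<bullet> (f ^^ j) x = a (Suc j)"
      using self_adjointD(2)[OF sa] by (simp add: a_def)
    also have "x \<bullet> (f ^^ j) (f x) = a (Suc j)"
      by (simp add: a_def funpow_swap1)
    also have "x \<bullet> (f ^^ j) x = a j" by (simp add: a_def)
    finally show ?thesis by simp
  qed
  have diff: "a 1 - a 0 \<le> a (Suc j) - a j" for j
  proof (induction j)
    case (Suc j)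
    then show ?case using conv[of j] by simp
  qed simp
  have "a 0 + real j * (a 1 - a 0) \<le> a j"
  proof (induction j)
    case (Suc j)
    then show ?case using diff[of j] by (simp add: algebra_simps)
  qed simp
  then show ?thesis by (simp add: a_def)
qed

text \<open>Factors are distributed by parity as in \<open>psd_funpow\<close>. Odd \<open>j\<close>
  requires \<open>f y \<bullet> f y \<le> y \<bullet> f y\<close>, which is the sum of the bound
  \<open>le\<close> at \<open>f y\<close> and of positivity of the form at
  \<open>y - f y\<close>.\<close>

lemma psd_funpow_Suc_le:
  assumes "psd f" and le: "\<And>x. x \<bullet> f x \<le> x \<bullet> x"
  shows "x \<bullet> (f ^^ Suc j) x \<le> x \<bullet> (f ^^ j) x"
proof -
  note sa = psdD(4)[OF assms(1)]
  have lin: "linear f" using sa by (rule self_adjointD)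
  note sy = self_adjointD(2)[OF sa]
  have sq: "f y \<bullet> f y \<le> y \<bullet> f y" for y
  proof -
    have "0 \<le> f y \<bullet> f y - f y \<bullet> f (f y)" using le[of "f y"] by simp
    moreover have "0 \<le> (y - f y) \<bullet> f (y - f y)"
      using psdD(3)[OF assms(1)] .
    moreover have "(y - f y) \<bullet> f (y - f y) = y \<bullet> f y - 2 * (f y \<bullet> f y) + f y \<bullet> f (f y)"
      by (simp add: linear_diff[OF lin] inner_diff_left inner_diff_right sy)
    ultimately show ?thesis by simp
  qed
  show ?thesis
  proof (cases "even j")
    case True
    then obtain h where h: "j = h + h" by (metis evenE mult_2)
    have "x \<bullet> (f ^^ (h + Suc h)) x = (f ^^ h) x \<bullet> f ((f ^^ h) x)"
      by (simp only: self_adjoint_funpow_add[OF sa]) simp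
    moreover have "x \<bullet> (f ^^ (h + h)) x = (f ^^ h) x \<bullet> (f ^^ h) x"
      by (simp only: self_adjoint_funpow_add[OF sa])
    ultimately show ?thesis using le[of "(f ^^ h) x"] h by simp
  next
    case False
    then obtain h where h: "j = h + Suc h" by (metis oddE add_Suc_right mult_2 Suc_eq_plus1)
    have "x \<bullet> (f ^^ (h + Suc h)) x = (f ^^ h) x \<bullet> f ((f ^^ h) x)"
      by (simp only: self_adjoint_funpow_add[OF sa]) simp
    moreover have "x \<bullet> (f ^^ (Suc h + Suc h)) x = f ((f ^^ h) x) \<bullet> f ((f ^^ h) x)"
      by (simp only: self_adjoint_funpow_add[OF sa]) simp
    ultimately show ?thesis using sq[of "(f ^^ h) x"] h by simp
  qed
qed

section \<open>Inverses and rank-one updates\<close>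

lemma inverse_of_linear:
  assumes "linear M" "inverse_of M R"
  shows "linear R"
proof (rule linearI)
  have MR: "M (R x) = x" and RM: "R (M x) = x" for x using assms(2) by (auto simp: inverse_of_def)
  show "R (x + y) = R x + R y" for x y
    by (metis MR RM linear_add[OF assms(1)])
  show "R (c *\<^sub>R x) = c *\<^sub>R R x" for c x
    by (metis MR RM linear_cmul[OF assms(1)])
qed

lemma inverse_of_self_adjoint:
  assumes "self_adjoint M" "inverse_of M R"
  shows "self_adjoint R"
proof -
  have MR: "M (R x) = x" for x using assms(2) by (auto simp: inverse_of_def)
  have "R x \<bullet> y = x \<bullet> R y" for x y
    by (metis MR self_adjointD(2)[OF assms(1)])
  then show ?thesis using inverse_of_linear[OF self_adjointD(1)[OF assms(1)] assms(2)]
    by (simp add: self_adjoint_def)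
qed

lemma inverse_of_psd:
  assumes "psd M" "inverse_of M R"
  shows "psd R"
proof -
  have MR: "M (R x) = x" for x using assms(2) by (auto simp: inverse_of_def)
  have "0 \<le> x \<bullet> R x" for x
    by (metis MR psdD(3)[OF assms(1)] inner_commute)
  then show ?thesis using inverse_of_self_adjoint[OF psdD(4)[OF assms(1)] assms(2)]
    by (simp add: psd_def)
qed

text \<open>The Sherman-Morrison formula. Both compositions are checked, since in infinite dimension
  a one-sided inverse need not be two-sided.\<close>

lemma inverse_of_rank_one_update:
  assumes "self_adjoint M" "inverse_of M R" and nz: "1 + w * (v \<bullet> R v) \<noteq> 0"
  shows "inverse_of (\<lambda>x. M x + (w * (v \<bullet> x)) *\<^sub>R v)
           (\<lambda>x. R x - (w / (1 + w * (v \<bullet> R v)) * (R v \<bullet> x)) *\<^sub>R R v)"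
proof -
  have MR: "M (R x) = x" and RM: "R (M x) = x" for x using assms(2) by (auto simp: inverse_of_def)
  have linM: "linear M" using assms(1) by (rule self_adjointD)
  have saR: "self_adjoint R" by (rule inverse_of_self_adjoint) (use assms in auto)
  have linR: "linear R" using saR by (rule self_adjointD)
  define q where "q = 1 + w * (v \<bullet> R v)"
  have q: "q \<noteq> 0" using nz by (simp add: q_def)
  have symR: "R v \<bullet> x = v \<bullet> R x" for x using self_adjointD(2)[OF saR] .
  have vRv: "w * (v \<bullet> R v) = q - 1" by (simp add: q_def)
  have 1: "M (R x - (w / q * (R v \<bullet> x)) *\<^sub>R R v) + (w * (v \<bullet> (R x - (w / q * (R v \<bullet> x)) *\<^sub>R R v))) *\<^sub>R v = x" for x
  proof -
    have "w * (v \<bullet> (R x - (w / q * (R v \<bullet> x)) *\<^sub>R R v)) = w * (v \<bullet> R x) - w / q * (v \<bullet> R x) * (w * (v \<bullet> R v))"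
      by (simp add: inner_diff_right symR algebra_simps)
    also have "\<dots> = w / q * (v \<bullet> R x)"
      unfolding vRv using q by (simp add: field_simps)
    finally show ?thesis
      by (simp add: linear_diff[OF linM] linear_cmul[OF linM] MR symR)
  qed
  have 2: "R (M x + (w * (v \<bullet> x)) *\<^sub>R v) - (w / q * (R v \<bullet> (M x + (w * (v \<bullet> x)) *\<^sub>R v))) *\<^sub>R R v = x" for x
  proof -
    have "w / q * (R v \<bullet> (M x + (w * (v \<bullet> x)) *\<^sub>R v)) = w / q * (v \<bullet> x) + w / q * (v \<bullet> x) * (w * (v \<bullet> R v))"
      by (simp add: inner_add_right symR RM linear_add[OF linR] linear_cmul[OF linR] algebra_simps)
    also have "\<dots> = w * (v \<bullet> x)"
      unfolding vRv using q by (simp add: field_simps)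
    finally show ?thesis
      by (simp add: linear_add[OF linR] linear_cmul[OF linR] RM)
  qed
  show ?thesis unfolding inverse_of_def q_def[symmetric] using 1 2 by auto
qed

text \<open>The operator \<open>a I + \<Sum> w V V^T\<close>, with weights of either sign. On the
  orthogonal complement of all \<open>V f\<close> it is \<open>a\<close> times the identity.\<close>

definition gram :: "real \<Rightarrow> ('b \<Rightarrow> real) \<Rightarrow> ('b \<Rightarrow> 'a::real_inner) \<Rightarrow> 'b set \<Rightarrow> 'a \<Rightarrow> 'a" where
  "gram a w V A x = a *\<^sub>R x + (\<Sum>f\<in>A. (w f * (V f \<bullet> x)) *\<^sub>R V f)"

lemma inner_gram: "y \<bullet> gram a w V A x = a * (y \<bullet> x) + (\<Sum>f\<in>A. w f * (V f \<bullet> y) * (V f \<bullet> x))"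
  by (simp add: gram_def inner_add_right inner_sum_right algebra_simps inner_commute)

lemma self_adjoint_gram: "self_adjoint (gram a w V A)"
proof -
  have "linear (gram a w V A)"
    by (rule linearI) (simp_all add: gram_def inner_add_right scaleR_add_right scaleR_add_left
        distrib_left sum.distrib scaleR_sum_right mult.left_commute)
  moreover have "gram a w V A x \<bullet> y = x \<bullet> gram a w V A y" for x y
    using inner_gram[of y a w V A x] inner_gram[of x a w V A y]
    by (simp add: inner_commute mult_ac)
  ultimately show ?thesis by (simp add: self_adjoint_def)
qed

text \<open>Rank-one terms are added one by one, those of nonnegative weight first. In that phase
  the denominators of the update are at least \<open>1\<close>. Afterwards every intermediate form
  dominates the final one and so is positive definite, whereas a vanishing denominator would make
  the next form vanish at the nonzero vector \<open>R (V f)\<close>.\<close>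

lemma gram_inverse_exists:
  assumes fin: "finite A" "finite B" and AB: "A \<inter> B = {}" and a: "0 < a"
    and wA: "\<And>f. f \<in> A \<Longrightarrow> 0 \<le> w f" and wB: "\<And>f. f \<in> B \<Longrightarrow> w f \<le> 0"
    and pd: "\<And>x. x \<noteq> 0 \<Longrightarrow> 0 < x \<bullet> gram a w V (A \<union> B) x"
  shows "\<exists>R. inverse_of (gram a w V (A \<union> B)) R"
proof -
  have ins: "gram a w V (insert f C) = (\<lambda>x. gram a w V C x + (w f * (V f \<bullet> x)) *\<^sub>R V f)"
    if "finite C" "f \<notin> C" for f C
    using that by (auto simp: gram_def fun_eq_iff)
  have "\<exists>R. inverse_of (gram a w V A) R"
    using fin(1) wA
  proof (induction A)
    case empty
    have "inverse_of (gram a w V {}) (\<lambda>x. (1 / a) *\<^sub>R x)"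
      using a by (simp add: inverse_of_def gram_def)
    then show ?case by blast
  next
    case (insert f C)
    then obtain R where R: "inverse_of (gram a w V C) R" by auto
    have "psd (gram a w V C)"
      unfolding psd_def inner_gram
    proof (intro conjI allI)
      show "self_adjoint (gram a w V C)" by (rule self_adjoint_gram)
      fix x
      show "0 \<le> a * (x \<bullet> x) + (\<Sum>f\<in>C. w f * (V f \<bullet> x) * (V f \<bullet> x))"
        using a insert.prems by (intro add_nonneg_nonneg sum_nonneg) (auto simp: mult.assoc)
    qed
    from psdD(3)[OF inverse_of_psd[OF this R]] insert.prems
    have "1 + w f * (V f \<bullet> R (V f)) \<noteq> 0"
      by (smt (verit, best) insertI1 mult_nonneg_nonneg)
    from inverse_of_rank_one_update[OF self_adjoint_gram R this]
    show ?case unfolding ins[OF insert.hyps] by blast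
  qed
  moreover have "\<exists>R. inverse_of (gram a w V (A \<union> C)) R" if "\<exists>R. inverse_of (gram a w V A) R" "C \<subseteq> B" for C
    using finite_subset[OF that(2) fin(2)] that(2)
  proof (induction C)
    case empty
    then show ?case using that(1) by simp
  next
    case (insert f C)
    then obtain R where R: "inverse_of (gram a w V (A \<union> C)) R" by auto
    have fnot: "f \<notin> A \<union> C" and finAC: "finite (A \<union> C)" using insert AB fin by auto
    have eq: "gram a w V (A \<union> insert f C) = (\<lambda>x. gram a w V (A \<union> C) x + (w f * (V f \<bullet> x)) *\<^sub>R V f)"
      using ins[OF finAC fnot] by simp
    have pos: "0 < x \<bullet> gram a w V (A \<union> D) x" if "x \<noteq> 0" "D \<subseteq> B" for x D
    proof -
      have "(\<Sum>f\<in>A\<union>B. w f * (V f \<bullet> x) * (V f \<bullet> x)) \<le> (\<Sum>f\<in>A\<union>D. w f * (V f \<bullet> x) * (V f \<bullet> x))"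
      proof -
        have "(\<Sum>f\<in>A\<union>B. w f * (V f \<bullet> x) * (V f \<bullet> x)) = (\<Sum>f\<in>A\<union>D. w f * (V f \<bullet> x) * (V f \<bullet> x))
          + (\<Sum>f\<in>B-D. w f * (V f \<bullet> x) * (V f \<bullet> x))"
          using fin that AB by (subst sum.union_disjoint[symmetric]) (auto intro: finite_subset intro!: sum.cong)
        moreover have "(\<Sum>f\<in>B-D. w f * (V f \<bullet> x) * (V f \<bullet> x)) \<le> 0"
          using wB by (intro sum_nonpos) (auto simp: mult.assoc mult_nonpos_nonneg)
        ultimately show ?thesis by simp
      qed
      then show ?thesis using pd[OF that(1)] unfolding inner_gram by simp
    qed
    have "1 + w f * (V f \<bullet> R (V f)) \<noteq> 0"
    proof
      assume z: "1 + w f * (V f \<bullet> R (V f)) = 0"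
      define x where "x = R (V f)"
      have Mx: "gram a w V (A \<union> C) x = V f" using R by (simp add: x_def inverse_of_def)
      have "x \<noteq> 0" using z by (auto simp: x_def)
      from pos[OF this, of "insert f C"] insert.prems
      have "0 < x \<bullet> (V f + (w f * (V f \<bullet> x)) *\<^sub>R V f)" unfolding eq Mx by simp
      also have "\<dots> = (V f \<bullet> x) * (1 + w f * (V f \<bullet> x))"
        by (simp add: inner_add_right algebra_simps inner_commute)
      finally show False using z by (simp add: x_def)
    qed
    from inverse_of_rank_one_update[OF self_adjoint_gram R this]
    show ?case unfolding eq by blast
  qed
  ultimately show ?thesis by blast
qed

section \<open>The truncated Neumann series\<close>

locale orthonormal_family =
  fixes e :: "nat \<Rightarrow> 'a::real_inner" and n :: nat
  assumes orth: "e i \<bullet> e j = (if i = j then 1 else 0)"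
begin

definition trace :: "('a \<Rightarrow> 'a) \<Rightarrow> real" where
  "trace f = (\<Sum>i<n. e i \<bullet> f (e i))"

definition proj :: "'a \<Rightarrow> 'a" where
  "proj x = (\<Sum>i<n. (e i \<bullet> x) *\<^sub>R e i)"

text \<open>The squared norm of \<open>proj (R v)\<close>; it governs the change of the trace of
  \<open>R\<close> under a rank-one update in direction \<open>v\<close>.\<close>

definition energy :: "('a \<Rightarrow> 'a) \<Rightarrow> 'a \<Rightarrow> real" where
  "energy R v = (\<Sum>i<n. (e i \<bullet> R v)\<^sup>2)"

text \<open>The first \<open>N\<close> terms of the expansion of the inverse of \<open>M\<close> in
  powers of \<open>I - M / c\<close>, after taking traces.\<close>

definition neumann :: "real \<Rightarrow> nat \<Rightarrow> ('a \<Rightarrow> 'a) \<Rightarrow> real" where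
  "neumann c N M = (\<Sum>j<N. trace ((\<lambda>x. x - (1 / c) *\<^sub>R M x) ^^ j)) / c"

lemma inner_proj: "i < n \<Longrightarrow> e i \<bullet> proj x = e i \<bullet> x"
  by (simp add: proj_def inner_sum_right orth if_distrib cong: if_cong)

lemma proj_inner: "proj x \<bullet> y = (\<Sum>i<n. (e i \<bullet> x) * (e i \<bullet> y))"
  by (simp add: proj_def inner_sum_left)

lemma proj_inner_proj: "proj x \<bullet> proj y = proj x \<bullet> y"
  by (simp add: proj_inner inner_proj)

lemma proj_proj [simp]: "proj (proj x) = proj x"
proof -
  have "(\<Sum>i<n. (e i \<bullet> proj x) *\<^sub>R e i) = (\<Sum>i<n. (e i \<bullet> x) *\<^sub>R e i)"
    by (intro sum.cong) (auto simp: inner_proj)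
  then have "proj (proj x) = (\<Sum>i<n. (e i \<bullet> x) *\<^sub>R e i)" by (subst proj_def)
  then show ?thesis by (simp only: proj_def[of x, symmetric])
qed

lemma proj_e: "i < n \<Longrightarrow> proj (e i) = e i"
  by (simp add: proj_def orth if_distrib[of "\<lambda>r. r *\<^sub>R _"] cong: if_cong)

lemma linear_proj: "linear proj"
  by (rule linearI) (simp_all add: proj_def inner_add_right scaleR_add_left sum.distrib scaleR_sum_right)

lemma energy_eq: "energy R v = proj (R v) \<bullet> proj (R v)"
  by (simp only: proj_inner_proj proj_inner[of "R v" "R v"] energy_def power2_eq_square)

lemma energy_le: "energy R v \<le> R v \<bullet> R v"
proof -
  have "0 \<le> (R v - proj (R v)) \<bullet> (R v - proj (R v))" by simp
  then show ?thesis
    by (simp add: energy_eq inner_diff_left inner_diff_right proj_inner_proj inner_commute[of "R v" "proj (R v)"])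
qed

lemma energy_nonneg: "0 \<le> energy R v"
  by (simp add: energy_eq)

lemma psd_trace_nonneg: "psd P \<Longrightarrow> 0 \<le> trace P"
  unfolding trace_def by (intro sum_nonneg psdD(3))

text \<open>The largest eigenvalue is at most the trace, shown without eigenvalues: Cauchy-Schwarz
  in the space, then in the form of \<open>P\<close>, after which one factor
  \<open>y \<bullet> P y\<close> cancels.\<close>

lemma psd_trace_bound:
  assumes P: "psd P" and y: "proj y = y"
  shows "y \<bullet> P y \<le> (y \<bullet> y) * trace P"
proof -
  have "(y \<bullet> P y)\<^sup>2 = (y \<bullet> proj (P y))\<^sup>2"
    using proj_inner_proj[of y "P y"] y by simp
  also have "\<dots> \<le> (y \<bullet> y) * (proj (P y) \<bullet> proj (P y))"
    by (rule Cauchy_Schwarz_ineq)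
  also have "proj (P y) \<bullet> proj (P y) = (\<Sum>i<n. (e i \<bullet> P y)\<^sup>2)"
    using energy_eq[of P y] by (simp add: energy_def)
  also have "\<dots> \<le> (\<Sum>i<n. (e i \<bullet> P (e i)) * (y \<bullet> P y))"
    by (intro sum_mono psd_Cauchy_Schwarz[OF P])
  also have "\<dots> = trace P * (y \<bullet> P y)"
    by (simp add: trace_def sum_distrib_right)
  finally have "(y \<bullet> P y) * (y \<bullet> P y) \<le> ((y \<bullet> y) * trace P) * (y \<bullet> P y)"
    by (simp add: power2_eq_square mult_left_mono mult.assoc)
  moreover have "0 \<le> y \<bullet> P y" by (rule psdD(3)[OF P])
  moreover have "0 \<le> (y \<bullet> y) * trace P" using psd_trace_nonneg[OF P] by simp
  ultimately show ?thesis
    by (cases "y \<bullet> P y = 0") auto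
qed

text \<open>The exponents \<open>j \<le> 4 \<Phi> c\<close> alone contribute more than \<open>2 \<Phi>\<close> if \<open>M\<close> is small in the direction \<open>y\<close>.\<close>

lemma neumann_coercive:
  assumes T: "psd (\<lambda>x. x - (1 / c) *\<^sub>R M x)" and c: "0 < c" and Phi: "0 < \<Phi>"
    and le: "neumann c N M \<le> \<Phi>" and N: "4 * \<Phi> * c + 1 \<le> real N" and y: "proj y = y"
  shows "y \<bullet> y / (8 * \<Phi>) \<le> y \<bullet> M y"
proof (rule ccontr)
  assume neg: "\<not> ?thesis"
  define T where "T = (\<lambda>x. x - (1 / c) *\<^sub>R M x)"
  note psdT = T[folded T_def]
  have ny: "y \<noteq> 0" using neg psdD(1)[OF psdT] by (auto simp: T_def linear_0)
  define J where "J = nat \<lfloor>4 * \<Phi> * c\<rfloor> + 1"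
  have pc: "0 < 4 * \<Phi> * c" using c Phi by simp
  then have fl: "real (nat \<lfloor>4 * \<Phi> * c\<rfloor>) \<le> 4 * \<Phi> * c" "4 * \<Phi> * c < real J"
    by (auto simp: J_def) linarith
  have JN: "J \<le> N" using fl(1) N by (simp add: J_def)
  have "1 / 2 \<le> trace (T ^^ j)" if "j < J" for j
  proof -
    have j: "real j \<le> 4 * \<Phi> * c" using that fl(1) by (simp add: J_def)
    \<comment> \<open>Relative to \<open>y \<bullet> y\<close>, the Bernoulli bound loses at most
      \<open>j / (8 * \<Phi> * c)\<close>, which is \<open>1 / 2\<close> at the largest admissible
      \<open>j\<close>.\<close>
    have "y \<bullet> y * (1 / 2) \<le> y \<bullet> y + real j * (y \<bullet> T y - y \<bullet> y)"
    proof -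
      have "y \<bullet> T y - y \<bullet> y = - (y \<bullet> M y) / c"
        by (simp add: T_def inner_diff_right)
      moreover have "real j * ((y \<bullet> M y) / c) \<le> real j * ((y \<bullet> y / (8 * \<Phi>)) / c)"
        using neg c by (intro mult_left_mono divide_right_mono) auto
      moreover have "real j * ((y \<bullet> y / (8 * \<Phi>)) / c) \<le> (4 * \<Phi> * c) * ((y \<bullet> y / (8 * \<Phi>)) / c)"
        using j c Phi by (intro mult_right_mono) auto
      moreover have "(4 * \<Phi> * c) * ((y \<bullet> y / (8 * \<Phi>)) / c) = y \<bullet> y / 2"
        using c Phi by (simp add: field_simps)
      ultimately show ?thesis by simp
    qed
    also have "\<dots> \<le> y \<bullet> (T ^^ j) y" by (rule psd_funpow_convex[OF psdT])
    also have "\<dots> \<le> (y \<bullet> y) * trace (T ^^ j)" by (rule psd_trace_bound[OF psd_funpow[OF psdT] y])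
    finally show ?thesis using ny by simp
  qed
  then have "(\<Sum>j<J. 1 / 2) \<le> (\<Sum>j<J. trace (T ^^ j))" by (intro sum_mono) auto
  also have "\<dots> \<le> (\<Sum>j<N. trace (T ^^ j))"
    using JN by (intro sum_mono2 psd_trace_nonneg psd_funpow psdT) auto
  also have "\<dots> \<le> c * \<Phi>" using le c by (simp add: neumann_def T_def field_simps)
  finally show False using fl(2) c Phi by (simp add: field_simps)
qed

text \<open>All \<open>V f\<close> lie in the span of the first \<open>n\<close> vectors. On its
  complement the operator is \<open>a\<close> times the identity, and there are no cross
  terms.\<close>

lemma gram_proj_coercive:
  assumes V: "\<And>f. f \<in> A \<Longrightarrow> proj (V f) = V f" and a: "\<mu> \<le> a"
    and co: "\<And>y. proj y = y \<Longrightarrow> \<mu> * (y \<bullet> y) \<le> y \<bullet> gram a w V A y"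
  shows "\<mu> * (x \<bullet> x) \<le> x \<bullet> gram a w V A x"
proof -
  define y where "y = proj x"
  define z where "z = x - y"
  have x: "x = y + z" and py: "proj y = y" by (simp_all add: z_def y_def)
  have yz: "y \<bullet> z = 0"
    by (simp add: y_def z_def inner_diff_right proj_inner_proj)
  have Vz: "V f \<bullet> z = 0" if "f \<in> A" for f
    using V[OF that] proj_inner_proj[of "V f" x] by (simp add: z_def y_def inner_diff_right)
  have "x \<bullet> gram a w V A x = a * (x \<bullet> x) + (\<Sum>f\<in>A. w f * (V f \<bullet> y) * (V f \<bullet> y))"
    unfolding inner_gram by (simp add: x inner_add_right Vz)
  also have "\<dots> = a * (z \<bullet> z) + y \<bullet> gram a w V A y"
    unfolding inner_gram using yz by (simp add: x inner_add_left inner_add_right inner_commute algebra_simps)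
  also have "\<dots> \<ge> \<mu> * (z \<bullet> z) + \<mu> * (y \<bullet> y)"
    using a co[OF py] by (intro add_mono mult_right_mono) auto
  finally show ?thesis using yz by (simp add: x inner_add_left inner_add_right inner_commute algebra_simps)
qed

text \<open>With \<open>T = I - M / c\<close>, the identity \<open>R x = x / c + R (T x)\<close>
  telescopes. Since \<open>R\<close> commutes with \<open>T\<close>, the remainder after an even
  number of terms can be written with \<open>T ^^ h\<close> on both sides of \<open>R\<close>, which
  exhibits its sign.\<close>

lemma neumann_remainder:
  assumes sa: "self_adjoint M" and inv: "inverse_of M R" and c: "c \<noteq> 0"
  shows "trace R = neumann c (h + h) M
    + (\<Sum>i<n. ((\<lambda>x. x - (1 / c) *\<^sub>R M x) ^^ h) (e i) \<bullet> R (((\<lambda>x. x - (1 / c) *\<^sub>R M x) ^^ h) (e i)))"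
proof -
  define T where "T = (\<lambda>x. x - (1 / c) *\<^sub>R M x)"
  have MR: "M (R x) = x" and RM: "R (M x) = x" for x using inv by (auto simp: inverse_of_def)
  have linM: "linear M" using sa by (rule self_adjointD)
  have linR: "linear R" by (rule inverse_of_linear[OF linM inv])
  have RT: "R (T x) = R x - (1 / c) *\<^sub>R x" for x
    by (simp add: T_def linear_diff[OF linR] linear_cmul[OF linR] RM)
  have TR: "T (R x) = R x - (1 / c) *\<^sub>R x" for x
    by (simp add: T_def MR)
  have comm: "R ((T ^^ j) x) = (T ^^ j) (R x)" for j x
  proof (induction j)
    case (Suc j)
    then show ?case using RT[of "(T ^^ j) x"] TR[of "(T ^^ j) x"] TR[of "R ((T ^^ j) x)"]
      by (metis RT TR comp_apply funpow.simps(2))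
  qed simp
  have "linear T"
    unfolding T_def by (rule linearI) (simp_all add: linear_add[OF linM] linear_cmul[OF linM] algebra_simps)
  then have saT: "self_adjoint T"
    by (simp add: self_adjoint_def T_def inner_diff_left inner_diff_right self_adjointD(2)[OF sa])
  have tele: "R x = (1 / c) *\<^sub>R (\<Sum>j<N. (T ^^ j) x) + R ((T ^^ N) x)" for N x
  proof (induction N)
    case (Suc N)
    have "R ((T ^^ Suc N) x) = R ((T ^^ N) x) - (1 / c) *\<^sub>R (T ^^ N) x" by (simp add: RT)
    then show ?case using Suc by (simp add: scaleR_add_right)
  qed simp
  have "e i \<bullet> R (e i) = (1 / c) * (\<Sum>j<h+h. e i \<bullet> (T ^^ j) (e i)) + (T ^^ h) (e i) \<bullet> R ((T ^^ h) (e i))" for i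
  proof -
    have "e i \<bullet> R (e i) = (1 / c) * (\<Sum>j<h+h. e i \<bullet> (T ^^ j) (e i)) + e i \<bullet> R ((T ^^ (h + h)) (e i))"
      by (subst tele[of _ "h + h"]) (simp add: inner_add_right inner_sum_right)
    also have "e i \<bullet> R ((T ^^ (h + h)) (e i)) = e i \<bullet> (T ^^ h) (R ((T ^^ h) (e i)))"
      by (simp add: funpow_add comm)
    also have "\<dots> = (T ^^ h) (e i) \<bullet> R ((T ^^ h) (e i))"
      by (simp add: self_adjointD(2)[OF self_adjoint_funpow[OF saT]])
    finally show ?thesis .
  qed
  then have "trace R = (\<Sum>i<n. (1 / c) * (\<Sum>j<h+h. e i \<bullet> (T ^^ j) (e i))) + (\<Sum>i<n. (T ^^ h) (e i) \<bullet> R ((T ^^ h) (e i)))"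
    by (simp add: trace_def sum.distrib)
  also have "(\<Sum>i<n. (1 / c) * (\<Sum>j<h+h. e i \<bullet> (T ^^ j) (e i))) = neumann c (h + h) M"
    unfolding neumann_def trace_def T_def sum_distrib_left sum_divide_distrib
    by (subst sum.swap) simp
  finally show ?thesis by (simp add: T_def)
qed

lemma neumann_le_trace:
  assumes "self_adjoint M" "inverse_of M R" "psd R" "c \<noteq> 0" "even N"
  shows "neumann c N M \<le> trace R"
proof -
  obtain h where N: "N = h + h" using assms(5) by (metis evenE mult_2)
  show ?thesis unfolding N neumann_remainder[OF assms(1,2,4), of h]
    by (simp add: sum_nonneg psdD(3)[OF assms(3)])
qed

text \<open>The remainder is at most \<open>trace (T ^^ N) / \<mu>\<close>. The traces of powers
  decrease, so the last one is at most the mean of the first \<open>N\<close>, and this mean is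
  \<open>c / N\<close> times the computed value. The error is inversely proportional to
  \<open>N\<close>, enough for polynomially many terms.\<close>

lemma trace_le_neumann:
  assumes T: "psd (\<lambda>x. x - (1 / c) *\<^sub>R M x)" and sa: "self_adjoint M" and inv: "inverse_of M R"
    and c: "0 < c" and mu: "0 < \<mu>" and N: "even N" "0 < N"
    and co: "\<And>x. \<mu> * (x \<bullet> x) \<le> x \<bullet> M x"
  shows "trace R \<le> neumann c N M + c * neumann c N M / (\<mu> * real N)"
proof -
  obtain h where h: "N = h + h" using N(1) by (metis evenE mult_2)
  define T where "T = (\<lambda>x. x - (1 / c) *\<^sub>R M x)"
  note psdT = T[folded T_def]
  have MR: "M (R x) = x" for x using inv by (auto simp: inverse_of_def)
  \<comment> \<open>Coercivity at \<open>R x\<close> bounds \<open>R x \<bullet> R x\<close> by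
    \<open>(x \<bullet> R x) / \<mu>\<close>; Cauchy-Schwarz then bounds \<open>R\<close> itself by
    \<open>1 / \<mu>\<close>.\<close>
  have R: "x \<bullet> R x \<le> (x \<bullet> x) / \<mu>" for x
  proof (cases "0 < x \<bullet> R x")
    case True
    have "\<mu> * (R x \<bullet> R x) \<le> x \<bullet> R x" using co[of "R x"] by (simp add: MR inner_commute)
    then have "(x \<bullet> x) * (R x \<bullet> R x) \<le> (x \<bullet> x) * ((x \<bullet> R x) / \<mu>)"
      using mu by (intro mult_left_mono) (auto simp: field_simps)
    with Cauchy_Schwarz_ineq[of x "R x"]
    have "(x \<bullet> R x) * (x \<bullet> R x) \<le> ((x \<bullet> x) / \<mu>) * (x \<bullet> R x)"
      by (simp add: power2_eq_square)
    then show ?thesis using True by (rule mult_right_le_imp_le)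
  next
    case False
    then show ?thesis using mu by (smt (verit) divide_nonneg_pos inner_ge_zero)
  qed
  have le: "x \<bullet> T x \<le> x \<bullet> x" for x
  proof -
    have "0 \<le> x \<bullet> M x" using co[of x] mu by (smt (verit) mult_nonneg_nonneg inner_ge_zero)
    then show ?thesis using c by (simp add: T_def inner_diff_right)
  qed
  have dec: "trace (T ^^ N) \<le> trace (T ^^ j)" if "j \<le> N" for j
  proof -
    have "decseq (\<lambda>j. trace (T ^^ j))"
      unfolding decseq_Suc_iff trace_def
      by (intro allI sum_mono psd_funpow_Suc_le[OF psdT le])
    then show ?thesis using that by (auto dest: decseqD)
  qed
  have "(\<Sum>j<N. trace (T ^^ N)) \<le> (\<Sum>j<N. trace (T ^^ j))"
    by (intro sum_mono dec) auto
  then have trN: "trace (T ^^ N) \<le> c * neumann c N M / N"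
    using N(2) c by (simp add: neumann_def T_def field_simps)
  have "(\<Sum>i<n. (T ^^ h) (e i) \<bullet> R ((T ^^ h) (e i))) \<le> (\<Sum>i<n. ((T ^^ h) (e i) \<bullet> (T ^^ h) (e i)) / \<mu>)"
    by (intro sum_mono R)
  also have "\<dots> = trace (T ^^ N) / \<mu>"
    unfolding trace_def h self_adjoint_funpow_add[OF psdD(4)[OF psdT]] sum_divide_distrib ..
  also have "\<dots> \<le> (c * neumann c N M / N) / \<mu>"
    using trN mu by (intro divide_right_mono) auto
  finally show ?thesis
    using neumann_remainder[OF sa inv, of c h] c by (simp add: h T_def mult.commute)
qed

end

section \<open>Averaging over the remaining edges\<close>

lemma gram_add: "gram a w V A x + gram a' w' V A x = gram (a + a') (\<lambda>f. w f + w' f) V A x"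
  by (simp add: gram_def scaleR_add_left distrib_right sum.distrib)

lemma psd_gram: "0 \<le> a \<Longrightarrow> (\<And>f. f \<in> A \<Longrightarrow> 0 \<le> w f) \<Longrightarrow> psd (gram a w V A)"
  unfolding psd_def inner_gram
  by (auto intro!: self_adjoint_gram add_nonneg_nonneg sum_nonneg simp: mult.assoc)

lemma gram_cong: "a = a' \<Longrightarrow> (\<And>f. f \<in> A \<Longrightarrow> w f = w' f) \<Longrightarrow> gram a w V A = gram a' w' V A"
  by (auto simp: gram_def fun_eq_iff intro!: sum.cong)

context orthonormal_family
begin

text \<open>The resolvent identity, used twice, gives \<open>R = R' + R' B R' + R' B R B R'\<close>.
  The last term is nonnegative because \<open>R\<close> is, and is dropped.\<close>

lemma trace_decrease:
  assumes sa: "self_adjoint M" "self_adjoint M'" and inv: "inverse_of M R" "inverse_of M' R'" and R: "psd R"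
    and M': "\<And>x. M' x = M x + B x" and B: "self_adjoint B"
  shows "trace R' + (\<Sum>i<n. R' (e i) \<bullet> B (R' (e i))) \<le> trace R"
proof -
  have MR: "M (R x) = x" and RM: "R (M x) = x" and MR': "M' (R' x) = x" and RM': "R' (M' x) = x" for x
    using inv by (auto simp: inverse_of_def)
  note linR = psdD(1)[OF R]
  note saR' = inverse_of_self_adjoint[OF sa(2) inv(2)]
  note linR' = self_adjointD(1)[OF saR']
  have 1: "R x = R' x + R (B (R' x))" for x
  proof -
    have "R (M' (R' x)) = R' x + R (B (R' x))" by (simp add: M' linear_add[OF linR] RM)
    then show ?thesis by (simp add: MR')
  qed
  have 2: "R x = R' x + R' (B (R x))" for x
  proof -
    have "R' (M' (R x)) = R' x + R' (B (R x))" by (simp add: M' linear_add[OF linR'] MR)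
    then show ?thesis by (simp add: RM')
  qed
  have "e i \<bullet> R' (e i) + R' (e i) \<bullet> B (R' (e i)) \<le> e i \<bullet> R (e i)" for i
  proof -
    define z where "z = B (R' (e i))"
    have "e i \<bullet> R (e i) = e i \<bullet> R' (e i) + e i \<bullet> R z"
      unfolding z_def by (subst 1) (rule inner_add_right)
    also have "e i \<bullet> R z = e i \<bullet> R' z + e i \<bullet> R' (B (R z))"
      by (subst 2) (rule inner_add_right)
    also have "e i \<bullet> R' (e i) + (e i \<bullet> R' z + e i \<bullet> R' (B (R z))) =
        e i \<bullet> R' (e i) + e i \<bullet> R' z + e i \<bullet> R' (B (R z))" by simp
    finally have "e i \<bullet> R (e i) = e i \<bullet> R' (e i) + e i \<bullet> R' z + e i \<bullet> R' (B (R z))" .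
    moreover have "e i \<bullet> R' z = R' (e i) \<bullet> z" using self_adjointD(2)[OF saR'] by simp
    moreover have "e i \<bullet> R' (B (R z)) = z \<bullet> R z"
      using self_adjointD(2)[OF saR', of "e i"] self_adjointD(2)[OF B, of "R' (e i)"] by (simp add: z_def)
    ultimately show ?thesis using psdD(3)[OF R, of z] by (simp add: z_def)
  qed
  then have "(\<Sum>i<n. e i \<bullet> R' (e i) + R' (e i) \<bullet> B (R' (e i))) \<le> (\<Sum>i<n. e i \<bullet> R (e i))"
    by (rule sum_mono)
  then show ?thesis by (simp add: trace_def sum.distrib)
qed

lemma energy_alt: "self_adjoint R \<Longrightarrow> energy R v = (\<Sum>i<n. (v \<bullet> R (e i))\<^sup>2)"
  unfolding energy_def by (metis inner_commute self_adjointD(2))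

text \<open>In the correction of \<open>trace_decrease\<close>, the multiple of the identity
  contributes full squared norms, which dominate the energies, and each rank-one term contributes
  exactly its energy.\<close>

lemma trace_decrease_gram:
  assumes sa: "self_adjoint M" "self_adjoint M'" and inv: "inverse_of M R" "inverse_of M' R'" and R: "psd R"
    and M': "\<And>x. M' x = M x + gram a w V A x" and a: "0 \<le> a"
  shows "trace R' + a * (\<Sum>i<n. energy R' (e i)) + (\<Sum>f\<in>A. w f * energy R' (V f)) \<le> trace R"
proof -
  note saR' = inverse_of_self_adjoint[OF sa(2) inv(2)]
  have "a * (\<Sum>i<n. energy R' (e i)) \<le> (\<Sum>i<n. a * (R' (e i) \<bullet> R' (e i)))"
    unfolding sum_distrib_left using a energy_le by (intro sum_mono mult_left_mono) auto
  moreover have "(\<Sum>f\<in>A. w f * energy R' (V f)) = (\<Sum>f\<in>A. \<Sum>i<n. w f * (V f \<bullet> R' (e i))\<^sup>2)"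
    by (simp add: energy_alt[OF saR', of "V _"] sum_distrib_left)
  ultimately have "a * (\<Sum>i<n. energy R' (e i)) + (\<Sum>f\<in>A. w f * energy R' (V f))
      \<le> (\<Sum>i<n. a * (R' (e i) \<bullet> R' (e i))) + (\<Sum>f\<in>A. \<Sum>i<n. w f * (V f \<bullet> R' (e i))\<^sup>2)"
    by simp
  also have "\<dots> = (\<Sum>i<n. R' (e i) \<bullet> gram a w V A (R' (e i)))"
    unfolding inner_gram sum.distrib by (subst sum.swap) (simp add: power2_eq_square mult.assoc)
  finally show ?thesis
    using trace_decrease[OF sa inv R M' self_adjoint_gram] by simp
qed

text \<open>Sherman-Morrison with weight \<open>- \<gamma>\<close>. By \<open>lt\<close> the
  denominator is positive, so a nonnegative rank-one term is added to \<open>R\<close> and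
  positivity persists.\<close>

lemma rank_one_downdate:
  assumes sa: "self_adjoint M" and inv: "inverse_of M R" and R: "psd R" and g: "0 \<le> \<gamma>"
    and lt: "\<gamma> * (v \<bullet> R v) < 1"
  shows "\<exists>R2. inverse_of (\<lambda>x. M x - (\<gamma> * (v \<bullet> x)) *\<^sub>R v) R2 \<and> psd R2 \<and>
    trace R2 = trace R + \<gamma> * energy R v / (1 - \<gamma> * (v \<bullet> R v))"
proof -
  define k where "k = \<gamma> / (1 - \<gamma> * (v \<bullet> R v))"
  define R2 where "R2 = (\<lambda>x. R x + (k * (R v \<bullet> x)) *\<^sub>R R v)"
  have k: "0 \<le> k" using g lt by (simp add: k_def)
  have "inverse_of (\<lambda>x. M x + (- \<gamma> * (v \<bullet> x)) *\<^sub>R v)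
      (\<lambda>x. R x - (- \<gamma> / (1 + - \<gamma> * (v \<bullet> R v)) * (R v \<bullet> x)) *\<^sub>R R v)"
    by (rule inverse_of_rank_one_update[OF sa inv]) (use lt in simp)
  then have 1: "inverse_of (\<lambda>x. M x - (\<gamma> * (v \<bullet> x)) *\<^sub>R v) R2"
    by (simp add: R2_def k_def)
  note linR = psdD(1)[OF R]
  have "linear R2"
    unfolding R2_def by (rule linearI)
      (simp_all add: linear_add[OF linR] linear_cmul[OF linR] inner_add_right algebra_simps)
  moreover have "0 \<le> k * r * r" for r using k by (simp add: mult.assoc)
  ultimately have 2: "psd R2"
    using psdD(2,3)[OF R]
    by (auto simp: psd_def self_adjoint_def R2_def inner_add_left inner_add_right inner_commute)
  have "trace R2 = trace R + k * energy R v"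
    by (simp add: trace_def energy_def R2_def inner_add_right sum.distrib sum_distrib_left power2_eq_square
        inner_commute mult_ac)
  then show ?thesis using 1 2 by (auto simp: k_def)
qed

text \<open>Since \<open>e i \<bullet> R (M (e i)) = 1\<close>, Cauchy-Schwarz for the form of
  \<open>R\<close> bounds \<open>1\<close> by the product of the two diagonal entries.\<close>

lemma inverse_diag_ge:
  assumes M: "psd M" and inv: "inverse_of M R" and le: "e i \<bullet> M (e i) \<le> c" and c: "0 < c"
  shows "1 / c \<le> e i \<bullet> R (e i)"
proof -
  have RM: "R (M x) = x" for x using inv by (auto simp: inverse_of_def)
  note R = inverse_of_psd[OF M inv]
  have "1 \<le> (e i \<bullet> R (e i)) * (e i \<bullet> M (e i))"
    using psd_Cauchy_Schwarz[OF R, of "e i" "M (e i)"] by (simp add: RM orth inner_commute)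
  also have "\<dots> \<le> (e i \<bullet> R (e i)) * c"
    using le psdD(3)[OF R] by (intro mult_left_mono)
  finally show ?thesis using c by (simp add: field_simps)
qed

text \<open>Replaces the vector of an edge by its two endpoints, at the cost of a factor
  \<open>2\<close>; sums over edges become sums over vertices.\<close>

lemma parallelogram_bound:
  assumes R: "psd R" and s: "\<bar>\<sigma>\<bar> = 1"
  shows "(a + \<sigma> *\<^sub>R b) \<bullet> R (a + \<sigma> *\<^sub>R b) \<le> 2 * (a \<bullet> R a) + 2 * (b \<bullet> R b)"
    and "energy R (a + \<sigma> *\<^sub>R b) \<le> 2 * energy R a + 2 * energy R b"
proof -
  note lin = psdD(1)[OF R]
  have ss: "\<sigma> * \<sigma> = 1" using s by (metis abs_mult_self_eq mult_1)
  have "0 \<le> (a - \<sigma> *\<^sub>R b) \<bullet> R (a - \<sigma> *\<^sub>R b)" by (rule psdD(3)[OF R])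
  moreover have "(a - \<sigma> *\<^sub>R b) \<bullet> R (a - \<sigma> *\<^sub>R b) + (a + \<sigma> *\<^sub>R b) \<bullet> R (a + \<sigma> *\<^sub>R b) = 2 * (a \<bullet> R a) + 2 * (\<sigma> * \<sigma>) * (b \<bullet> R b)"
    by (simp add: linear_diff[OF lin] linear_add[OF lin] linear_cmul[OF lin] inner_add_left inner_add_right
        inner_diff_left inner_diff_right algebra_simps)
  ultimately show "(a + \<sigma> *\<^sub>R b) \<bullet> R (a + \<sigma> *\<^sub>R b) \<le> 2 * (a \<bullet> R a) + 2 * (b \<bullet> R b)"
    by (simp add: ss)
  have "energy R (a + \<sigma> *\<^sub>R b) \<le> (\<Sum>i<n. 2 * (e i \<bullet> R a)\<^sup>2 + 2 * (e i \<bullet> R b)\<^sup>2)"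
    unfolding energy_def
  proof (intro sum_mono)
    fix i
    have "(e i \<bullet> R (a + \<sigma> *\<^sub>R b))\<^sup>2 + (e i \<bullet> R a - \<sigma> * (e i \<bullet> R b))\<^sup>2 = 2 * (e i \<bullet> R a)\<^sup>2 + 2 * (\<sigma> * \<sigma>) * (e i \<bullet> R b)\<^sup>2"
      by (simp add: linear_add[OF lin] linear_cmul[OF lin] inner_add_right power2_eq_square algebra_simps)
    then show "(e i \<bullet> R (a + \<sigma> *\<^sub>R b))\<^sup>2 \<le> 2 * (e i \<bullet> R a)\<^sup>2 + 2 * (e i \<bullet> R b)\<^sup>2"
      by (simp add: ss) (smt (verit) zero_le_power2)
  qed
  also have "\<dots> = 2 * energy R a + 2 * energy R b"
    by (simp add: energy_def sum.distrib sum_distrib_left)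
  finally show "energy R (a + \<sigma> *\<^sub>R b) \<le> 2 * energy R a + 2 * energy R b" .
qed

end

text \<open>Double counting: \<open>g i\<close> occurs once for each incidence of \<open>i\<close>,
  hence at most \<open>d\<close> times.\<close>

lemma sum_incidence_le:
  fixes g :: "nat \<Rightarrow> real"
  assumes fin: "finite A" and lt: "\<And>f. f \<in> A \<Longrightarrow> u f < n \<and> v f < n"
    and deg: "\<And>i. i < n \<Longrightarrow> real (card {f\<in>A. u f = i}) + real (card {f\<in>A. v f = i}) \<le> d"
    and g: "\<And>i. i < n \<Longrightarrow> 0 \<le> g i"
  shows "(\<Sum>f\<in>A. g (u f) + g (v f)) \<le> d * (\<Sum>i<n. g i)"
proof -
  have *: "(\<Sum>f\<in>A. g (z f)) = (\<Sum>i<n. real (card {f\<in>A. z f = i}) * g i)" if "\<And>f. f \<in> A \<Longrightarrow> z f < n" for z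
  proof -
    have "(\<Sum>f\<in>A. g (z f)) = (\<Sum>i\<in>{..<n}. \<Sum>f\<in>{f\<in>A. z f = i}. g (z f))"
      using that by (intro sum.group[symmetric] fin) auto
    also have "\<dots> = (\<Sum>i<n. real (card {f\<in>A. z f = i}) * g i)"
      by (intro sum.cong refl) simp
    finally show ?thesis .
  qed
  have "(\<Sum>f\<in>A. g (u f) + g (v f)) = (\<Sum>i<n. (real (card {f\<in>A. u f = i}) + real (card {f\<in>A. v f = i})) * g i)"
    using *[of u] *[of v] lt by (simp add: sum.distrib distrib_right)
  also have "\<dots> \<le> (\<Sum>i<n. d * g i)"
    using deg g by (intro sum_mono mult_right_mono) auto
  finally show ?thesis by (simp add: sum_distrib_left)
qed

text \<open>The edge obtained satisfies \<open>\<tau> f / (1 - \<alpha> f) \<le> s\<close>, an increase of the potential which the shift of the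
  barrier has paid for.\<close>

lemma average_choice:
  fixes \<tau> \<alpha> :: "'b \<Rightarrow> real"
  assumes fin: "finite A" "A \<noteq> {}" and s: "0 < s"
    and avg: "(\<Sum>f\<in>A. \<tau> f) / s + (\<Sum>f\<in>A. \<alpha> f) \<le> real (card A)"
  obtains f where "f \<in> A" "\<tau> f / s + \<alpha> f \<le> 1"
proof (rule ccontr)
  assume "\<not> thesis"
  with that have "\<And>f. f \<in> A \<Longrightarrow> 1 < \<tau> f / s + \<alpha> f" by force
  then have "(\<Sum>f\<in>A. 1) < (\<Sum>f\<in>A. \<tau> f / s + \<alpha> f)" using fin by (intro sum_strict_mono) auto
  then show False using avg by (simp add: sum.distrib sum_divide_distrib)
qed

context orthonormal_family
begin

text \<open>\<open>M'\<close> adds to \<open>M\<close> the shift \<open>2 * \<delta>\<close> and the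
  mean over \<open>A\<close> of the rank-one terms, so that subtracting the term of a random edge is
  centred. The mean and half of the shift pay for the trace increase caused by some edge; the other
  half remains as the gain \<open>2 * real n * \<delta> / c\<^sup>2\<close>. The condition
  \<open>small\<close> controls the second-order effect, the denominators of the updates.\<close>

lemma potential_step:
  fixes M M' R :: "real \<Rightarrow> 'a \<Rightarrow> 'a" and u v :: "'b \<Rightarrow> nat"
  defines "V \<equiv> \<lambda>\<sigma> f. e (u f) + \<sigma> *\<^sub>R e (v f)"
  defines "S \<equiv> {1, - 1 :: real}"
  assumes fin: "finite E" "A \<subseteq> E" "A \<noteq> {}" and n: "0 < n"
    and lt: "\<And>f. f \<in> A \<Longrightarrow> u f < n \<and> v f < n"
    and deg: "\<And>i. i < n \<Longrightarrow> real (card {f\<in>A. u f = i}) + real (card {f\<in>A. v f = i}) \<le> d"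
    and pos: "0 < \<gamma>" "0 < \<delta>" "0 < c" "0 \<le> d"
    and sa: "\<And>\<sigma>. \<sigma> \<in> S \<Longrightarrow> self_adjoint (M \<sigma>)" "\<And>\<sigma>. \<sigma> \<in> S \<Longrightarrow> psd (M' \<sigma>)"
    and inv: "\<And>\<sigma>. \<sigma> \<in> S \<Longrightarrow> inverse_of (M \<sigma>) (R \<sigma>)" "\<And>\<sigma>. \<sigma> \<in> S \<Longrightarrow> psd (R \<sigma>)"
      "\<And>\<sigma>. \<sigma> \<in> S \<Longrightarrow> \<exists>R'. inverse_of (M' \<sigma>) R'"
    and M': "\<And>\<sigma> x. \<sigma> \<in> S \<Longrightarrow> M' \<sigma> x = M \<sigma> x + gram (2 * \<delta>) (\<lambda>f. if f \<in> A then \<gamma> / card A else 0) (V \<sigma>) E x"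
    and le: "\<And>\<sigma> i. \<sigma> \<in> S \<Longrightarrow> i < n \<Longrightarrow> e i \<bullet> M' \<sigma> (e i) \<le> c"
    and small: "2 * d * \<gamma> / card A * (\<Sum>\<sigma>\<in>S. trace (R \<sigma>)) * (2 * d * \<gamma> / card A + \<delta>) \<le> \<delta>"
  shows "\<exists>f\<in>A. \<exists>R2. (\<forall>\<sigma>\<in>S. inverse_of (\<lambda>x. M' \<sigma> x - (\<gamma> * (V \<sigma> f \<bullet> x)) *\<^sub>R V \<sigma> f) (R2 \<sigma>) \<and> psd (R2 \<sigma>)) \<and>
    (\<Sum>\<sigma>\<in>S. trace (R2 \<sigma>)) + 2 * real n * \<delta> / c\<^sup>2 \<le> (\<Sum>\<sigma>\<in>S. trace (R \<sigma>))"
proof -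
  obtain R' where R': "\<And>\<sigma>. \<sigma> \<in> S \<Longrightarrow> inverse_of (M' \<sigma>) (R' \<sigma>)" using inv(3) by metis
  have psdR': "psd (R' \<sigma>)" if "\<sigma> \<in> S" for \<sigma> using inverse_of_psd[OF sa(2) R'] that by blast
  have finA: "finite A" using fin finite_subset by blast
  have cA: "0 < real (card A)" using finA fin by (simp add: card_gt_0_iff)
  have finS: "finite S" and cS: "card S = 2" by (simp_all add: S_def)
  define \<beta> where "\<beta> = 2 * d * \<gamma> / card A"
  have \<beta>: "0 \<le> \<beta>" using pos by (simp add: \<beta>_def)
  \<comment> \<open>The squared Frobenius norms of the two inverses compressed to the first
    \<open>n\<close> coordinates; shifting by a multiple of the identity lowers the trace at this
    rate.\<close>
  define Fr where "Fr = (\<Sum>\<sigma>\<in>S. \<Sum>i<n. energy (R' \<sigma>) (e i))"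
  \<comment> \<open>\<open>\<tau> f\<close> collects the numerators of the updates at
    \<open>f\<close> and \<open>\<alpha> f\<close> what their denominators lose, over both signs, so
    that one edge is good for both.\<close>
  define \<tau> where "\<tau> f = (\<Sum>\<sigma>\<in>S. \<gamma> * energy (R' \<sigma>) (V \<sigma> f))" for f
  define \<alpha> where "\<alpha> f = (\<Sum>\<sigma>\<in>S. \<gamma> * (V \<sigma> f \<bullet> R' \<sigma> (V \<sigma> f)))" for f
  \<comment> \<open>The increase that is paid for: the mean of \<open>\<tau>\<close> and half of the
    shift.\<close>
  define s where "s = (\<Sum>f\<in>A. \<tau> f) / card A + \<delta> * Fr"
  define tR where "tR = (\<Sum>\<sigma>\<in>S. trace (R \<sigma>))"
  define tR' where "tR' = (\<Sum>\<sigma>\<in>S. trace (R' \<sigma>))"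
  have \<tau>0: "0 \<le> \<tau> f" for f unfolding \<tau>_def using pos energy_nonneg by (intro sum_nonneg mult_nonneg_nonneg) auto
  have Fr_ge: "2 * real n / c\<^sup>2 \<le> Fr"
  proof -
    have "1 / c\<^sup>2 \<le> energy (R' \<sigma>) (e i)" if "\<sigma> \<in> S" "i < n" for \<sigma> i
    proof -
      have "1 / c \<le> e i \<bullet> R' \<sigma> (e i)"
        using inverse_diag_ge[OF sa(2) R' le] that pos by blast
      then have "(1 / c)\<^sup>2 \<le> (e i \<bullet> R' \<sigma> (e i))\<^sup>2" using pos by (intro power_mono) auto
      also have "\<dots> \<le> energy (R' \<sigma>) (e i)"
        unfolding energy_def using that by (intro member_le_sum) auto
      finally show ?thesis by (simp add: power_divide)
    qed
    then have "(\<Sum>\<sigma>\<in>S. \<Sum>i<n. 1 / c\<^sup>2) \<le> Fr" unfolding Fr_def by (intro sum_mono) auto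
    then show ?thesis by (simp add: cS)
  qed
  have Fr: "0 < Fr"
    using Fr_ge n pos by (smt (verit) divide_pos_pos of_nat_0_less_iff zero_less_power)
  have s: "0 < s"
    unfolding s_def using Fr pos \<tau>0 by (intro add_nonneg_pos divide_nonneg_nonneg sum_nonneg) auto
  have dec: "tR' + 2 * \<delta> * Fr + (\<Sum>f\<in>A. \<tau> f) / card A \<le> tR"
  proof -
    have "trace (R' \<sigma>) + 2 * \<delta> * (\<Sum>i<n. energy (R' \<sigma>) (e i)) + (\<Sum>f\<in>A. \<gamma> / card A * energy (R' \<sigma>) (V \<sigma> f)) \<le> trace (R \<sigma>)"
      if "\<sigma> \<in> S" for \<sigma>
    proof -
      have "(\<Sum>f\<in>A. \<gamma> / card A * energy (R' \<sigma>) (V \<sigma> f))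
        = (\<Sum>f\<in>E. (if f \<in> A then \<gamma> / card A else 0) * energy (R' \<sigma>) (V \<sigma> f))"
        using fin by (intro sum.mono_neutral_cong_left) auto
      with trace_decrease_gram[OF sa(1) psdD(4)[OF sa(2)] inv(1) R' inv(2) M'] that pos
      show ?thesis by simp
    qed
    then have "(\<Sum>\<sigma>\<in>S. trace (R' \<sigma>) + 2 * \<delta> * (\<Sum>i<n. energy (R' \<sigma>) (e i)) + (\<Sum>f\<in>A. \<gamma> / card A * energy (R' \<sigma>) (V \<sigma> f))) \<le> tR"
      unfolding tR_def by (intro sum_mono)
    moreover have "(\<Sum>\<sigma>\<in>S. \<Sum>f\<in>A. \<gamma> / card A * energy (R' \<sigma>) (V \<sigma> f)) = (\<Sum>f\<in>A. \<tau> f) / card A"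
      unfolding \<tau>_def sum_divide_distrib by (subst sum.swap) simp
    ultimately show ?thesis by (simp add: sum.distrib tR'_def Fr_def sum_distrib_left)
  qed
  have tau_le: "(\<Sum>f\<in>A. \<tau> f) / card A \<le> \<beta> * Fr"
  proof -
    have "(\<Sum>f\<in>A. energy (R' \<sigma>) (V \<sigma> f)) \<le> 2 * d * (\<Sum>i<n. energy (R' \<sigma>) (e i))" if "\<sigma> \<in> S" for \<sigma>
    proof -
      have "(\<Sum>f\<in>A. energy (R' \<sigma>) (V \<sigma> f)) \<le> (\<Sum>f\<in>A. 2 * energy (R' \<sigma>) (e (u f)) + 2 * energy (R' \<sigma>) (e (v f)))"
        unfolding V_def using that by (intro sum_mono parallelogram_bound psdR') (auto simp: S_def)
      also have "\<dots> \<le> d * (\<Sum>i<n. 2 * energy (R' \<sigma>) (e i))"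
        by (rule sum_incidence_le[OF finA lt deg, where g = "\<lambda>i. 2 * energy (R' \<sigma>) (e i)"])
          (auto simp: energy_nonneg)
      finally show ?thesis by (simp add: sum_distrib_left mult_ac)
    qed
    then have "(\<Sum>\<sigma>\<in>S. \<gamma> * (\<Sum>f\<in>A. energy (R' \<sigma>) (V \<sigma> f))) \<le> (\<Sum>\<sigma>\<in>S. \<gamma> * (2 * d * (\<Sum>i<n. energy (R' \<sigma>) (e i))))"
      using pos by (intro sum_mono mult_left_mono) auto
    moreover have "(\<Sum>\<sigma>\<in>S. \<gamma> * (\<Sum>f\<in>A. energy (R' \<sigma>) (V \<sigma> f))) = (\<Sum>f\<in>A. \<tau> f)"
      unfolding \<tau>_def sum_distrib_left by (subst sum.swap) simp
    moreover have "(\<Sum>\<sigma>\<in>S. \<gamma> * (2 * d * (\<Sum>i<n. energy (R' \<sigma>) (e i)))) = card A * (\<beta> * Fr)"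
    proof -
      have "card A * (\<beta> * Fr) = \<gamma> * (2 * d * Fr)" using cA by (simp add: \<beta>_def)
      then show ?thesis by (simp add: Fr_def sum_distrib_left)
    qed
    ultimately show ?thesis using cA by (simp add: field_simps)
  qed
  have al_le: "(\<Sum>f\<in>A. \<alpha> f) \<le> card A * (\<beta> * tR')"
  proof -
    have "(\<Sum>f\<in>A. V \<sigma> f \<bullet> R' \<sigma> (V \<sigma> f)) \<le> 2 * d * trace (R' \<sigma>)" if "\<sigma> \<in> S" for \<sigma>
    proof -
      have "(\<Sum>f\<in>A. V \<sigma> f \<bullet> R' \<sigma> (V \<sigma> f)) \<le> (\<Sum>f\<in>A. 2 * (e (u f) \<bullet> R' \<sigma> (e (u f))) + 2 * (e (v f) \<bullet> R' \<sigma> (e (v f))))"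
        unfolding V_def using that by (intro sum_mono parallelogram_bound psdR') (auto simp: S_def)
      also have "\<dots> \<le> d * (\<Sum>i<n. 2 * (e i \<bullet> R' \<sigma> (e i)))"
        by (rule sum_incidence_le[OF finA lt deg, where g = "\<lambda>i. 2 * (e i \<bullet> R' \<sigma> (e i))"])
          (auto simp: psdD(3)[OF psdR'[OF that]])
      finally show ?thesis by (simp add: sum_distrib_left trace_def mult_ac)
    qed
    then have "(\<Sum>\<sigma>\<in>S. \<gamma> * (\<Sum>f\<in>A. V \<sigma> f \<bullet> R' \<sigma> (V \<sigma> f))) \<le> (\<Sum>\<sigma>\<in>S. \<gamma> * (2 * d * trace (R' \<sigma>)))"
      using pos by (intro sum_mono mult_left_mono) auto
    moreover have "(\<Sum>\<sigma>\<in>S. \<gamma> * (\<Sum>f\<in>A. V \<sigma> f \<bullet> R' \<sigma> (V \<sigma> f))) = (\<Sum>f\<in>A. \<alpha> f)"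
      unfolding \<alpha>_def sum_distrib_left by (subst sum.swap) simp
    moreover have "(\<Sum>\<sigma>\<in>S. \<gamma> * (2 * d * trace (R' \<sigma>))) = card A * (\<beta> * tR')"
    proof -
      have "card A * (\<beta> * tR') = \<gamma> * (2 * d * tR')" using cA by (simp add: \<beta>_def)
      then show ?thesis by (simp add: tR'_def sum_distrib_left)
    qed
    ultimately show ?thesis by simp
  qed
  \<comment> \<open>From \<open>tau_le\<close> follows
    \<open>s \<le> (\<beta> + \<delta>) * Fr\<close>, and \<open>dec\<close> gives
    \<open>tR' \<le> tR\<close>; with these the claim reduces to \<open>small\<close>.\<close>
  have small': "\<beta> * tR' \<le> \<delta> * Fr / s"
  proof -
    have "0 \<le> (\<Sum>f\<in>A. \<tau> f) / card A" using \<tau>0 by (intro divide_nonneg_nonneg sum_nonneg) auto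
    then have "tR' \<le> tR" using dec Fr pos by (smt (verit) mult_pos_pos)
    then have "\<beta> * tR' * (\<beta> + \<delta>) \<le> \<beta> * tR * (\<beta> + \<delta>)"
      using \<beta> pos by (intro mult_right_mono mult_left_mono) auto
    also have "\<dots> \<le> \<delta>" using small by (simp add: \<beta>_def tR_def)
    finally have "\<beta> * tR' * (\<beta> + \<delta>) * Fr \<le> \<delta> * Fr" using Fr by simp
    moreover have "\<beta> * tR' * s \<le> \<beta> * tR' * ((\<beta> + \<delta>) * Fr)"
    proof (intro mult_left_mono mult_nonneg_nonneg \<beta>)
      show "s \<le> (\<beta> + \<delta>) * Fr" using tau_le by (simp add: s_def algebra_simps)
      show "0 \<le> tR'" unfolding tR'_def by (intro sum_nonneg psd_trace_nonneg psdR')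
    qed
    ultimately show ?thesis using s by (simp add: field_simps)
  qed
  \<comment> \<open>The budget \<open>1\<close> per edge is split into
    \<open>(s - \<delta> * Fr) / s\<close> for \<open>\<tau>\<close> and
    \<open>\<delta> * Fr / s\<close> for \<open>\<alpha>\<close>.\<close>
  have "(\<Sum>f\<in>A. \<tau> f) / s + (\<Sum>f\<in>A. \<alpha> f) \<le> card A"
  proof -
    have "(\<Sum>f\<in>A. \<tau> f) / s + (\<Sum>f\<in>A. \<alpha> f) \<le> card A * ((s - \<delta> * Fr) / s) + card A * (\<delta> * Fr / s)"
    proof (intro add_mono)
      show "(\<Sum>f\<in>A. \<tau> f) / s \<le> card A * ((s - \<delta> * Fr) / s)"
        using cA by (simp add: s_def)
      show "(\<Sum>f\<in>A. \<alpha> f) \<le> card A * (\<delta> * Fr / s)"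
        using al_le small' cA by (smt (verit) mult_left_mono)
    qed
    also have "\<dots> = card A * ((s - \<delta> * Fr) / s + \<delta> * Fr / s)" by (simp only: distrib_left)
    also have "(s - \<delta> * Fr) / s + \<delta> * Fr / s = 1" using s by (simp add: add_divide_distrib[symmetric])
    finally show ?thesis by simp
  qed
  then obtain f where f: "f \<in> A" "\<tau> f / s + \<alpha> f \<le> 1"
    using average_choice[OF finA fin(3) s] by metis
  have al0: "0 \<le> \<gamma> * (V \<sigma> f \<bullet> R' \<sigma> (V \<sigma> f))" if "\<sigma> \<in> S" for \<sigma>
    using pos psdD(3)[OF psdR'[OF that]] by simp
  \<comment> \<open>Averaging alone yields \<open>\<alpha> f \<le> 1\<close>, with equality only if
    \<open>\<tau> f = 0\<close>. In that case the image of the edge vector is orthogonal to both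
    endpoints, so \<open>\<alpha> f\<close> is \<open>0\<close>.\<close>
  have al1: "\<alpha> f < 1"
  proof (cases "\<tau> f = 0")
    case True
    have "V \<sigma> f \<bullet> R' \<sigma> (V \<sigma> f) = 0" if "\<sigma> \<in> S" for \<sigma>
    proof -
      have "\<gamma> * energy (R' \<sigma>) (V \<sigma> f) = 0"
        using True that unfolding \<tau>_def using pos energy_nonneg finS
        by (subst (asm) sum_nonneg_eq_0_iff) auto
      then have "e i \<bullet> R' \<sigma> (V \<sigma> f) = 0" if "i < n" for i
        using that pos by (simp add: energy_def sum_nonneg_eq_0_iff)
      then have z: "e (u f) \<bullet> R' \<sigma> (V \<sigma> f) = 0" "e (v f) \<bullet> R' \<sigma> (V \<sigma> f) = 0"
        using lt[OF f(1)] by auto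
      have "V \<sigma> f \<bullet> x = e (u f) \<bullet> x + \<sigma> * (e (v f) \<bullet> x)" for x
        by (simp only: V_def inner_add_left inner_scaleR_left)
      then show ?thesis by (simp only: z)
    qed
    then show ?thesis by (simp add: \<alpha>_def)
  next
    case False
    with \<tau>0[of f] s have "0 < \<tau> f / s" by simp
    then show ?thesis using f(2) by simp
  qed
  have le_al: "\<gamma> * (V \<sigma> f \<bullet> R' \<sigma> (V \<sigma> f)) \<le> \<alpha> f" if "\<sigma> \<in> S" for \<sigma>
    unfolding \<alpha>_def using that finS al0 by (intro member_le_sum) auto
  have "\<exists>R2. inverse_of (\<lambda>x. M' \<sigma> x - (\<gamma> * (V \<sigma> f \<bullet> x)) *\<^sub>R V \<sigma> f) R2 \<and> psd R2 \<and>
      trace R2 \<le> trace (R' \<sigma>) + \<gamma> * energy (R' \<sigma>) (V \<sigma> f) / (1 - \<alpha> f)" if "\<sigma> \<in> S" for \<sigma>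
  proof -
    have "\<gamma> * (V \<sigma> f \<bullet> R' \<sigma> (V \<sigma> f)) < 1" using le_al[OF that] al1 by simp
    from rank_one_downdate[OF psdD(4)[OF sa(2)[OF that]] R'[OF that] psdR'[OF that] _ this] pos
    obtain R2 where R2: "inverse_of (\<lambda>x. M' \<sigma> x - (\<gamma> * (V \<sigma> f \<bullet> x)) *\<^sub>R V \<sigma> f) R2" "psd R2"
      "trace R2 = trace (R' \<sigma>) + \<gamma> * energy (R' \<sigma>) (V \<sigma> f) / (1 - \<gamma> * (V \<sigma> f \<bullet> R' \<sigma> (V \<sigma> f)))"
      by auto
    have "\<gamma> * energy (R' \<sigma>) (V \<sigma> f) / (1 - \<gamma> * (V \<sigma> f \<bullet> R' \<sigma> (V \<sigma> f))) \<le> \<gamma> * energy (R' \<sigma>) (V \<sigma> f) / (1 - \<alpha> f)"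
      using le_al[OF that] al1 pos energy_nonneg by (intro divide_left_mono mult_pos_pos) auto
    then show ?thesis using R2 by auto
  qed
  then have "\<forall>\<sigma>\<in>S. \<exists>R2. inverse_of (\<lambda>x. M' \<sigma> x - (\<gamma> * (V \<sigma> f \<bullet> x)) *\<^sub>R V \<sigma> f) R2 \<and> psd R2 \<and>
      trace R2 \<le> trace (R' \<sigma>) + \<gamma> * energy (R' \<sigma>) (V \<sigma> f) / (1 - \<alpha> f)" by blast
  from bchoice[OF this] obtain R2 where R2: "\<And>\<sigma>. \<sigma> \<in> S \<Longrightarrow> inverse_of (\<lambda>x. M' \<sigma> x - (\<gamma> * (V \<sigma> f \<bullet> x)) *\<^sub>R V \<sigma> f) (R2 \<sigma>)"
      "\<And>\<sigma>. \<sigma> \<in> S \<Longrightarrow> psd (R2 \<sigma>)"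
      "\<And>\<sigma>. \<sigma> \<in> S \<Longrightarrow> trace (R2 \<sigma>) \<le> trace (R' \<sigma>) + \<gamma> * energy (R' \<sigma>) (V \<sigma> f) / (1 - \<alpha> f)"
    by blast
  have "(\<Sum>\<sigma>\<in>S. trace (R2 \<sigma>)) \<le> (\<Sum>\<sigma>\<in>S. trace (R' \<sigma>) + \<gamma> * energy (R' \<sigma>) (V \<sigma> f) / (1 - \<alpha> f))"
    using R2(3) by (rule sum_mono)
  also have "\<dots> = tR' + \<tau> f / (1 - \<alpha> f)"
    by (simp add: sum.distrib tR'_def \<tau>_def sum_divide_distrib)
  also have "\<tau> f / (1 - \<alpha> f) \<le> s"
  proof -
    have "\<tau> f / s \<le> 1 - \<alpha> f" using f(2) by simp
    then show ?thesis using s al1 by (simp add: field_simps)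
  qed
  also have "tR' + s \<le> tR - \<delta> * Fr"
    using dec unfolding s_def by (simp add: algebra_simps)
  finally have "(\<Sum>\<sigma>\<in>S. trace (R2 \<sigma>)) + \<delta> * Fr \<le> tR" by simp
  moreover have "\<delta> * (2 * real n / c\<^sup>2) \<le> \<delta> * Fr" using Fr_ge pos by (intro mult_left_mono) auto
  ultimately have "(\<Sum>\<sigma>\<in>S. trace (R2 \<sigma>)) + 2 * real n * \<delta> / c\<^sup>2 \<le> tR" by (simp add: mult_ac)
  then show ?thesis using f(1) R2(1,2) unfolding tR_def by blast
qed

end

section \<open>Finitely supported vectors\<close>

text \<open>One inner product space for all dimensions, whose unit vectors form the infinite
  orthonormal family that \<open>orthonormal_family\<close> asks for.\<close>

typedef fin_vec = "{f :: nat \<Rightarrow> real. finite {i. f i \<noteq> 0}}"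
  by (rule exI[of _ "\<lambda>_. 0"]) simp

setup_lifting type_definition_fin_vec

lift_definition coord :: "fin_vec \<Rightarrow> nat \<Rightarrow> real" is "\<lambda>f. f" .

lemma fin_vec_eqI: "(\<And>i. coord x i = coord y i) \<Longrightarrow> x = y"
  by transfer auto

lemma finite_coord: "finite {i. coord x i \<noteq> 0}"
  by transfer auto

instantiation fin_vec :: real_vector
begin

lift_definition zero_fin_vec :: fin_vec is "\<lambda>_. 0" by simp
lift_definition plus_fin_vec :: "fin_vec \<Rightarrow> fin_vec \<Rightarrow> fin_vec" is "\<lambda>f g i. f i + g i"
  subgoal for f g by (rule finite_subset[of _ "{i. f i \<noteq> 0} \<union> {i. g i \<noteq> 0}"]) auto
  done
lift_definition minus_fin_vec :: "fin_vec \<Rightarrow> fin_vec \<Rightarrow> fin_vec" is "\<lambda>f g i. f i - g i"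
  subgoal for f g by (rule finite_subset[of _ "{i. f i \<noteq> 0} \<union> {i. g i \<noteq> 0}"]) auto
  done
lift_definition uminus_fin_vec :: "fin_vec \<Rightarrow> fin_vec" is "\<lambda>f i. - f i"
  by simp
lift_definition scaleR_fin_vec :: "real \<Rightarrow> fin_vec \<Rightarrow> fin_vec" is "\<lambda>c f i. c * f i"
  by (rule finite_subset) auto

instance
  by standard (transfer, simp add: algebra_simps fun_eq_iff)+

end

lemma coord_simps [simp]:
  "coord 0 i = 0" "coord (x + y) i = coord x i + coord y i" "coord (x - y) i = coord x i - coord y i"
  "coord (- x) i = - coord x i" "coord (c *\<^sub>R x) i = c * coord x i"
  by (transfer, simp)+

lemma coord_sum: "coord (\<Sum>f\<in>A. g f) i = (\<Sum>f\<in>A. coord (g f) i)"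
  by (induction A rule: infinite_finite_induct) auto

instantiation fin_vec :: real_inner
begin

definition inner_fin_vec :: "fin_vec \<Rightarrow> fin_vec \<Rightarrow> real" where
  "inner_fin_vec x y = (\<Sum>i | coord x i \<noteq> 0. coord x i * coord y i)"
definition norm_fin_vec :: "fin_vec \<Rightarrow> real" where
  "norm_fin_vec x = sqrt (inner x x)"
definition dist_fin_vec :: "fin_vec \<Rightarrow> fin_vec \<Rightarrow> real" where
  "dist_fin_vec x y = norm (x - y)"
definition sgn_fin_vec :: "fin_vec \<Rightarrow> fin_vec" where
  "sgn_fin_vec x = inverse (norm x) *\<^sub>R x"
definition uniformity_fin_vec :: "(fin_vec \<times> fin_vec) filter" where
  "uniformity_fin_vec = (INF e\<in>{0 <..}. principal {(x, y). dist x y < e})"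
definition open_fin_vec :: "fin_vec set \<Rightarrow> bool" where
  "open_fin_vec U \<longleftrightarrow> (\<forall>x\<in>U. eventually (\<lambda>(x', y). x' = x \<longrightarrow> y \<in> U) uniformity)"

lemma inner_fin_vec_superset:
  assumes "finite S" "{i. coord x i \<noteq> 0} \<subseteq> S"
  shows "inner x y = (\<Sum>i\<in>S. coord x i * coord y i)"
  unfolding inner_fin_vec_def using assms by (intro sum.mono_neutral_left) auto

instance
proof
  fix x y z :: fin_vec and r :: real
  show "dist x y = norm (x - y)" by (rule dist_fin_vec_def)
  show "sgn x = inverse (norm x) *\<^sub>R x" by (rule sgn_fin_vec_def)
  show "uniformity = (INF e\<in>{0 <..}. principal {(x :: fin_vec, y). dist x y < e})"
    by (rule uniformity_fin_vec_def)
  show "open U \<longleftrightarrow> (\<forall>x\<in>U. eventually (\<lambda>(x', y). x' = x \<longrightarrow> y \<in> U) uniformity)" for U :: "fin_vec set"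
    by (rule open_fin_vec_def)
  show "norm x = sqrt (inner x x)" by (rule norm_fin_vec_def)
  define S where "S = {i. coord x i \<noteq> 0} \<union> {i. coord y i \<noteq> 0} \<union> {i. coord z i \<noteq> 0}"
  have S: "finite S" by (simp add: S_def finite_coord)
  have sup: "inner w w' = (\<Sum>i\<in>S. coord w i * coord w' i)" if "\<And>i. i \<notin> S \<Longrightarrow> coord w i = 0" for w w'
    using that by (intro inner_fin_vec_superset S) auto
  have x: "i \<notin> S \<Longrightarrow> coord x i = 0" "i \<notin> S \<Longrightarrow> coord y i = 0" for i by (auto simp: S_def)
  show "inner x y = inner y x" using x by (simp add: sup mult.commute)
  show "inner (x + y) z = inner x z + inner y z" using x by (simp add: sup distrib_right sum.distrib)
  show "inner (r *\<^sub>R x) y = r * inner x y" using x by (simp add: sup sum_distrib_left mult.assoc)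
  show "0 \<le> inner x x" by (simp add: inner_fin_vec_def sum_nonneg)
  show "inner x x = 0 \<longleftrightarrow> x = 0"
    using finite_coord[of x] by (auto simp: inner_fin_vec_def sum_nonneg_eq_0_iff intro: fin_vec_eqI)
qed

end

lift_definition unit :: "nat \<Rightarrow> fin_vec" is "\<lambda>i j. if j = i then 1 else 0"
  by simp

lemma coord_unit: "coord (unit i) j = (if j = i then 1 else 0)"
  by transfer simp

lemma inner_unit: "unit i \<bullet> x = coord x i"
  by (simp add: inner_fin_vec_superset[of "{i}"] coord_unit)

interpretation fv: orthonormal_family unit n for n
  by standard (simp add: inner_unit coord_unit)

section \<open>Upper bounds for weighted edge sums\<close>

context orthonormal_family
begin

definition edge_vec :: "('b \<Rightarrow> nat) \<Rightarrow> ('b \<Rightarrow> nat) \<Rightarrow> real \<Rightarrow> 'b \<Rightarrow> 'a" where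
  "edge_vec u v \<sigma> f = e (u f) + \<sigma> *\<^sub>R e (v f)"

text \<open>Weights at most \<open>1\<close> leave at most the unweighted sum, and signed and
  unsigned Laplacians are at most \<open>2 * d\<close> by passing to endpoints and double
  counting.\<close>

lemma gram_upper:
  assumes fin: "finite A" and s: "\<bar>\<sigma>\<bar> = 1" and lt: "\<And>f. f \<in> A \<Longrightarrow> u f < n \<and> v f < n"
    and deg: "\<And>i. i < n \<Longrightarrow> real (card {f\<in>A. u f = i}) + real (card {f\<in>A. v f = i}) \<le> d"
    and w: "\<And>f. f \<in> A \<Longrightarrow> w f \<le> 1" and d: "0 \<le> d"
  shows "x \<bullet> gram a w (edge_vec u v \<sigma>) A x \<le> (a + 2 * d) * (x \<bullet> x)"
proof -
  have ss: "\<sigma> * \<sigma> = 1" using s by (metis abs_mult_self_eq mult_1)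
  have "w f * (edge_vec u v \<sigma> f \<bullet> x) * (edge_vec u v \<sigma> f \<bullet> x) \<le> 2 * (e (u f) \<bullet> x)\<^sup>2 + 2 * (e (v f) \<bullet> x)\<^sup>2"
    if "f \<in> A" for f
  proof -
    define g where "g = edge_vec u v \<sigma> f \<bullet> x"
    have A: "w f * g * g \<le> 1 * (g * g)"
      unfolding mult.assoc using w[OF that] by (intro mult_right_mono) auto
    have "g * g + (e (u f) \<bullet> x - \<sigma> * (e (v f) \<bullet> x))\<^sup>2 = 2 * (e (u f) \<bullet> x)\<^sup>2 + 2 * (\<sigma> * \<sigma>) * (e (v f) \<bullet> x)\<^sup>2"
      by (simp add: g_def edge_vec_def inner_add_left power2_eq_square algebra_simps)
    with zero_le_power2[of "e (u f) \<bullet> x - \<sigma> * (e (v f) \<bullet> x)"]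
    have "g * g \<le> 2 * (e (u f) \<bullet> x)\<^sup>2 + 2 * (e (v f) \<bullet> x)\<^sup>2" unfolding ss by linarith
    with A show ?thesis unfolding g_def[symmetric] by linarith
  qed
  then have "(\<Sum>f\<in>A. w f * (edge_vec u v \<sigma> f \<bullet> x) * (edge_vec u v \<sigma> f \<bullet> x))
      \<le> (\<Sum>f\<in>A. 2 * (e (u f) \<bullet> x)\<^sup>2 + 2 * (e (v f) \<bullet> x)\<^sup>2)"
    by (rule sum_mono)
  also have "\<dots> \<le> d * (\<Sum>i<n. 2 * (e i \<bullet> x)\<^sup>2)"
    by (rule sum_incidence_le[OF fin lt deg, where g = "\<lambda>i. 2 * (e i \<bullet> x)\<^sup>2"]) auto
  also have "\<dots> = 2 * d * energy (\<lambda>x. x) x" by (simp add: energy_def sum_distrib_left mult_ac)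
  also have "\<dots> \<le> 2 * d * (x \<bullet> x)" using d energy_le[of "\<lambda>x. x" x] by (intro mult_left_mono) auto
  finally show ?thesis by (simp add: inner_gram algebra_simps)
qed

lemma neumann_nonneg: "0 < c \<Longrightarrow> psd (\<lambda>x. x - (1 / c) *\<^sub>R M x) \<Longrightarrow> 0 \<le> neumann c N M"
  unfolding neumann_def by (intro divide_nonneg_pos sum_nonneg psd_trace_nonneg psd_funpow)

lemma psd_contraction:
  assumes sa: "self_adjoint M" and c: "0 < c" and le: "\<And>x. x \<bullet> M x \<le> c * (x \<bullet> x)"
  shows "psd (\<lambda>x. x - (1 / c) *\<^sub>R M x)"
proof -
  note lin = self_adjointD(1)[OF sa]
  have "linear (\<lambda>x. x - (1 / c) *\<^sub>R M x)"
    by (rule linearI) (simp_all add: linear_add[OF lin] linear_cmul[OF lin] algebra_simps)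
  moreover have "0 \<le> x \<bullet> (x - (1 / c) *\<^sub>R M x)" for x
    using le[of x] c by (simp add: inner_diff_right field_simps)
  ultimately show ?thesis
    by (simp add: psd_def self_adjoint_def inner_diff_left inner_diff_right self_adjointD(2)[OF sa])
qed

end

section \<open>The barrier argument\<close>

text \<open>\<open>k\<close> of order \<open>n / \<eta>^2\<close> makes the potential small compared
  with \<open>m / d\<close>; the factor \<open>1000\<close> leaves room in all later estimates.
  \<open>2 * k \<le> m\<close> keeps the number of remaining edges of order \<open>m\<close> and the
  weights at most \<open>1\<close>.\<close>

locale barrier = orthonormal_family e n for e :: "nat \<Rightarrow> 'a::real_inner" and n :: nat +
  fixes m k :: nat and u v :: "nat \<Rightarrow> nat" and d \<eta> :: real
  assumes lt: "f < m \<Longrightarrow> u f < n \<and> v f < n"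
    and deg: "i < n \<Longrightarrow> real (card {f. f < m \<and> u f = i}) + real (card {f. f < m \<and> v f = i}) \<le> d"
    and n: "0 < n" and d: "1 \<le> d" and eta: "0 < \<eta>" "\<eta> < 1"
    and k: "1000 * real n \<le> \<eta>\<^sup>2 * real k" and km: "2 * k \<le> m"
begin

text \<open>\<open>M t P \<sigma>\<close> is the distance to the barrier after the set \<open>P\<close> of \<open>t\<close> edges has been chosen, for the
  signed (\<open>\<sigma> = -1\<close>) and the unsigned (\<open>\<sigma> = 1\<close>) Laplacian. The weights make
  the expected change of the part without the identity vanish for a uniformly chosen further edge.\<close>

definition wt :: "nat \<Rightarrow> nat set \<Rightarrow> nat \<Rightarrow> real" where
  "wt t P f = (if f \<in> P then - 1 else real t / (real m - real t))"

definition M :: "nat \<Rightarrow> nat set \<Rightarrow> real \<Rightarrow> 'a \<Rightarrow> 'a" where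
  "M t P \<sigma> = gram (\<eta> * d / m * (real k + real t)) (wt t P) (edge_vec u v \<sigma>) {..<m}"

text \<open>Even, so that the remainder has a sign. Cubic, because \<open>\<Phi>\<close> is at most
  of order \<open>m / d\<close>, and the truncation error of order
  \<open>d * \<Phi>\<^sup>2 / N\<close> must stay below the gain of one step, of order
  \<open>n * \<eta> / (d * m)\<close>.\<close>

definition N :: nat where "N = 2 * m ^ 3"

text \<open>The scale \<open>3 * d\<close> bounds the spectrum for both signs while
  \<open>t \<le> k\<close>, see \<open>M_le\<close>.\<close>

definition pot :: "nat \<Rightarrow> nat set \<Rightarrow> real" where
  "pot t P = (\<Sum>\<sigma>\<in>{1, - 1}. neumann (3 * d) N (M t P \<sigma>))"

text \<open>The exact potential at the start: for each sign, the trace over \<open>n\<close>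
  coordinates of the inverse of \<open>\<eta> * d * k / m\<close> times the identity.\<close>

definition \<Phi> :: real where "\<Phi> = 2 * real n * m / (\<eta> * d * k)"

lemma k_pos: "0 < k"
  using k n by (metis bot_nat_0.not_eq_extremum mult_eq_0_iff mult_pos_pos not_le of_nat_0 of_nat_0_less_iff zero_less_numeral)

lemma m_pos: "0 < m" using k_pos km by simp

lemma Phi_pos: "0 < \<Phi>"
  using n m_pos eta d k_pos by (simp add: \<Phi>_def)

lemma self_adjoint_M: "self_adjoint (M t P \<sigma>)"
  unfolding M_def by (rule self_adjoint_gram)

lemma wt_le: "t \<le> k \<Longrightarrow> wt t P f \<le> 1"
  using km m_pos by (auto simp: wt_def field_simps)

lemma deg': "i < n \<Longrightarrow> real (card {f\<in>{..<m}. u f = i}) + real (card {f\<in>{..<m}. v f = i}) \<le> d"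
  using deg by simp

lemma M_le:
  assumes t: "t \<le> k" and s: "\<bar>\<sigma>\<bar> = 1"
  shows "x \<bullet> M t P \<sigma> x \<le> 3 * d * (x \<bullet> x)"
proof -
  have "\<eta> * (real k + real t) \<le> 1 * real m"
    using t km eta by (intro mult_mono) auto
  then have "\<eta> * d / m * (real k + real t) \<le> d"
    using d m_pos mult_right_mono[of "\<eta> * (real k + real t)" "real m" d] by (simp add: field_simps)
  then have "(\<eta> * d / m * (real k + real t) + 2 * d) * (x \<bullet> x) \<le> 3 * d * (x \<bullet> x)"
    by (intro mult_right_mono) auto
  moreover have "x \<bullet> M t P \<sigma> x \<le> (\<eta> * d / m * (real k + real t) + 2 * d) * (x \<bullet> x)"
    unfolding M_def using gram_upper[where A = "{..<m}", OF _ s _ deg' wt_le[OF t]] lt d by auto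
  ultimately show ?thesis by linarith
qed

lemma contraction:
  assumes t: "t \<le> k" and s: "\<bar>\<sigma>\<bar> = 1"
  shows "psd (\<lambda>x. x - (1 / (3 * d)) *\<^sub>R M t P \<sigma> x)"
  using psd_contraction[OF self_adjoint_M _ M_le[OF t s]] d by simp

lemma ratio: "real n / (\<eta> * k) \<le> \<eta> / 1000" "1000 * real n \<le> \<eta> * k" "1000 \<le> \<eta> * k"
proof -
  have "\<eta> * \<eta> * k \<le> 1 * \<eta> * k" using eta by (intro mult_right_mono) auto
  then show "1000 * real n \<le> \<eta> * k" using k by (simp add: power2_eq_square)
  then show "1000 \<le> \<eta> * k" using of_nat_mono[of 1 n, where ?'a = real] n by linarith
  show "real n / (\<eta> * k) \<le> \<eta> / 1000" using k k_pos eta by (simp add: field_simps power2_eq_square)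
qed

lemma Phi_eq: "\<Phi> = 2 * (real n / (\<eta> * k)) * (m / d)"
  by (simp add: \<Phi>_def)

text \<open>\<open>24 * d * \<Phi>\<close> is \<open>c / \<mu>\<close> for \<open>c = 3 * d\<close>
  and \<open>\<mu> = 1 / (8 * \<Phi>)\<close>, the numerator of the relative truncation error; it is
  also twice the \<open>4 * \<Phi> * c\<close> in \<open>neumann_coercive\<close>.\<close>

lemma N_large: "24 * d * \<Phi> + 1 \<le> real N"
proof -
  have "24 * d * \<Phi> = 48 * (real n / (\<eta> * k)) * m" using d by (simp add: Phi_eq)
  also have "\<dots> \<le> 48 * (\<eta> / 1000) * m" using ratio by (intro mult_right_mono mult_left_mono) auto
  also have "\<dots> \<le> 1 * real m" using eta by (intro mult_right_mono) auto
  finally have "24 * d * \<Phi> \<le> real m" by simp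
  moreover have "real m + 1 \<le> real (2 * m ^ 3)"
  proof -
    have "m ^ 1 \<le> m ^ 3" using m_pos by (intro power_increasing) auto
    then have "m + 1 \<le> 2 * m ^ 3" using m_pos by simp
    then have "real (m + 1) \<le> real (2 * m ^ 3)" by (simp only: of_nat_le_iff)
    then show ?thesis by simp
  qed
  ultimately show ?thesis by (simp add: N_def)
qed

text \<open>The right-hand side is the gain of \<open>potential_step\<close> for
  \<open>\<delta> = \<eta> * d / (2 * m)\<close> and \<open>c = 3 * d\<close>, so each step pays for
  its own truncation error. Of the two factors \<open>r\<close>, one is traded for \<open>n\<close>
  and the other for \<open>\<eta>\<close>.\<close>

lemma error_le: "24 * d * \<Phi>\<^sup>2 / N \<le> 2 * real n * (\<eta> * d / (2 * m)) / (3 * d)\<^sup>2"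
proof -
  define r where "r = real n / (\<eta> * k)"
  have r: "0 \<le> r" "r \<le> \<eta> / 1000" "r \<le> real n / 1000"
    using ratio eta n by (auto simp: r_def field_simps intro: mult_left_mono)
  have "24 * d * \<Phi>\<^sup>2 / N = 48 * (r * r) / (d * m)"
    using d m_pos by (simp add: Phi_eq r_def[symmetric] N_def power2_eq_square power3_eq_cube field_simps)
  also have "\<dots> \<le> 48 * ((real n / 1000) * (\<eta> / 1000)) / (d * m)"
    using r d by (intro divide_right_mono mult_left_mono mult_mono) auto
  also have "\<dots> \<le> real n * \<eta> / (9 * (d * m))"
    using d m_pos eta by (simp add: field_simps)
  also have "\<dots> = 2 * real n * (\<eta> * d / (2 * m)) / (3 * d)\<^sup>2"
    using d m_pos by (simp add: power2_eq_square field_simps)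
  finally show ?thesis .
qed

lemma error_le_Phi: "24 * d * \<Phi>\<^sup>2 / N \<le> \<Phi>"
proof -
  have "0 < real N" using m_pos by (simp add: N_def)
  then have "24 * d * \<Phi> / N \<le> 1" using N_large by simp
  then have "24 * d * \<Phi> / N * \<Phi> \<le> 1 * \<Phi>" using Phi_pos by (intro mult_right_mono) auto
  then show ?thesis by (simp add: power2_eq_square)
qed

text \<open>The hypothesis \<open>small\<close> of \<open>potential_step\<close>, with total trace
  at most \<open>2 * \<Phi>\<close>. Since \<open>\<beta> \<le> 8 * d / m\<close>, the left side is
  at most \<open>272 * r * (d / m)\<close> with \<open>r \<le> \<eta> / 1000\<close>; here the size
  of \<open>k\<close> is decisive.\<close>

lemma small_cond:
  assumes t: "t < k"
  shows "2 * d * (m / (real m - real t - 1)) / (real m - real t) * (2 * \<Phi>) *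
    (2 * d * (m / (real m - real t - 1)) / (real m - real t) + \<eta> * d / (2 * m)) \<le> \<eta> * d / (2 * m)"
proof -
  define \<beta> where "\<beta> = 2 * d * (m / (real m - real t - 1)) / (real m - real t)"
  have h: "real m / 2 \<le> real m - real t - 1" "real m / 2 \<le> real m - real t" "0 < real m"
    using t km m_pos by auto
  have "m / (real m - real t - 1) \<le> 2" using h by (simp add: field_simps)
  then have "2 * d * (m / (real m - real t - 1)) / (real m - real t) \<le> (2 * d * 2) / (real m / 2)"
    using h d by (intro frac_le mult_left_mono) auto
  then have b: "\<beta> \<le> 8 * d / m" by (simp add: \<beta>_def)
  have b0: "0 \<le> \<beta>" unfolding \<beta>_def using h d by (intro divide_nonneg_nonneg mult_nonneg_nonneg) auto
  define r where "r = real n / (\<eta> * k)"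
  have r: "0 \<le> r" "r \<le> \<eta> / 1000" using ratio eta by (auto simp: r_def)
  have "\<beta> * (2 * \<Phi>) * (\<beta> + \<eta> * d / (2 * m)) \<le> (8 * d / m) * (2 * \<Phi>) * (8 * d / m + 1 * d / (2 * m))"
    using b b0 Phi_pos eta d h by (intro mult_mono add_mono divide_right_mono mult_nonneg_nonneg add_nonneg_nonneg) auto
  also have "\<dots> = 272 * r * (d / m)"
    using d h by (simp add: Phi_eq r_def[symmetric] field_simps)
  also have "\<dots> \<le> 272 * (\<eta> / 1000) * (d / m)" using r d by (intro mult_right_mono mult_left_mono) auto
  also have "\<dots> \<le> \<eta> * d / (2 * m)" using d h eta by (simp add: field_simps)
  finally show ?thesis by (simp add: \<beta>_def)
qed

lemma edge_vec_proj: "f < m \<Longrightarrow> proj (edge_vec u v \<sigma> f) = edge_vec u v \<sigma> f"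
  using lt[of f] by (simp add: edge_vec_def linear_add[OF linear_proj] linear_cmul[OF linear_proj] proj_e)

text \<open>The truncated series gives the bound on the span of the first \<open>n\<close> vectors.
  It extends to the whole space because the multiple of the identity in \<open>M\<close> is itself
  at least \<open>1 / (8 * \<Phi>)\<close>.\<close>

lemma coercive:
  assumes t: "t \<le> k" and s: "\<sigma> \<in> {1, - 1}" and pot: "pot t P \<le> \<Phi>"
  shows "x \<bullet> x / (8 * \<Phi>) \<le> x \<bullet> M t P \<sigma> x"
proof -
  have nn: "0 \<le> neumann (3 * d) N (M t P \<sigma>')" if "\<sigma>' \<in> {1, - 1}" for \<sigma>'
    using that d by (intro neumann_nonneg contraction t) auto
  have "neumann (3 * d) N (M t P \<sigma>) \<le> pot t P"
    unfolding pot_def using s nn by (intro member_le_sum) auto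
  with pot have le: "neumann (3 * d) N (M t P \<sigma>) \<le> \<Phi>" by simp
  have "0 \<le> d * \<Phi>" using d Phi_pos by simp
  then have N: "4 * \<Phi> * (3 * d) + 1 \<le> real N" using N_large by (simp add: mult_ac)
  have co: "1 / (8 * \<Phi>) * (y \<bullet> y) \<le> y \<bullet> M t P \<sigma> y" if "proj y = y" for y
    using neumann_coercive[OF contraction[OF t] _ Phi_pos le N that] s d by auto
  have "1 / (8 * \<Phi>) \<le> \<eta> * d / m * (real k + real t)"
  proof -
    have "1 / (8 * \<Phi>) = \<eta> * d / m * real k * (1 / (16 * n))" by (simp add: \<Phi>_def field_simps)
    also have "\<dots> \<le> \<eta> * d / m * real k * 1"
      using eta d n by (intro mult_left_mono) auto
    also have "\<dots> \<le> \<eta> * d / m * (real k + real t)"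
      using eta d by (simp add: mult_left_mono divide_right_mono)
    finally show ?thesis .
  qed
  from gram_proj_coercive[OF edge_vec_proj this co[unfolded M_def]]
  show ?thesis by (simp add: M_def)
qed

lemma M_posdef:
  assumes "t \<le> k" "\<sigma> \<in> {1, - 1}" "pot t P \<le> \<Phi>" "x \<noteq> 0"
  shows "0 < x \<bullet> M t P \<sigma> x"
proof -
  have "0 < x \<bullet> x / (8 * \<Phi>)" using assms(4) Phi_pos by simp
  with coercive[OF assms(1-3), of x] show ?thesis by simp
qed

lemma M_psd:
  assumes "t \<le> k" "\<sigma> \<in> {1, - 1}" "pot t P \<le> \<Phi>"
  shows "psd (M t P \<sigma>)"
proof -
  have "0 \<le> x \<bullet> M t P \<sigma> x" for x
    using M_posdef[OF assms, of x] self_adjointD(1)[OF self_adjoint_M, of t P \<sigma>] by (cases "x = 0") (auto simp: linear_0)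
  then show ?thesis by (simp add: psd_def self_adjoint_M)
qed

text \<open>Unchosen edges carry the nonnegative weights and chosen edges the weight
  \<open>- 1\<close>, the split that \<open>gram_inverse_exists\<close> asks for.\<close>

lemma M_inverse:
  assumes t: "t \<le> k" and P: "P \<subseteq> {..<m}" and pd: "\<And>x. x \<noteq> 0 \<Longrightarrow> 0 < x \<bullet> M t P \<sigma> x"
  shows "\<exists>R. inverse_of (M t P \<sigma>) R"
proof -
  have U: "({..<m} - P) \<union> P = {..<m}" using P by auto
  have "0 < \<eta> * d / m * (real k + real t)" using eta d m_pos k_pos by simp
  moreover have "finite P" using P finite_subset by blast
  ultimately show ?thesis
    using gram_inverse_exists[of "{..<m} - P" P "\<eta> * d / m * (real k + real t)" "wt t P" "edge_vec u v \<sigma>"] pd km t m_pos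
    unfolding U M_def by (auto simp: wt_def)
qed

lemma pot_0: "pot 0 {} \<le> \<Phi>"
proof -
  define a where "a = \<eta> * d / m * real k"
  have a: "0 < a" using eta d m_pos k_pos by (simp add: a_def)
  have "neumann (3 * d) N (M 0 {} \<sigma>) \<le> n / a" for \<sigma>
  proof -
    have M: "M 0 {} \<sigma> = (\<lambda>x. a *\<^sub>R x)" by (simp add: M_def gram_def wt_def a_def fun_eq_iff)
    have sa: "self_adjoint (M 0 {} \<sigma>)" by (rule self_adjoint_M)
    have "inverse_of (M 0 {} \<sigma>) (\<lambda>x. (1 / a) *\<^sub>R x)" using a by (simp add: inverse_of_def M)
    moreover have "psd (\<lambda>x::'a. (1 / a) *\<^sub>R x)"
      using a by (auto simp: psd_def self_adjoint_def linear_iff algebra_simps)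
    ultimately have "neumann (3 * d) N (M 0 {} \<sigma>) \<le> trace (\<lambda>x. (1 / a) *\<^sub>R x)"
      using d by (intro neumann_le_trace sa) (auto simp: N_def)
    then show ?thesis by (simp add: trace_def orth)
  qed
  then have "pot 0 {} \<le> (\<Sum>\<sigma>\<in>{1::real, - 1}. n / a)" unfolding pot_def by (intro sum_mono)
  also have "\<dots> = \<Phi>" using eta d m_pos k_pos by (simp add: a_def \<Phi>_def field_simps)
  finally show ?thesis .
qed

text \<open>From the truncated to the exact potential by \<open>trace_le_neumann\<close>, through
  \<open>potential_step\<close>, and back by \<open>neumann_le_trace\<close>. The gain in the middle
  covers the error of the first passage, so the same bound \<open>\<Phi>\<close> is restored and
  errors do not accumulate.\<close>

lemma pot_step:
  assumes P: "P \<subseteq> {..<m}" "card P = t" and t: "t < k" and pot: "pot t P \<le> \<Phi>"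
  shows "\<exists>f\<in>{..<m} - P. pot (Suc t) (insert f P) \<le> \<Phi>"
proof -
  define S where "S = {1, - 1 :: real}"
  define A where "A = {..<m} - P"
  define h where "h = real m - real t"
  \<comment> \<open>The drop in the weight of an edge when it is chosen, from
    \<open>(t + 1) / (m - t - 1)\<close> to \<open>- 1\<close>.\<close>
  define \<gamma> where "\<gamma> = m / (h - 1)"
  define \<delta> where "\<delta> = \<eta> * d / (2 * m)"
  define M' where "M' = M (Suc t) P"
  have tk: "t \<le> k" "Suc t \<le> k" using t by auto
  have finP: "finite P" using P finite_subset by blast
  have h: "real m / 2 \<le> h - 1" "1 < h" "0 < real m" using t km m_pos by (auto simp: h_def)
  have cA: "real (card A) = h"
    using P t km by (simp add: A_def card_Diff_subset finP h_def of_nat_diff)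
  then have "card A \<noteq> 0" using h by auto
  then have A: "A \<noteq> {}" "A \<subseteq> {..<m}" by (auto simp: A_def)
  have S1: "\<bar>\<sigma>\<bar> = 1" if "\<sigma> \<in> S" for \<sigma> using that by (auto simp: S_def)
  have inv: "\<exists>R. inverse_of (M t P \<sigma>) R" if "\<sigma> \<in> S" for \<sigma>
    using M_inverse[OF tk(1) P(1) M_posdef[OF tk(1) _ pot]] that by (auto simp: S_def)
  then have "\<forall>\<sigma>\<in>S. \<exists>R. inverse_of (M t P \<sigma>) R" by blast
  from bchoice[OF this] obtain R where R: "\<And>\<sigma>. \<sigma> \<in> S \<Longrightarrow> inverse_of (M t P \<sigma>) (R \<sigma>)" by blast
  have psdM: "psd (M t P \<sigma>)" if "\<sigma> \<in> S" for \<sigma> using M_psd[OF tk(1) _ pot] that by (simp add: S_def)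
  have trR: "(\<Sum>\<sigma>\<in>S. trace (R \<sigma>)) \<le> \<Phi> + 24 * d * \<Phi>\<^sup>2 / N"
  proof -
    have Npos: "even N" "0 < N" using m_pos by (auto simp: N_def)
    have "trace (R \<sigma>) \<le> neumann (3 * d) N (M t P \<sigma>) + 24 * d * \<Phi> / N * neumann (3 * d) N (M t P \<sigma>)"
      if "\<sigma> \<in> S" for \<sigma>
    proof -
      have "1 / (8 * \<Phi>) * (x \<bullet> x) \<le> x \<bullet> M t P \<sigma> x" for x
        using coercive[OF tk(1) _ pot] that by (simp add: S_def)
      from trace_le_neumann[OF contraction[OF tk(1) S1[OF that]] self_adjoint_M R[OF that] _ _ Npos this]
      show ?thesis using d Phi_pos by (simp add: mult_ac)
    qed
    then have "(\<Sum>\<sigma>\<in>S. trace (R \<sigma>)) \<le> pot t P + 24 * d * \<Phi> / N * pot t P"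
      unfolding pot_def S_def[symmetric] sum_distrib_left sum.distrib[symmetric] by (rule sum_mono)
    also have "\<dots> \<le> \<Phi> + 24 * d * \<Phi> / N * \<Phi>"
      using pot d Phi_pos by (intro add_mono mult_left_mono) auto
    finally show ?thesis by (simp add: power2_eq_square)
  qed
  \<comment> \<open>Partial fractions: the weight of each unchosen edge grows by
    \<open>\<gamma> / h\<close>, and there are \<open>h\<close> such edges. The growth is thus the
    mean of the drop.\<close>
  have wt_Suc: "wt (Suc t) P f = wt t P f + (if f \<in> A then \<gamma> / h else 0)" if "f < m" for f
  proof -
    have "(\<mu> - a + 1) / (a - 1) = (\<mu> - a) / a + \<mu> / (a - 1) / a" if "a \<noteq> 0" "a - 1 \<noteq> 0" for a \<mu> :: real
      using that by (simp add: divide_simps) (simp add: algebra_simps)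
    from this[of "real m - real t" "real m"] h
    have "real (Suc t) / (real m - real (Suc t)) = real t / (real m - real t) + m / (real m - real t - 1) / (real m - real t)"
      by (simp add: h_def diff_diff_eq add.commute)
    then show ?thesis using that by (auto simp: wt_def A_def \<gamma>_def h_def)
  qed
  have M': "M' \<sigma> x = M t P \<sigma> x + gram (2 * \<delta>) (\<lambda>f. if f \<in> A then \<gamma> / card A else 0) (edge_vec u v \<sigma>) {..<m} x" for \<sigma> x
    unfolding M'_def M_def gram_add
    by (rule fun_cong[OF gram_cong]) (auto simp: wt_Suc cA \<delta>_def algebra_simps add_divide_distrib)
  have pdB: "psd (gram (2 * \<delta>) (\<lambda>f. if f \<in> A then \<gamma> / card A else 0) (edge_vec u v \<sigma>) {..<m})" for \<sigma>
    using h eta d by (intro psd_gram) (auto simp: cA \<delta>_def \<gamma>_def)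
  have pdM': "0 < x \<bullet> M' \<sigma> x" if "\<sigma> \<in> S" "x \<noteq> 0" for \<sigma> x
    unfolding M' inner_add_right
    using M_posdef[OF tk(1) _ pot that(2)] that(1) psdD(3)[OF pdB] by (intro add_pos_nonneg) (auto simp: S_def)
  have psdM': "psd (M' \<sigma>)" if "\<sigma> \<in> S" for \<sigma>
  proof -
    have "0 \<le> x \<bullet> M' \<sigma> x" for x
      unfolding M' inner_add_right using psdD(3)[OF psdM[OF that]] psdD(3)[OF pdB] by (intro add_nonneg_nonneg)
    then show ?thesis by (simp add: psd_def self_adjoint_M M'_def)
  qed
  have invM': "\<exists>R'. inverse_of (M' \<sigma>) R'" if "\<sigma> \<in> S" for \<sigma>
    using M_inverse[OF tk(2) P(1)] pdM'[OF that] by (simp add: M'_def)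
  have "\<exists>f\<in>A. \<exists>R2. (\<forall>\<sigma>\<in>S. inverse_of (\<lambda>x. M' \<sigma> x - (\<gamma> * (edge_vec u v \<sigma> f \<bullet> x)) *\<^sub>R edge_vec u v \<sigma> f) (R2 \<sigma>) \<and> psd (R2 \<sigma>)) \<and>
    (\<Sum>\<sigma>\<in>S. trace (R2 \<sigma>)) + 2 * real n * \<delta> / (3 * d)\<^sup>2 \<le> (\<Sum>\<sigma>\<in>S. trace (R \<sigma>))"
    unfolding S_def edge_vec_def
  proof (rule potential_step[where d = d and E = "{..<m}" and M = "M t P"], unfold edge_vec_def[symmetric] S_def[symmetric])
    show "real (card {f\<in>A. u f = i}) + real (card {f\<in>A. v f = i}) \<le> d" if "i < n" for i
    proof -
      have "card {f\<in>A. u f = i} \<le> card {f. f < m \<and> u f = i}" "card {f\<in>A. v f = i} \<le> card {f. f < m \<and> v f = i}"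
        using A by (auto intro!: card_mono)
      then show ?thesis using deg[OF that] by linarith
    qed
    show "e i \<bullet> M' \<sigma> (e i) \<le> 3 * d" if "\<sigma> \<in> S" "i < n" for \<sigma> i
      using M_le[OF tk(2) S1[OF that(1)], of "e i" P] by (simp add: M'_def orth)
    have "2 * d * \<gamma> / h * (\<Sum>\<sigma>\<in>S. trace (R \<sigma>)) * (2 * d * \<gamma> / h + \<delta>) \<le> 2 * d * \<gamma> / h * (2 * \<Phi>) * (2 * d * \<gamma> / h + \<delta>)"
      using trR error_le_Phi h d eta
      by (intro mult_right_mono mult_left_mono) (auto simp: \<gamma>_def \<delta>_def intro!: add_nonneg_nonneg)
    also have "\<dots> \<le> \<delta>" using small_cond[OF t] by (simp add: h_def \<gamma>_def \<delta>_def)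
    finally show "2 * d * \<gamma> / card A * (\<Sum>\<sigma>\<in>S. trace (R \<sigma>)) * (2 * d * \<gamma> / card A + \<delta>) \<le> \<delta>"
      by (simp add: cA)
    show "psd (M' \<sigma>)" if "\<sigma> \<in> S" for \<sigma> using that by (rule psdM')
    show "\<exists>R'. inverse_of (M' \<sigma>) R'" if "\<sigma> \<in> S" for \<sigma> using that by (rule invM')
    show "M' \<sigma> x = M t P \<sigma> x + gram (2 * \<delta>) (\<lambda>f. if f \<in> A then \<gamma> / card A else 0) (edge_vec u v \<sigma>) {..<m} x" for \<sigma> x
      by (rule M')
  qed (use A n lt d eta h self_adjoint_M R inverse_of_psd[OF psdM R] in \<open>auto simp: \<gamma>_def \<delta>_def\<close>)
  then obtain f R2 where f: "f \<in> A"
    and R2: "\<And>\<sigma>. \<sigma> \<in> S \<Longrightarrow> inverse_of (\<lambda>x. M' \<sigma> x - (\<gamma> * (edge_vec u v \<sigma> f \<bullet> x)) *\<^sub>R edge_vec u v \<sigma> f) (R2 \<sigma>)"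
      "\<And>\<sigma>. \<sigma> \<in> S \<Longrightarrow> psd (R2 \<sigma>)"
    and tr: "(\<Sum>\<sigma>\<in>S. trace (R2 \<sigma>)) + 2 * real n * \<delta> / (3 * d)\<^sup>2 \<le> (\<Sum>\<sigma>\<in>S. trace (R \<sigma>))"
    by blast
  have M2: "M (Suc t) (insert f P) \<sigma> = (\<lambda>x. M' \<sigma> x - (\<gamma> * (edge_vec u v \<sigma> f \<bullet> x)) *\<^sub>R edge_vec u v \<sigma> f)" for \<sigma>
  proof
    fix x
    have fm: "f < m" "f \<notin> P" using f by (auto simp: A_def)
    have "- 1 = (\<mu> - a + 1) / (a - 1) - \<mu> / (a - 1)" if "a - 1 \<noteq> 0" for a \<mu> :: real
      using that by (simp add: divide_simps)
    from this[of h "real m"] h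
    have w: "wt (Suc t) (insert f P) f = wt (Suc t) P f - \<gamma>"
      using fm by (simp add: wt_def \<gamma>_def h_def diff_diff_eq add.commute)
    have w': "wt (Suc t) (insert f P) g = wt (Suc t) P g" if "g \<noteq> f" for g
      using that by (simp add: wt_def)
    show "M (Suc t) (insert f P) \<sigma> x = M' \<sigma> x - (\<gamma> * (edge_vec u v \<sigma> f \<bullet> x)) *\<^sub>R edge_vec u v \<sigma> f"
      unfolding M'_def M_def gram_def using fm(1)
      by (simp add: sum.remove[of "{..<m}" f] w w' left_diff_distrib scaleR_diff_left)
  qed
  have "pot (Suc t) (insert f P) \<le> (\<Sum>\<sigma>\<in>S. trace (R2 \<sigma>))"
    unfolding pot_def S_def[symmetric]
    using R2 d by (intro sum_mono neumann_le_trace self_adjoint_M) (auto simp: M2 N_def)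
  also have "\<dots> \<le> \<Phi>"
    using tr trR error_le by (simp add: \<delta>_def)
  finally show ?thesis using f unfolding A_def by blast
qed

end

section \<open>Running times of programs\<close>

text \<open>One bound for all cells, so that the cost of an expression depends only on its syntax
  and on \<open>b\<close>.\<close>

definition bdd :: "nat \<Rightarrow> state \<Rightarrow> bool" where
  "bdd b s \<longleftrightarrow> (\<forall>x i. \<bar>s x i\<bar> < 2 ^ b)"

lemma bdd_upd: "bdd b s \<Longrightarrow> \<bar>k\<bar> < 2 ^ b \<Longrightarrow> bdd b (s(x := (s x)(i := k)))"
  by (auto simp: bdd_def)

lemma bddD: "bdd b s \<Longrightarrow> \<bar>s x i\<bar> < 2 ^ b"
  by (auto simp: bdd_def)

lemma bit_size_le: "\<bar>k\<bar> < 2 ^ j \<Longrightarrow> bit_size k \<le> j + 1"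
proof -
  assume "\<bar>k\<bar> < 2 ^ j"
  then have "nat \<bar>k\<bar> < 2 ^ j" by (simp add: nat_less_iff)
  then show ?thesis by (simp add: bit_size_def floorlog_le_iff)
qed

lemma bit_size_bound: "\<bar>k\<bar> < 2 ^ (bit_size k - 1)"
proof -
  have "nat \<bar>k\<bar> < 2 ^ floorlog 2 (nat \<bar>k\<bar>)" by (rule floorlog_leD) auto
  then show ?thesis by (simp add: bit_size_def nat_less_iff)
qed

lemma bit_size_pos: "1 \<le> bit_size k"
  by (simp add: bit_size_def)

lemma bit_size_add: "bit_size (x + y) \<le> bit_size x + bit_size y" "bit_size (x - y) \<le> bit_size x + bit_size y"
proof -
  define i j where "i = bit_size x - 1" "j = bit_size y - 1"
  have "(2::int) ^ i \<le> 2 ^ (i + j)" "(2::int) ^ j \<le> 2 ^ (i + j)" by (auto intro: power_increasing)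
  moreover have "\<bar>x\<bar> < 2 ^ i" "\<bar>y\<bar> < 2 ^ j" unfolding i_j_def by (rule bit_size_bound)+
  moreover have "(2::int) ^ (i + j + 1) = 2 * 2 ^ (i + j)" by simp
  ultimately have "\<bar>x + y\<bar> < 2 ^ (i + j + 1)" "\<bar>x - y\<bar> < 2 ^ (i + j + 1)" by linarith+
  from this[THEN bit_size_le] bit_size_pos[of x] bit_size_pos[of y]
  show "bit_size (x + y) \<le> bit_size x + bit_size y" "bit_size (x - y) \<le> bit_size x + bit_size y"
    by (auto simp: i_j_def)
qed

lemma bit_size_mult: "bit_size (x * y) \<le> bit_size x + bit_size y"
proof -
  have "\<bar>x * y\<bar> < 2 ^ (bit_size x - 1) * 2 ^ (bit_size y - 1)"
    unfolding abs_mult using bit_size_bound[of x] bit_size_bound[of y] by (intro mult_strict_mono') auto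
  then show ?thesis using bit_size_le bit_size_pos[of x] bit_size_pos[of y]
    by (fastforce simp flip: power_add)
qed

text \<open>Division rounds downwards, so the sign of the dividend matters; division by
  \<open>0\<close> yields \<open>0\<close>.\<close>

lemma abs_div_le: "\<bar>x div y\<bar> \<le> \<bar>x :: int\<bar>"
proof (cases "y = 0")
  case False
  have pos: "\<bar>x div y\<bar> \<le> \<bar>x\<bar>" if y: "0 < y" for x y :: int
  proof (cases "0 \<le> x")
    case True
    then show ?thesis using y by (simp add: pos_imp_zdiv_nonneg_iff zdiv_mono2[of x 1 y, simplified])
  next
    case False
    then have "x \<le> x div y" using y zdiv_mono2_neg[of x 1 y] by simp
    moreover have "x div y \<le> 0" using False y by (simp add: div_nonpos_pos_le0)
    ultimately show ?thesis by simp
  qed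
  show ?thesis
  proof (cases "0 < y")
    case False
    then have "0 < - y" using \<open>y \<noteq> 0\<close> by simp
    from pos[OF this, of "- x"] show ?thesis by simp
  qed (rule pos)
qed simp

lemma bit_size_mono: "\<bar>x\<bar> \<le> \<bar>y\<bar> \<Longrightarrow> bit_size x \<le> bit_size y"
  using bit_size_le[of x "bit_size y - 1"] bit_size_bound[of y] bit_size_pos[of y] by simp

text \<open>A syntactic size such that values have at most \<open>asz e * (b + 1)\<close> bits and
  evaluation costs at most the square of this. A constant counts with its absolute value, a crude
  bound on its length.\<close>

fun asz :: "aexp \<Rightarrow> nat" where
  "asz (Num k) = nat \<bar>k\<bar> + 2"
| "asz (Read x e) = asz e + 1"
| "asz (Add a b) = asz a + asz b + 1"
| "asz (Sub a b) = asz a + asz b + 1"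
| "asz (Mul a b) = asz a + asz b + 1"
| "asz (Div a b) = asz a + asz b + 1"

fun bsz :: "bexp \<Rightarrow> nat" where
  "bsz (Less a b) = asz a + asz b + 1"
| "bsz (Not b) = bsz b + 1"
| "bsz (And a b) = bsz a + bsz b + 1"

lemma bit_size_aval: "bdd b s \<Longrightarrow> bit_size (aval e s) \<le> asz e * (b + 1)"
proof (induction e)
  case (Num k)
  have "\<bar>k\<bar> < 2 ^ nat \<bar>k\<bar>"
    using of_nat_less_iff[of "nat \<bar>k\<bar>" "2 ^ nat \<bar>k\<bar>", where ?'a = int] less_exp[of "nat \<bar>k\<bar>"] by simp
  from bit_size_le[OF this] have "bit_size k \<le> (nat \<bar>k\<bar> + 2) * 1" by simp
  also have "\<dots> \<le> (nat \<bar>k\<bar> + 2) * (b + 1)" by (intro mult_le_mono) auto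
  finally show ?case by simp
next
  case (Read x e)
  have "bit_size (s x (aval e s)) \<le> b + 1" by (rule bit_size_le[OF bddD[OF Read.prems]])
  also have "\<dots> \<le> asz (Read x e) * (b + 1)" by simp
  finally show ?case by simp
next
  case (Add e1 e2)
  then show ?case using bit_size_add(1)[of "aval e1 s" "aval e2 s"] by (simp add: algebra_simps)
next
  case (Sub e1 e2)
  then show ?case using bit_size_add(2)[of "aval e1 s" "aval e2 s"] by (simp add: algebra_simps)
next
  case (Mul e1 e2)
  then show ?case using bit_size_mult[of "aval e1 s" "aval e2 s"] by (simp add: algebra_simps)
next
  case (Div e1 e2)
  then show ?case using bit_size_mono[OF abs_div_le, of "aval e1 s" "aval e2 s"] by (simp add: algebra_simps)
qed

text \<open>The cross term with \<open>B\<close> absorbs the linear cost of one operation, so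
  quadratic bounds compose.\<close>

lemma add_sq_le: "(x::nat) \<le> i\<^sup>2 \<Longrightarrow> y \<le> j\<^sup>2 \<Longrightarrow> 1 \<le> B \<Longrightarrow> x + y + (i + j) \<le> (i + j + B)\<^sup>2"
proof -
  assume a: "x \<le> i\<^sup>2" "y \<le> j\<^sup>2" "1 \<le> B"
  have "(i + j) * 1 \<le> (i + j) * B" using a(3) by (intro mult_le_mono) auto
  then show ?thesis using a by (simp add: power2_eq_square algebra_simps)
qed

lemma acost_le: "bdd b s \<Longrightarrow> acost e s \<le> (asz e * (b + 1))\<^sup>2"
proof (induction e)
  case (Num k)
  have "bit_size k \<le> asz (Num k) * (b + 1)" using bit_size_aval[OF Num, of "Num k"] by simp
  also have "\<dots> \<le> (asz (Num k) * (b + 1))\<^sup>2" by (simp add: power2_eq_square)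
  finally show ?case by simp
next
  case (Read x e)
  let ?A = "asz e * (b + 1)"
  have "acost (Read x e) s \<le> ?A\<^sup>2 + ?A + (b + 1)"
    using Read bit_size_aval[OF Read.prems, of e] bit_size_le[OF bddD[OF Read.prems], of x "aval e s"] by simp
  also have "\<dots> \<le> (?A + (b + 1))\<^sup>2"
    by (simp add: power2_eq_square algebra_simps)
  finally show ?case by (simp add: algebra_simps)
next
  case (Add e1 e2)
  from add_sq_le[OF Add.IH(1)[OF Add.prems] Add.IH(2)[OF Add.prems], of "b + 1"] Add.prems
  show ?case using bit_size_aval[OF Add.prems, of e1] bit_size_aval[OF Add.prems, of e2]
    by (simp add: algebra_simps)
next
  case (Sub e1 e2)
  from add_sq_le[OF Sub.IH(1)[OF Sub.prems] Sub.IH(2)[OF Sub.prems], of "b + 1"] Sub.prems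
  show ?case using bit_size_aval[OF Sub.prems, of e1] bit_size_aval[OF Sub.prems, of e2]
    by (simp add: algebra_simps)
next
  case (Mul e1 e2)
  have "acost (Mul e1 e2) s \<le> (asz e1 * (b+1))\<^sup>2 + (asz e2 * (b+1))\<^sup>2 + (asz e1 * (b+1)) * (asz e2 * (b+1))"
    using Mul bit_size_aval[OF Mul.prems, of e1] bit_size_aval[OF Mul.prems, of e2]
    by (simp only: acost.simps) (intro add_mono mult_le_mono, auto)
  also have "\<dots> \<le> (asz e1 * (b+1) + asz e2 * (b+1) + (b + 1))\<^sup>2"
    by (simp add: power2_eq_square algebra_simps)
  finally show ?case by (simp add: algebra_simps)
next
  case (Div e1 e2)
  have "acost (Div e1 e2) s \<le> (asz e1 * (b+1))\<^sup>2 + (asz e2 * (b+1))\<^sup>2 + (asz e1 * (b+1)) * (asz e2 * (b+1))"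
    using Div bit_size_aval[OF Div.prems, of e1] bit_size_aval[OF Div.prems, of e2]
    by (simp only: acost.simps) (intro add_mono mult_le_mono, auto)
  also have "\<dots> \<le> (asz e1 * (b+1) + asz e2 * (b+1) + (b + 1))\<^sup>2"
    by (simp add: power2_eq_square algebra_simps)
  finally show ?case by (simp add: algebra_simps)
qed

lemma bcost_le: "bdd b s \<Longrightarrow> bcost e s \<le> (bsz e * (b + 1))\<^sup>2"
proof (induction e)
  case (Less e1 e2)
  from add_sq_le[OF acost_le[OF Less] acost_le[OF Less], of "b + 1" e1 e2]
  show ?case using bit_size_aval[OF Less, of e1] bit_size_aval[OF Less, of e2]
    by (simp add: algebra_simps)
next
  case (Not e)
  then have "bcost (Not e) s \<le> (bsz e * (b + 1))\<^sup>2 + 1" by simp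
  also have "\<dots> \<le> (bsz e * (b + 1) + (b + 1))\<^sup>2" by (simp add: power2_eq_square algebra_simps)
  finally show ?case by (simp add: algebra_simps)
next
  case (And e1 e2)
  then have "bcost (And e1 e2) s \<le> (bsz e1 * (b + 1))\<^sup>2 + (bsz e2 * (b + 1))\<^sup>2 + 1" by simp
  also have "\<dots> \<le> (bsz e1 * (b + 1) + bsz e2 * (b + 1) + (b + 1))\<^sup>2" by (simp add: power2_eq_square algebra_simps)
  finally show ?case by (simp add: algebra_simps)
qed

text \<open>The constant exceeds the size of each expression of the program below.\<close>

definition U :: "nat \<Rightarrow> nat" where
  "U b = (5000 * (b + 1))\<^sup>2"

text \<open>Total correctness with a time bound, used like a weakest precondition: \<open>Q\<close>
  may itself be a \<open>reach\<close> statement, which is how \<open>reach_Seq\<close> chains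
  commands.\<close>

definition reach :: "com \<Rightarrow> state \<Rightarrow> nat \<Rightarrow> (state \<Rightarrow> bool) \<Rightarrow> bool" where
  "reach c s T Q \<longleftrightarrow> (\<exists>t s'. exec c s t s' \<and> t \<le> T \<and> Q s')"

lemma U_pos: "1 \<le> U b"
  by (simp add: U_def power2_eq_square)

lemma reach_mono: "reach c s T Q \<Longrightarrow> T \<le> T' \<Longrightarrow> (\<And>s'. Q s' \<Longrightarrow> Q' s') \<Longrightarrow> reach c s T' Q'"
  unfolding reach_def by (meson le_trans)

lemma reach_Skip: "Q s \<Longrightarrow> reach Skip s (U b) Q"
  unfolding reach_def using exec.Skip U_pos by blast

lemma reach_Seq: "reach c1 s T1 (\<lambda>s'. reach c2 s' T2 Q) \<Longrightarrow> reach (Seq c1 c2) s (T1 + T2) Q"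
  unfolding reach_def by (meson add_le_mono exec.Seq)

lemma reach_Assign:
  assumes "bdd b s" "asz i + asz a < 5000" "\<bar>aval a s\<bar> < 2 ^ b"
    and Q: "bdd b (s(x := (s x)(aval i s := aval a s))) \<Longrightarrow> Q (s(x := (s x)(aval i s := aval a s)))"
  shows "reach (Assign x i a) s (U b) Q"
proof -
  have "acost i s + acost a s + (bit_size (aval i s) + bit_size (aval a s))
      \<le> (asz i * (b + 1))\<^sup>2 + (asz a * (b + 1))\<^sup>2 + (asz i * (b + 1) + asz a * (b + 1))"
    using acost_le[OF assms(1)] bit_size_aval[OF assms(1)] by (intro add_mono)
  also have "\<dots> \<le> (asz i * (b + 1) + asz a * (b + 1) + (b + 1))\<^sup>2"
    by (rule add_sq_le) auto
  also have "asz i * (b + 1) + asz a * (b + 1) + (b + 1) = (asz i + asz a + 1) * (b + 1)" by (simp add: algebra_simps)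
  also have "((asz i + asz a + 1) * (b + 1))\<^sup>2 \<le> U b"
    unfolding U_def using assms(2) by (intro power_mono mult_le_mono) auto
  finally show ?thesis
    using exec.Assign[of x i a s] Q[OF bdd_upd[OF assms(1,3)]] unfolding reach_def by (auto simp: add.assoc)
qed

lemma bcost_le_U: "bdd b s \<Longrightarrow> bsz e < 5000 \<Longrightarrow> bcost e s \<le> U b"
  unfolding U_def by (rule order_trans[OF bcost_le], assumption, intro power_mono mult_le_mono) auto

lemma reach_If:
  assumes "bdd b s" "bsz e < 5000" "bval e s \<Longrightarrow> reach c1 s T Q" "\<not> bval e s \<Longrightarrow> reach c2 s T Q"
  shows "reach (If e c1 c2) s (U b + T) Q"
  using assms(3,4) bcost_le_U[OF assms(1,2)] unfolding reach_def
  by (cases "bval e s") (meson add_le_mono exec.IfTrue exec.IfFalse)+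

definition For :: "vname \<Rightarrow> aexp \<Rightarrow> com \<Rightarrow> com" where
  "For x e c = Seq (Assign x (Num 0) (Num 0)) (While (Less (Read x (Num 0)) e)
     (Seq c (Assign x (Num 0) (Add (Read x (Num 0)) (Num 1)))))"

text \<open>The postcondition of a loop body: the counter is untouched, and the invariant is stated
  for the state after the increment that follows.\<close>

abbreviation advanced :: "nat \<Rightarrow> vname \<Rightarrow> nat \<Rightarrow> (nat \<Rightarrow> state \<Rightarrow> bool) \<Rightarrow> state \<Rightarrow> bool" where
  "advanced b x j I s \<equiv> bdd b s \<and> s x 0 = int j \<and> I (Suc j) (s(x := (s x)(0 := int (Suc j))))"

text \<open>Each round pays \<open>U b\<close> for the guard and \<open>U b\<close> for the
  increment; the other two cover the initialization and the last guard. The limit is evaluated anew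
  in every round, hence \<open>bound\<close>.\<close>

lemma reach_For:
  assumes s: "bdd b s" and sz: "asz e < 2000" and kb: "int k < 2 ^ b"
    and I0: "I 0 (s(x := (s x)(0 := 0)))"
    and step: "\<And>j s. j < k \<Longrightarrow> I j s \<Longrightarrow> bdd b s \<Longrightarrow> s x 0 = int j \<Longrightarrow>
      reach c s T (advanced b x j I)"
    and bound: "\<And>j s. I j s \<Longrightarrow> aval e s = int k"
    and post: "\<And>s. I k s \<Longrightarrow> bdd b s \<Longrightarrow> Q s"
  shows "reach (For x e c) s (k * (T + 2 * U b) + 2 * U b) Q"
proof -
  let ?W = "While (Less (Read x (Num 0)) e) (Seq c (Assign x (Num 0) (Add (Read x (Num 0)) (Num 1))))"
  have sz': "bsz (Less (Read x (Num 0)) e) < 5000" using sz by simp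
  have loop: "reach ?W s ((k - j) * (T + 2 * U b) + U b) Q" if "j \<le> k" "I j s" "bdd b s" "s x 0 = int j" for j s
    using that
  proof (induction "k - j" arbitrary: j s)
    case 0
    then have "j = k" by simp
    with 0 have "exec ?W s (bcost (Less (Read x (Num 0)) e) s) s"
      by (intro exec.WhileFalse) (simp add: bound)
    moreover have "bcost (Less (Read x (Num 0)) e) s \<le> U b" by (rule bcost_le_U[OF _ sz']) (rule 0)
    ultimately show ?case using 0 post \<open>j = k\<close> unfolding reach_def by fastforce
  next
    case (Suc l)
    then have j: "j < k" by simp
    from step[OF j Suc.prems(2-4)] obtain t1 s1 where
      1: "exec c s t1 s1" "t1 \<le> T" "bdd b s1" "s1 x 0 = int j" "I (Suc j) (s1(x := (s1 x)(0 := int (Suc j))))"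
      unfolding reach_def by auto
    have lt: "\<bar>int j + 1\<bar> < 2 ^ b" using j kb by linarith
    have "reach (Assign x (Num 0) (Add (Read x (Num 0)) (Num 1))) s1 (U b)
        (\<lambda>s'. bdd b s' \<and> s' = s1(x := (s1 x)(0 := int (Suc j))))"
      by (rule reach_Assign) (use 1(3,4) lt in \<open>simp_all add: add.commute\<close>)
    then obtain t2 where 2: "exec (Assign x (Num 0) (Add (Read x (Num 0)) (Num 1))) s1 t2 (s1(x := (s1 x)(0 := int (Suc j))))"
      "t2 \<le> U b" "bdd b (s1(x := (s1 x)(0 := int (Suc j))))"
      unfolding reach_def by auto
    have "reach ?W (s1(x := (s1 x)(0 := int (Suc j)))) ((k - Suc j) * (T + 2 * U b) + U b) Q"
      by (rule Suc.hyps(1)) (use Suc.hyps(2) j 1 2 in auto)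
    then obtain t3 s3 where 3: "exec ?W (s1(x := (s1 x)(0 := int (Suc j)))) t3 s3"
      "t3 \<le> (k - Suc j) * (T + 2 * U b) + U b" "Q s3" unfolding reach_def by auto
    have "bval (Less (Read x (Num 0)) e) s" using Suc.prems j by (simp add: bound)
    from exec.WhileTrue[OF this exec.Seq[OF 1(1) 2(1)] 3(1)]
    have "exec ?W s (bcost (Less (Read x (Num 0)) e) s + (t1 + t2) + t3) s3" .
    moreover have "bcost (Less (Read x (Num 0)) e) s \<le> U b"
      by (rule bcost_le_U[OF _ sz']) (rule Suc.prems)
    moreover have "(k - j) * (T + 2 * U b) = (T + 2 * U b) + (k - Suc j) * (T + 2 * U b)"
      using j by (metis Suc_diff_Suc mult_Suc)
    ultimately show ?case using 1(2) 2(2) 3(2,3) unfolding reach_def by fastforce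
  qed
  have "reach (For x e c) s (U b + (k * (T + 2 * U b) + U b)) Q"
    unfolding For_def
  proof (intro reach_Seq reach_Assign)
    assume a: "bdd b (s(x := (s x)(aval (Num 0) s := aval (Num 0) s)))"
    show "reach ?W (s(x := (s x)(aval (Num 0) s := aval (Num 0) s))) (k * (T + 2 * U b) + U b) Q"
      using loop[of 0 "s(x := (s x)(0 := 0))"] I0 a by simp
  qed (use s in auto)
  then show ?thesis by (rule reach_mono) auto
qed

definition same :: "vname set \<Rightarrow> state \<Rightarrow> state \<Rightarrow> bool" where
  "same X s s' \<longleftrightarrow> (\<forall>z. z \<notin> X \<longrightarrow> s' z = s z)"

lemma sameD: "same X s s' \<Longrightarrow> z \<notin> X \<Longrightarrow> s' z = s z"
  by (simp add: same_def)

section \<open>The algorithm\<close>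

abbreviation Var :: "vname \<Rightarrow> aexp" where "Var x \<equiv> Read x (Num 0)"
abbreviation Set :: "vname \<Rightarrow> aexp \<Rightarrow> com" where "Set x \<equiv> Assign x (Num 0)"

text \<open>Subtracts the rank-one term of edge \<open>f\<close> applied to \<open>x\<close>. The
  factor \<open>q * m * (t - m * out[f])\<close> is the weight \<open>wt\<close> times the common
  denominator \<open>q * m * (m - t)\<close>, for chosen and unchosen edges alike.\<close>

definition edge_body :: com where
  "edge_body = Seq
     (Set ''g'' (Mul (Mul (Mul (Var ''q'') (Var ''m'')) (Sub (Var ''t'') (Mul (Var ''m'') (Read ''out'' (Var ''f'')))))
       (Add (Read ''x'' (Read ''src'' (Var ''f''))) (Mul (Var ''s'') (Read ''x'' (Read ''dst'' (Var ''f'')))))))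
     (Seq (Assign ''y'' (Read ''src'' (Var ''f'')) (Sub (Read ''y'' (Read ''src'' (Var ''f''))) (Var ''g'')))
       (Assign ''y'' (Read ''dst'' (Var ''f'')) (Sub (Read ''y'' (Read ''dst'' (Var ''f''))) (Mul (Var ''s'') (Var ''g'')))))"

definition edge_loop :: com where
  "edge_loop = For ''f'' (Var ''m'') edge_body"

text \<open>Moves the finished vector to \<open>x\<close> and preloads \<open>y\<close> with its
  diagonal part, from which the next \<open>edge_loop\<close> subtracts.\<close>

definition shift_body :: com where
  "shift_body = Seq
     (Assign ''x'' (Var ''v'') (Read ''y'' (Var ''v'')))
     (Assign ''y'' (Var ''v'') (Mul (Var ''a'') (Read ''x'' (Var ''v''))))"

definition shift_loop :: com where
  "shift_loop = For ''v'' (Var ''n'') shift_body"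

text \<open>Horner's scheme: the \<open>j\<close>-th iterate carries a factor \<open>c ^ j\<close>,
  and multiplying \<open>acc\<close> by \<open>c\<close> brings all entries to a common scale. The
  entry is read before the operator is applied, so the sum starts with the power
  \<open>0\<close>.\<close>

definition iterate_body :: com where
  "iterate_body = Seq
     (Set ''acc'' (Add (Mul (Var ''acc'') (Var ''c'')) (Read ''x'' (Var ''i''))))
     (Seq edge_loop shift_loop)"

definition iterate :: com where
  "iterate = For ''j'' (Var ''N'') iterate_body"

lemma same_refl: "same X s s" by (simp add: same_def)
lemma same_upd: "same X s s' \<Longrightarrow> x \<in> X \<Longrightarrow> same X s (s'(x := g))" by (auto simp: same_def)
lemma same_trans: "same X s s' \<Longrightarrow> same Y s' s'' \<Longrightarrow> X \<subseteq> Z \<Longrightarrow> Y \<subseteq> Z \<Longrightarrow> same Z s s''"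
  by (auto simp: same_def) (metis subsetD)

text \<open>Horner's scheme for \<open>\<Sum>j<J. X j * c ^ (J - 1 - j)\<close>.\<close>

primrec accum :: "int \<Rightarrow> (nat \<Rightarrow> int) \<Rightarrow> nat \<Rightarrow> int" where
  "accum c X 0 = 0"
| "accum c X (Suc j) = accum c X j * c + X j"

section \<open>Correctness of the iterated operator\<close>

locale edge_list =
  fixes n m :: nat and u v :: "nat \<Rightarrow> nat"
  assumes uv: "f < m \<Longrightarrow> u f < v f \<and> v f < n"
begin

text \<open>For suitable \<open>a\<close> and \<open>W\<close>, an integer multiple of
  \<open>I - M / c\<close> in coordinates, see \<open>kern_embed\<close>.\<close>

definition kern :: "int \<Rightarrow> int \<Rightarrow> (nat \<Rightarrow> int) \<Rightarrow> (nat \<Rightarrow> int) \<Rightarrow> nat \<Rightarrow> int" where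
  "kern a \<sigma> W X w = a * X w - (\<Sum>f<m. W f * (X (u f) + \<sigma> * X (v f)) * (of_bool (u f = w) + \<sigma> * of_bool (v f = w)))"

definition graph_state :: "state \<Rightarrow> bool" where
  "graph_state s \<longleftrightarrow> s ''n'' 0 = int n \<and> s ''m'' 0 = int m \<and>
     (\<forall>f<m. s ''src'' (int f) = int (u f) \<and> s ''dst'' (int f) = int (v f))"

text \<open>The endpoints are distinct, so the last factor is \<open>0\<close> or has absolute value
  \<open>1\<close>.\<close>

lemma term_bound:
  fixes \<sigma> B Xb :: int and W X :: "nat \<Rightarrow> int"
  assumes "f < m" "\<bar>\<sigma>\<bar> = 1" "\<bar>W f\<bar> \<le> B" "\<And>w. w < n \<Longrightarrow> \<bar>X w\<bar> \<le> Xb"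
  shows "\<bar>W f * (X (u f) + \<sigma> * X (v f))\<bar> \<le> 2 * B * Xb"
    and "\<bar>W f * (X (u f) + \<sigma> * X (v f)) * (of_bool (u f = w) + \<sigma> * of_bool (v f = w))\<bar> \<le> 2 * B * Xb"
proof -
  have s: "\<sigma> = 1 \<or> \<sigma> = - 1" using assms(2) by linarith
  have uvf: "u f < n" "v f < n" "u f \<noteq> v f" using uv[OF assms(1)] by auto
  have "\<bar>X (u f) + \<sigma> * X (v f)\<bar> \<le> 2 * Xb"
    using s assms(4)[OF uvf(1)] assms(4)[OF uvf(2)] by auto
  then have "\<bar>W f\<bar> * \<bar>X (u f) + \<sigma> * X (v f)\<bar> \<le> B * (2 * Xb)"
    using assms(3) by (intro mult_mono) auto
  then show 1: "\<bar>W f * (X (u f) + \<sigma> * X (v f))\<bar> \<le> 2 * B * Xb" by (simp add: abs_mult)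
  with order_trans[OF abs_ge_zero 1] show "\<bar>W f * (X (u f) + \<sigma> * X (v f)) * (of_bool (u f = w) + \<sigma> * of_bool (v f = w))\<bar> \<le> 2 * B * Xb"
    using s uvf(3) by (auto simp: of_bool_def abs_mult)
qed

text \<open>The bound \<open>Yb + 2 * int m * B * Xb\<close> covers every partial sum, so that no
  intermediate entry of \<open>y\<close> leaves the range.\<close>

lemma edge_loop_spec:
  fixes b :: nat and B Xb Yb :: int
  assumes s: "bdd b s" "graph_state s" and sg: "s ''s'' 0 = \<sigma>" "\<bar>\<sigma>\<bar> = 1"
    and W: "\<And>f. f < m \<Longrightarrow> s ''q'' 0 * int m * (s ''t'' 0 - int m * s ''out'' (int f)) = W f" "\<And>f. f < m \<Longrightarrow> \<bar>W f\<bar> \<le> B"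
    and X: "\<And>w. w < n \<Longrightarrow> s ''x'' (int w) = X w" "\<And>w. w < n \<Longrightarrow> \<bar>X w\<bar> \<le> Xb"
    and Y: "\<And>w. w < n \<Longrightarrow> \<bar>s ''y'' (int w)\<bar> \<le> Yb" and Yb: "Yb + 2 * int m * B * Xb < 2 ^ b"
  shows "reach edge_loop s ((5 * m + 2) * U b) (\<lambda>s'. same {''f'', ''g'', ''y''} s s' \<and> bdd b s' \<and>
    (\<forall>w<n. s' ''y'' (int w) = s ''y'' (int w) -
      (\<Sum>f<m. W f * (X (u f) + \<sigma> * X (v f)) * (of_bool (u f = w) + \<sigma> * of_bool (v f = w)))))"
proof -
  define trm where "trm f w = W f * (X (u f) + \<sigma> * X (v f)) * (of_bool (u f = w) + \<sigma> * of_bool (v f = w))" for f w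
  define I where "I j s' \<longleftrightarrow> same {''f'', ''g'', ''y''} s s' \<and> (\<forall>w<n. s' ''y'' (int w) = s ''y'' (int w) - (\<Sum>f<j. trm f w))" for j s'
  have mb: "int m < 2 ^ b" using bddD[OF s(1), of "''m''" 0] s(2) by (simp add: graph_state_def)
  have step: "reach edge_body s'
     (U b + (U b + U b)) (advanced b ''f'' j I)"
    if j: "j < m" and I: "I j s'" and b: "bdd b s'" and f: "s' ''f'' 0 = int j" for j s'
  proof -
    have eq: "z \<notin> {''f'', ''g'', ''y''} \<Longrightarrow> s' z = s z" for z using I by (auto simp: I_def same_def)
    have y: "w < n \<Longrightarrow> s' ''y'' (int w) = s ''y'' (int w) - (\<Sum>f<j. trm f w)" for w using I by (auto simp: I_def)
    have uvj: "u j < n" "v j < n" "u j \<noteq> v j" using uv[OF j] by auto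
    define g where "g = W j * (X (u j) + \<sigma> * X (v j))"
    have env: "s ''m'' 0 = int m" "s ''src'' (int j) = int (u j)" "s ''dst'' (int j) = int (v j)"
      using s(2) j by (auto simp: graph_state_def)
    have "0 \<le> B" using W(2)[OF j] by linarith
    moreover have "0 \<le> Xb" using X(2)[OF uvj(1)] by linarith
    ultimately have BX: "0 \<le> 2 * B * Xb" by simp
    have Yb0: "0 \<le> Yb" using Y[OF uvj(1)] by linarith
    have part: "\<bar>s ''y'' (int w) - (\<Sum>f<i. trm f w)\<bar> < 2 ^ b" if "i \<le> m" "w < n" for i w
    proof -
      have "\<bar>\<Sum>f<i. trm f w\<bar> \<le> (\<Sum>f<i. \<bar>trm f w\<bar>)" by (rule sum_abs)
      also have "\<dots> \<le> (\<Sum>f<i. 2 * B * Xb)"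
      proof (rule sum_mono)
        fix f assume "f \<in> {..<i}"
        then have "f < m" using that by simp
        then show "\<bar>trm f w\<bar> \<le> 2 * B * Xb"
          unfolding trm_def by (intro term_bound(2) sg W X)
      qed
      also have "\<dots> \<le> int m * (2 * B * Xb)" using that BX by (simp add: mult_right_mono)
      finally have "\<bar>\<Sum>f<i. trm f w\<bar> \<le> 2 * int m * B * Xb" by (simp add: mult_ac)
      then show ?thesis using Y[OF that(2)] Yb by linarith
    qed
    \<comment> \<open>Since \<open>u j < v j\<close>, the two updated entries differ and the second
      assignment does not see the first.\<close>
    have tu: "trm j (u j) = g" "trm j (v j) = \<sigma> * g" and tw: "w \<noteq> u j \<Longrightarrow> w \<noteq> v j \<Longrightarrow> trm j w = 0" for w
      using uvj by (auto simp: trm_def g_def)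
    have p1: "\<bar>s ''y'' (int (u j)) - (\<Sum>f<j. trm f (u j)) - g\<bar> < 2 ^ b"
      using part[of "Suc j" "u j"] j uvj by (simp add: tu diff_diff_eq)
    have p2: "\<bar>s ''y'' (int (v j)) - (\<Sum>f<j. trm f (v j)) - \<sigma> * g\<bar> < 2 ^ b"
      using part[of "Suc j" "v j"] j uvj by (simp add: tu diff_diff_eq)
    have g: "\<bar>g\<bar> < 2 ^ b"
    proof -
      have "\<bar>g\<bar> \<le> 2 * B * Xb" unfolding g_def by (rule term_bound(1)) (use j sg W X in auto)
      also have "\<dots> \<le> int m * (2 * B * Xb)" using j BX mult_right_mono[of 1 "int m" "2 * B * Xb"] by simp
      finally show ?thesis using Yb Yb0 by (simp add: mult_ac)
    qed
    have geq: "s ''q'' 0 * int m * (s ''t'' 0 - int m * s ''out'' (int j)) * (X (u j) + \<sigma> * X (v j)) = g"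
      using W(1)[OF j] by (simp add: g_def)
    note simps = f eq env X(1)[OF uvj(1)] X(1)[OF uvj(2)] sg(1) y[OF uvj(1)] y[OF uvj(2)] geq uvj uvj(3)[symmetric]
    show ?thesis
      unfolding edge_body_def
      apply (intro reach_Seq reach_Assign)
      apply (simp_all add: simps b g p1 p2)
      subgoal
        unfolding I_def
        apply (intro conjI allI impI)
        subgoal using I by (auto simp: I_def intro!: same_upd)
        subgoal for w by (cases "w = u j"; cases "w = v j") (auto simp: simps y tu tw)
        done
      done
  qed
  have "reach edge_loop s (m * ((U b + (U b + U b)) + 2 * U b) + 2 * U b) (\<lambda>s'. same {''f'', ''g'', ''y''} s s' \<and> bdd b s' \<and>
    (\<forall>w<n. s' ''y'' (int w) = s ''y'' (int w) - (\<Sum>f<m. trm f w)))"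
    unfolding edge_loop_def
  proof (rule reach_For[where I = I, OF s(1) _ mb])
    show "I 0 (s(''f'' := (s ''f'')(0 := 0)))" by (auto simp: I_def intro: same_upd same_refl)
    show "aval (Var ''m'') s' = int m" if "I j s'" for j s'
      using that s(2) by (simp add: I_def same_def graph_state_def)
  qed (use step in \<open>auto simp: I_def\<close>)
  then show ?thesis by (rule reach_mono) (auto simp: trm_def algebra_simps)
qed

lemma shift_loop_spec:
  assumes s: "bdd b s" "s ''n'' 0 = int n"
    and Y: "\<And>w. w < n \<Longrightarrow> s ''y'' (int w) = Y w" "\<And>w. w < n \<Longrightarrow> \<bar>s ''a'' 0 * Y w\<bar> < 2 ^ b"
  shows "reach shift_loop s ((4 * n + 2) * U b) (\<lambda>s'. same {''v'', ''x'', ''y''} s s' \<and> bdd b s' \<and>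
    (\<forall>w<n. s' ''x'' (int w) = Y w \<and> s' ''y'' (int w) = s ''a'' 0 * Y w))"
proof -
  define I where "I j s' \<longleftrightarrow> same {''v'', ''x'', ''y''} s s' \<and>
    (\<forall>w<n. if w < j then s' ''x'' (int w) = Y w \<and> s' ''y'' (int w) = s ''a'' 0 * Y w else s' ''y'' (int w) = Y w)" for j s'
  have nb: "int n < 2 ^ b" using bddD[OF s(1), of "''n''" 0] s(2) by simp
  have step: "reach shift_body s'
     (U b + U b) (advanced b ''v'' j I)"
    if j: "j < n" and I: "I j s'" and b: "bdd b s'" and f: "s' ''v'' 0 = int j" for j s'
  proof -
    have eq: "z \<notin> {''v'', ''x'', ''y''} \<Longrightarrow> s' z = s z" for z using I by (auto simp: I_def same_def)
    have y: "s' ''y'' (int j) = Y j" using I j by (auto simp: I_def)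
    have Yj: "\<bar>Y j\<bar> < 2 ^ b" using bddD[OF b, of "''y''" "int j"] y by simp
    note simps = f eq y Yj Y(2)[OF j]
    show ?thesis
      unfolding shift_body_def
      apply (intro reach_Seq reach_Assign)
      apply (simp_all add: simps b)
      using I apply (auto simp: I_def simps less_Suc_eq intro!: same_upd split: if_splits)
      done
  qed
  have "reach shift_loop s (n * ((U b + U b) + 2 * U b) + 2 * U b) (\<lambda>s'. same {''v'', ''x'', ''y''} s s' \<and> bdd b s' \<and>
    (\<forall>w<n. s' ''x'' (int w) = Y w \<and> s' ''y'' (int w) = s ''a'' 0 * Y w))"
    unfolding shift_loop_def
  proof (rule reach_For[where I = I, OF s(1) _ nb])
    show "I 0 (s(''v'' := (s ''v'')(0 := 0)))" using Y(1) by (auto simp: I_def intro: same_upd same_refl)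
    show "aval (Var ''n'') s' = int n" if "I j s'" for j s'
      using that s(2) by (simp add: I_def same_def)
  qed (use step in \<open>auto simp: I_def\<close>)
  then show ?thesis by (rule reach_mono) (auto simp: algebra_simps)
qed

definition delta :: "nat \<Rightarrow> nat \<Rightarrow> int" where
  "delta i w = of_bool (w = i)"

lemma kern_bound:
  assumes "\<bar>\<sigma>\<bar> = 1" "\<And>f. f < m \<Longrightarrow> \<bar>W f\<bar> \<le> B" "\<And>w. w < n \<Longrightarrow> \<bar>X w\<bar> \<le> Xb" "w < n"
  shows "\<bar>kern a \<sigma> W X w\<bar> \<le> (\<bar>a\<bar> + 2 * int m * B) * Xb"
proof -
  have "\<bar>\<Sum>f<m. W f * (X (u f) + \<sigma> * X (v f)) * (of_bool (u f = w) + \<sigma> * of_bool (v f = w))\<bar> \<le> (\<Sum>f<m. 2 * B * Xb)"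
    by (intro order_trans[OF sum_abs] sum_mono term_bound(2) assms) auto
  moreover have "\<bar>a * X w\<bar> \<le> \<bar>a\<bar> * Xb" using assms(3,4) by (simp add: abs_mult mult_left_mono)
  ultimately show ?thesis unfolding kern_def by (simp add: algebra_simps)
qed

lemma kern_pow_bound:
  assumes "\<bar>\<sigma>\<bar> = 1" "\<And>f. f < m \<Longrightarrow> \<bar>W f\<bar> \<le> B" "0 \<le> B" "\<bar>a\<bar> + 2 * int m * B \<le> Q" "w < n"
  shows "\<bar>(kern a \<sigma> W ^^ j) (delta i) w\<bar> \<le> Q ^ j"
  using assms(5)
proof (induction j arbitrary: w)
  case 0
  then show ?case by (simp add: delta_def)
next
  case (Suc j)
  have Q: "0 \<le> Q" using assms(3,4) by (smt (verit) mult_nonneg_nonneg of_nat_0_le_iff)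
  have "\<bar>kern a \<sigma> W ((kern a \<sigma> W ^^ j) (delta i)) w\<bar> \<le> (\<bar>a\<bar> + 2 * int m * B) * Q ^ j"
    by (rule kern_bound[OF assms(1,2) Suc.IH Suc.prems])
  also have "\<dots> \<le> Q * Q ^ j" using assms(4) Q by (intro mult_right_mono) auto
  finally show ?case by simp
qed

lemma accum_bound:
  assumes "\<And>j. j < N \<Longrightarrow> \<bar>X j\<bar> \<le> Q ^ j" "\<bar>c\<bar> + 1 \<le> Q" "J \<le> N"
  shows "\<bar>accum c X J\<bar> \<le> Q ^ J"
  using assms(3)
proof (induction J)
  case (Suc J)
  have Q: "1 \<le> Q" using assms(2) by linarith
  have "\<bar>accum c X (Suc J)\<bar> \<le> \<bar>accum c X J\<bar> * \<bar>c\<bar> + \<bar>X J\<bar>" by (simp flip: abs_mult)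
  also have "\<dots> \<le> Q ^ J * \<bar>c\<bar> + Q ^ J" using Suc assms(1)[of J] by (intro add_mono mult_right_mono) auto
  also have "\<dots> = Q ^ J * (\<bar>c\<bar> + 1)" by (simp add: algebra_simps)
  also have "\<dots> \<le> Q ^ J * Q" using assms(2) Q by (intro mult_left_mono) auto
  finally show ?case by (simp add: mult.commute)
qed simp

text \<open>The exponent is \<open>Suc N\<close> and not \<open>N\<close>, because after the last
  round \<open>y\<close> is preloaded with \<open>a\<close> times the \<open>N\<close>-th
  iterate.\<close>

lemma iterate_spec:
  fixes b N :: nat and B Q :: int
  assumes s: "bdd b s" "graph_state s" and sg: "s ''s'' 0 = \<sigma>" "\<bar>\<sigma>\<bar> = 1"
    and W: "\<And>f. f < m \<Longrightarrow> s ''q'' 0 * int m * (s ''t'' 0 - int m * s ''out'' (int f)) = W f" "\<And>f. f < m \<Longrightarrow> \<bar>W f\<bar> \<le> B"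
    and B: "0 \<le> B" "\<bar>a\<bar> + 2 * int m * B \<le> Q" "\<bar>c\<bar> + 1 \<le> Q" "Q ^ Suc N < 2 ^ b"
    and v: "s ''a'' 0 = a" "s ''c'' 0 = c" "s ''i'' 0 = int i" "i < n" "s ''N'' 0 = int N" "s ''acc'' 0 = 0"
    and X: "\<And>w. w < n \<Longrightarrow> s ''x'' (int w) = delta i w" "\<And>w. w < n \<Longrightarrow> s ''y'' (int w) = a * delta i w"
  shows "reach iterate s ((N * (5 * m + 4 * n + 7) + 2) * U b)
    (\<lambda>s'. same {''j'', ''acc'', ''f'', ''g'', ''y'', ''v'', ''x''} s s' \<and> bdd b s' \<and>
      s' ''acc'' 0 = accum c (\<lambda>j. (kern a \<sigma> W ^^ j) (delta i) i) N)"
proof -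
  define K where "K = kern a \<sigma> W"
  let ?Z = "{''j'', ''acc'', ''f'', ''g'', ''y'', ''v'', ''x''}"
  define I where "I j s' \<longleftrightarrow> same ?Z s s' \<and> s' ''acc'' 0 = accum c (\<lambda>j. (K ^^ j) (delta i) i) j \<and>
    (\<forall>w<n. s' ''x'' (int w) = (K ^^ j) (delta i) w \<and> s' ''y'' (int w) = a * (K ^^ j) (delta i) w)" for j s'
  have Nb: "int N < 2 ^ b" using bddD[OF s(1), of "''N''" 0] v by simp
  have Q: "1 \<le> Q" using B by linarith
  have "0 \<le> 2 * int m * B" using B(1) by simp
  then have aQ: "\<bar>a\<bar> \<le> Q" using B(2) by linarith
  have Kb: "\<bar>(K ^^ j) (delta i) w\<bar> \<le> Q ^ j" if "w < n" for j w
    unfolding K_def by (rule kern_pow_bound[OF sg(2) _ B(1,2) that]) (rule W(2))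
  have Qb: "Q ^ j < 2 ^ b" if "j \<le> Suc N" for j
    using B(4) power_increasing[OF that Q] by linarith
  have step: "reach iterate_body s'
     (U b + ((5 * m + 2) * U b + (4 * n + 2) * U b)) (advanced b ''j'' j I)"
    if j: "j < N" and I: "I j s'" and b: "bdd b s'" and f: "s' ''j'' 0 = int j" for j s'
  proof -
    let ?X = "(K ^^ j) (delta i)"
    have sm: "same ?Z s s'" using I by (simp add: I_def)
    have eq: "z \<notin> ?Z \<Longrightarrow> s' z = s z" for z using sm by (rule sameD)
    have x: "s' ''x'' (int w) = ?X w" "s' ''y'' (int w) = a * ?X w" if "w < n" for w using I that by (auto simp: I_def)
    have acc: "s' ''acc'' 0 = accum c (\<lambda>j. (K ^^ j) (delta i) i) j" using I by (simp add: I_def)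
    have accb: "\<bar>accum c (\<lambda>j. (K ^^ j) (delta i) i) (Suc j)\<bar> < 2 ^ b"
    proof -
      have "\<bar>accum c (\<lambda>j. (K ^^ j) (delta i) i) (Suc j)\<bar> \<le> Q ^ Suc j"
        by (rule accum_bound[where N = N]) (use Kb v B j in auto)
      then show ?thesis using Qb[of "Suc j"] j by linarith
    qed
    define s1 where "s1 = s'(''acc'' := (s' ''acc'')(0 := accum c (\<lambda>j. (K ^^ j) (delta i) i) (Suc j)))"
    have b1: "bdd b s1" unfolding s1_def by (rule bdd_upd[OF b accb])
    have g1: "graph_state s1" using s(2) by (simp add: graph_state_def s1_def eq)
    have "Q * Q ^ j < 2 ^ b" using Qb[of "Suc j"] j by simp
    moreover have "(\<bar>a\<bar> + 2 * int m * B) * Q ^ j \<le> Q * Q ^ j" using B Q by (intro mult_right_mono) auto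
    ultimately have bd: "(\<bar>a\<bar> + 2 * int m * B) * Q ^ j < 2 ^ b" by linarith
    have "reach edge_loop s1 ((5 * m + 2) * U b) (\<lambda>s'. same {''f'', ''g'', ''y''} s1 s' \<and> bdd b s' \<and>
      (\<forall>w<n. s' ''y'' (int w) = s1 ''y'' (int w) -
      (\<Sum>f<m. W f * (?X (u f) + \<sigma> * ?X (v f)) * (of_bool (u f = w) + \<sigma> * of_bool (v f = w)))))"
    proof (rule edge_loop_spec[OF b1 g1 _ sg(2), where B = B and Xb = "Q ^ j" and Yb = "\<bar>a\<bar> * Q ^ j"])
      show "\<bar>s1 ''y'' (int w)\<bar> \<le> \<bar>a\<bar> * Q ^ j" if "w < n" for w
        using x(2)[OF that] Kb[OF that, of j] by (simp add: s1_def abs_mult mult_left_mono)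
      show "\<bar>a\<bar> * Q ^ j + 2 * int m * B * Q ^ j < 2 ^ b" using bd by (simp add: algebra_simps)
    qed (use W Kb x sg in \<open>auto simp: s1_def eq\<close>)
    then have e: "reach edge_loop s1 ((5 * m + 2) * U b) (\<lambda>s2. same {''f'', ''g'', ''y''} s1 s2 \<and> bdd b s2 \<and>
      (\<forall>w<n. s2 ''y'' (int w) = (K ^^ Suc j) (delta i) w))"
      by (rule reach_mono) (auto simp: K_def kern_def s1_def x)
    have sh: "reach shift_loop s2 ((4 * n + 2) * U b) (advanced b ''j'' j I)"
      if s2: "same {''f'', ''g'', ''y''} s1 s2" "bdd b s2" "\<forall>w<n. s2 ''y'' (int w) = (K ^^ Suc j) (delta i) w" for s2
    proof -
      have eq2: "z \<notin> {''f'', ''g'', ''y'', ''acc''} \<Longrightarrow> s2 z = s' z" for z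
        using sameD[OF s2(1), of z] by (simp add: s1_def)
      have acc2: "s2 ''acc'' 0 = accum c (\<lambda>j. (K ^^ j) (delta i) i) (Suc j)"
        using sameD[OF s2(1), of "''acc''"] by (simp add: s1_def)
      have sm2: "same ?Z s s2"
        using same_trans[OF sm same_trans[OF same_upd[OF same_refl] s2(1)[unfolded s1_def]], of "{''acc''}"  ?Z] by auto
      have a2: "s2 ''a'' 0 = a" using v by (simp add: eq2 eq)
      have ab: "\<bar>s2 ''a'' 0 * (K ^^ Suc j) (delta i) w\<bar> < 2 ^ b" if "w < n" for w
      proof -
        have "\<bar>a * (K ^^ Suc j) (delta i) w\<bar> \<le> Q * Q ^ Suc j"
          unfolding abs_mult using Kb[OF that, of "Suc j"] aQ Q by (intro mult_mono) auto
        also have "\<dots> = Q ^ Suc (Suc j)" by simp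
        also have "\<dots> < 2 ^ b" using Qb[of "Suc (Suc j)"] j by simp
        finally show ?thesis by (simp only: a2)
      qed
      have n2: "s2 ''n'' 0 = int n" using s(2) by (simp add: eq2 eq graph_state_def)
      have j2: "s2 ''j'' 0 = int j" using f by (simp add: eq2)
      have y2: "s2 ''y'' (int w) = (K ^^ Suc j) (delta i) w" if "w < n" for w using s2(3) that by blast
      show ?thesis
      proof (rule reach_mono[OF shift_loop_spec[OF s2(2) n2 y2 ab] order_refl], assumption, assumption, elim conjE)
        fix s3 assume s3: "same {''v'', ''x'', ''y''} s2 s3" "bdd b s3"
          "\<forall>w<n. s3 ''x'' (int w) = (K ^^ Suc j) (delta i) w \<and> s3 ''y'' (int w) = s2 ''a'' 0 * (K ^^ Suc j) (delta i) w"
        have "same ?Z s s3" by (rule same_trans[OF sm2 s3(1)]) auto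
        then show "advanced b ''j'' j I s3"
          using s3(2,3) sameD[OF s3(1), of "''j''"] sameD[OF s3(1), of "''acc''"] j2 acc2 a2
          by (simp add: I_def same_upd)
      qed
    qed
    show ?thesis
      unfolding iterate_body_def
    proof (intro reach_Seq reach_Assign)
      show "\<bar>aval (Add (Mul (Var ''acc'') (Var ''c'')) (Read ''x'' (Var ''i''))) s'\<bar> < 2 ^ b"
        using accb v by (simp add: acc eq x)
      show "reach edge_loop (s'(''acc'' := (s' ''acc'')(aval (Num 0) s' := aval (Add (Mul (Var ''acc'') (Var ''c'')) (Read ''x'' (Var ''i''))) s')))
        ((5 * m + 2) * U b) (\<lambda>s2. reach shift_loop s2 ((4 * n + 2) * U b)
          (advanced b ''j'' j I))"
      proof -
        have "s'(''acc'' := (s' ''acc'')(aval (Num 0) s' := aval (Add (Mul (Var ''acc'') (Var ''c'')) (Read ''x'' (Var ''i''))) s')) = s1"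
          using v by (simp add: s1_def acc eq x)
        then show ?thesis using reach_mono[OF e order_refl] sh by fastforce
      qed
    qed (use b in auto)
  qed
  have "reach iterate s (N * (U b + ((5 * m + 2) * U b + (4 * n + 2) * U b) + 2 * U b) + 2 * U b)
    (\<lambda>s'. same ?Z s s' \<and> bdd b s' \<and> s' ''acc'' 0 = accum c (\<lambda>j. (K ^^ j) (delta i) i) N)"
    unfolding iterate_def
  proof (rule reach_For[where I = I, OF s(1) _ Nb])
    show "I 0 (s(''j'' := (s ''j'')(0 := 0)))" using X v by (auto simp: I_def intro: same_upd same_refl)
    show "aval (Var ''N'') s' = int N" if "I j s'" for j s'
      using that v by (simp add: I_def same_def)
  qed (use step in \<open>auto simp: I_def\<close>)
  then show ?thesis by (rule reach_mono) (auto simp: K_def algebra_simps)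
qed

end

section \<open>Evaluating the potential and scanning candidates\<close>

definition init_body :: com where
  "init_body = Seq (Assign ''x'' (Var ''v'') (Num 0)) (Assign ''y'' (Var ''v'') (Num 0))"

definition init_loop :: com where
  "init_loop = For ''v'' (Var ''n'') init_body"

definition column_rest :: com where
  "column_rest = Seq (Assign ''x'' (Var ''i'') (Num 1)) (Seq (Assign ''y'' (Var ''i'') (Var ''a''))
     (Seq (Set ''acc'' (Num 0)) (Seq iterate (Set ''tr'' (Add (Var ''tr'') (Var ''acc''))))))"

definition column_body :: com where
  "column_body = Seq init_loop column_rest"

definition column_loop :: com where
  "column_loop = For ''i'' (Var ''n'') column_body"

definition sign_body :: com where
  "sign_body = Seq (Set ''s'' (Sub (Mul (Num 2) (Var ''h'')) (Num 1))) column_loop"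

definition evaluate :: com where
  "evaluate = Seq (Set ''tr'' (Num 0)) (For ''h'' (Num 2)
     sign_body)"

text \<open>\<open>best\<close> may still hold a value of an earlier round; it is trusted only once
  \<open>sel\<close> is nonnegative.\<close>

definition keep_best :: com where
  "keep_best = If (And (Not (Less (Var ''sel'') (Num 0))) (Not (Less (Var ''tr'') (Var ''best'')))) Skip
         (Seq (Set ''best'' (Var ''tr'')) (Set ''sel'' (Var ''e'')))"

definition try_edge :: com where
  "try_edge = Seq (Assign ''out'' (Var ''e'') (Num 1)) (Seq evaluate (Seq (Assign ''out'' (Var ''e'') (Num 0)) keep_best))"

definition candidate_body :: com where
  "candidate_body = If (Less (Read ''out'' (Var ''e'')) (Num 1))
     try_edge
     Skip"

definition candidate_loop :: com where
  "candidate_loop = For ''e'' (Var ''m'') candidate_body"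

context edge_list
begin

text \<open>The entry condition of \<open>evaluate\<close>. The factor \<open>2 * int n\<close>
  leaves room for the sum over both signs and all columns.\<close>

definition ready :: "nat \<Rightarrow> (nat \<Rightarrow> int) \<Rightarrow> int \<Rightarrow> int \<Rightarrow> nat \<Rightarrow> int \<Rightarrow> int \<Rightarrow> state \<Rightarrow> bool" where
  "ready b W a c N B Q s \<longleftrightarrow> graph_state s \<and>
     (\<forall>f<m. s ''q'' 0 * int m * (s ''t'' 0 - int m * s ''out'' (int f)) = W f \<and> \<bar>W f\<bar> \<le> B) \<and>
     0 \<le> B \<and> \<bar>a\<bar> + 2 * int m * B \<le> Q \<and> \<bar>c\<bar> + 1 \<le> Q \<and> 2 * int n * Q ^ Suc N < 2 ^ b \<and> 0 < n \<and> (3::int) < 2 ^ b \<and>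
     s ''a'' 0 = a \<and> s ''c'' 0 = c \<and> s ''N'' 0 = int N"

lemma graph_state_same: "graph_state s \<Longrightarrow> same X s s' \<Longrightarrow> X \<inter> {''n'', ''m'', ''src'', ''dst''} = {} \<Longrightarrow> graph_state s'"
  by (auto simp: graph_state_def same_def)

lemma ready_same: "ready b W a c N B Q s \<Longrightarrow> same X s s' \<Longrightarrow>
  X \<inter> {''n'', ''m'', ''src'', ''dst'', ''q'', ''t'', ''out'', ''a'', ''c'', ''N''} = {} \<Longrightarrow> ready b W a c N B Q s'"
  unfolding ready_def by (intro conjI) (auto elim: graph_state_same simp: same_def)

definition colval :: "int \<Rightarrow> int \<Rightarrow> (nat \<Rightarrow> int) \<Rightarrow> int \<Rightarrow> nat \<Rightarrow> nat \<Rightarrow> int" where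
  "colval a \<sigma> W c N i = accum c (\<lambda>j. (kern a \<sigma> W ^^ j) (delta i) i) N"

definition evalval :: "int \<Rightarrow> (nat \<Rightarrow> int) \<Rightarrow> int \<Rightarrow> nat \<Rightarrow> int" where
  "evalval a W c N = (\<Sum>h<2. \<Sum>i<n. colval a (2 * int h - 1) W c N i)"

lemma ready_bounds:
  assumes "ready b W a c N B Q s"
  shows "1 \<le> Q" "\<bar>a\<bar> < 2 ^ b" "2 * int n * Q ^ N < 2 ^ b" "Q ^ Suc N < 2 ^ b" "n < 2 ^ b" "3 < (2::int) ^ b"
proof -
  have r: "0 \<le> B" "\<bar>a\<bar> + 2 * int m * B \<le> Q" "\<bar>c\<bar> + 1 \<le> Q" "2 * int n * Q ^ Suc N < 2 ^ b" "1 \<le> int n"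
    using assms by (auto simp: ready_def)
  show Q: "1 \<le> Q" using r(3) by linarith
  define P R where "P = Q ^ Suc N" "R = Q ^ N"
  have Q1: "1 \<le> R" "R \<le> P" "Q \<le> P"
    using Q power_increasing[of 1 "Suc N" Q] power_increasing[of N "Suc N" Q] by (simp_all add: P_R_def one_le_power del: power_Suc)
  have n: "1 * P \<le> int n * P" "int n * R \<le> int n * P" "int n * 1 \<le> int n * R"
    using r(5) Q1 by (auto intro!: mult_right_mono mult_left_mono)
  have r4: "2 * (int n * P) < 2 ^ b" using r(4) by (simp only: P_R_def mult.assoc)
  have "0 \<le> 2 * int m * B" using r(1) by simp
  then show "\<bar>a\<bar> < 2 ^ b" using r(2) Q1 n r4 by linarith
  have "2 * (int n * R) < 2 ^ b" "P < 2 ^ b" using n r4 Q1 by linarith+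
  then show "2 * int n * Q ^ N < 2 ^ b" "Q ^ Suc N < 2 ^ b" by (simp_all only: P_R_def mult.assoc)
  have "int n < 2 ^ b" using n r4 Q1 by linarith
  then show "n < 2 ^ b" by simp
  show "3 < (2::int) ^ b" using assms by (simp add: ready_def)
qed

lemma colval_bound:
  assumes "ready b W a c N B Q s" "\<bar>\<sigma>\<bar> = 1" "i < n"
  shows "\<bar>colval a \<sigma> W c N i\<bar> \<le> Q ^ N"
  unfolding colval_def using assms
  by (intro accum_bound[where N = N] kern_pow_bound[where B = B]) (auto simp: ready_def)

lemma init_loop_spec:
  assumes s: "bdd b s" "s ''n'' 0 = int n"
  shows "reach init_loop s ((4 * n + 2) * U b) (\<lambda>s'. same {''v'', ''x'', ''y''} s s' \<and> bdd b s' \<and>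
    (\<forall>w<n. s' ''x'' (int w) = 0 \<and> s' ''y'' (int w) = 0))"
proof -
  define I where "I j s' \<longleftrightarrow> same {''v'', ''x'', ''y''} s s' \<and>
    (\<forall>w<j. s' ''x'' (int w) = 0 \<and> s' ''y'' (int w) = 0)" for j :: nat and s'
  have nb: "int n < 2 ^ b" using bddD[OF s(1), of "''n''" 0] s(2) by simp
  have step: "reach init_body s'
     (U b + U b) (advanced b ''v'' j I)"
    if j: "j < n" and I: "I j s'" and b: "bdd b s'" and f: "s' ''v'' 0 = int j" for j s'
    unfolding init_body_def
    apply (intro reach_Seq reach_Assign)
    apply (simp_all add: b f)
    using I apply (auto simp: I_def less_Suc_eq intro!: same_upd)
    done
  have "reach init_loop s (n * ((U b + U b) + 2 * U b) + 2 * U b) (\<lambda>s'. same {''v'', ''x'', ''y''} s s' \<and> bdd b s' \<and>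
    (\<forall>w<n. s' ''x'' (int w) = 0 \<and> s' ''y'' (int w) = 0))"
    unfolding init_loop_def
  proof (rule reach_For[where I = I, OF s(1) _ nb])
    show "I 0 (s(''v'' := (s ''v'')(0 := 0)))" by (auto simp: I_def intro: same_upd same_refl)
    show "aval (Var ''n'') s' = int n" if "I j s'" for j s'
      using that s(2) by (simp add: I_def same_def)
  qed (use step in \<open>auto simp: I_def\<close>)
  then show ?thesis by (rule reach_mono) (auto simp: algebra_simps)
qed

abbreviation "col_vars \<equiv> {''v'', ''x'', ''y'', ''j'', ''acc'', ''f'', ''g'', ''tr''}"

lemma column_body_spec:
  assumes s: "bdd b s" "ready b W a c N B Q s" and sg: "s ''s'' 0 = \<sigma>" "\<bar>\<sigma>\<bar> = 1" and i: "s ''i'' 0 = int i" "i < n"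
    and tr: "\<bar>s ''tr'' 0 + colval a \<sigma> W c N i\<bar> < 2 ^ b"
  shows "reach column_body s ((N * (5 * m + 4 * n + 7) + 4 * n + 8) * U b)
    (\<lambda>s'. same col_vars s s' \<and> bdd b s' \<and> s' ''tr'' 0 = s ''tr'' 0 + colval a \<sigma> W c N i)"
proof -
  note rb = ready_bounds[OF s(2)]
  have gs: "graph_state s" and n: "s ''n'' 0 = int n" using s(2) by (auto simp: ready_def graph_state_def)
  have *: "reach column_rest s1
      (U b + (U b + (U b + ((N * (5 * m + 4 * n + 7) + 2) * U b + U b))))
    (\<lambda>s'. same col_vars s s' \<and> bdd b s' \<and> s' ''tr'' 0 = s ''tr'' 0 + colval a \<sigma> W c N i)"
    if s1: "same {''v'', ''x'', ''y''} s s1" "bdd b s1" "\<forall>w<n. s1 ''x'' (int w) = 0 \<and> s1 ''y'' (int w) = 0" for s1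
  proof -
    have eq: "z \<notin> {''v'', ''x'', ''y''} \<Longrightarrow> s1 z = s z" for z using s1(1) by (rule sameD)
    have sa: "s ''a'' 0 = a" using s(2) by (simp add: ready_def)
    define s2 where "s2 = s1(''x'' := (s1 ''x'')(int i := 1), ''y'' := (s1 ''y'')(int i := a), ''acc'' := (s1 ''acc'')(0 := 0))"
    have sm2: "same ({''v'', ''x'', ''y''} \<union> {''acc''}) s s2"
      unfolding s2_def using s1(1) by (auto simp: same_def)
    have r2: "ready b W a c N B Q s2" by (rule ready_same[OF s(2) sm2]) auto
    have it: "reach iterate s2 ((N * (5 * m + 4 * n + 7) + 2) * U b)
      (\<lambda>s'. same {''j'', ''acc'', ''f'', ''g'', ''y'', ''v'', ''x''} s2 s' \<and> bdd b s' \<and>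
      s' ''acc'' 0 = colval a \<sigma> W c N i)" if "bdd b s2"
      unfolding colval_def
    proof (rule iterate_spec[OF that, where B = B and Q = Q])
      show "s2 ''x'' (int w) = delta i w" "s2 ''y'' (int w) = a * delta i w" if "w < n" for w
        using s1(3) that i(2) by (auto simp: s2_def delta_def)
    qed (use r2 sg i rb in \<open>auto simp: ready_def s2_def eq\<close>)
    show ?thesis
      unfolding column_rest_def
    proof (intro reach_Seq reach_Assign)
      show "bdd b s1" by (rule s1)
      assume b: "bdd b (s1(''x'' := (s1 ''x'')(aval (Var ''i'') s1 := aval (Num 1) s1)))"
      then show "bdd b (s1(''x'' := (s1 ''x'')(aval (Var ''i'') s1 := aval (Num 1) s1)))" .
      have e1: "s1(''x'' := (s1 ''x'')(aval (Var ''i'') s1 := aval (Num 1) s1)) = s1(''x'' := (s1 ''x'')(int i := 1))"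
        by (simp add: eq i)
      show "\<bar>aval (Var ''a'') (s1(''x'' := (s1 ''x'')(aval (Var ''i'') s1 := aval (Num 1) s1)))\<bar> < 2 ^ b"
        using rb(2) by (simp add: eq sa)
    next
      let ?s = "s1(''x'' := (s1 ''x'')(aval (Var ''i'') s1 := aval (Num 1) s1))"
      let ?t = "?s(''y'' := (?s ''y'')(aval (Var ''i'') ?s := aval (Var ''a'') ?s))"
      assume "bdd b ?t"
      then show "bdd b ?t" .
    next
      let ?s = "s1(''x'' := (s1 ''x'')(aval (Var ''i'') s1 := aval (Num 1) s1))"
      let ?t = "?s(''y'' := (?s ''y'')(aval (Var ''i'') ?s := aval (Var ''a'') ?s))"
      let ?u = "?t(''acc'' := (?t ''acc'')(aval (Num 0) ?t := aval (Num 0) ?t))"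
      assume b: "bdd b ?u"
      have e: "?u = s2" by (simp add: s2_def eq i sa)
      show "reach iterate ?u ((N * (5 * m + 4 * n + 7) + 2) * U b)
        (\<lambda>s'. reach (Set ''tr'' (Add (Var ''tr'') (Var ''acc''))) s' (U b)
          (\<lambda>s'. same col_vars s s' \<and> bdd b s' \<and> s' ''tr'' 0 = s ''tr'' 0 + colval a \<sigma> W c N i))"
        unfolding e
      proof (rule reach_mono[OF it order_refl])
        show "bdd b s2" using b unfolding e .
        fix s3 assume s3: "same {''j'', ''acc'', ''f'', ''g'', ''y'', ''v'', ''x''} s2 s3 \<and> bdd b s3 \<and>
          s3 ''acc'' 0 = colval a \<sigma> W c N i"
        have tr3: "s3 ''tr'' 0 = s ''tr'' 0"
          using sameD[of _ s2 s3 "''tr''"] s3 by (fastforce simp: s2_def eq)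
        have sm3: "same col_vars s s3"
          by (rule same_trans[OF sm2, of "{''j'', ''acc'', ''f'', ''g'', ''y'', ''v'', ''x''}"]) (use s3 in auto)
        show "reach (Set ''tr'' (Add (Var ''tr'') (Var ''acc''))) s3 (U b)
          (\<lambda>s'. same col_vars s s' \<and> bdd b s' \<and> s' ''tr'' 0 = s ''tr'' 0 + colval a \<sigma> W c N i)"
          by (rule reach_Assign) (use s3 tr in \<open>simp_all add: tr3 sm3 same_upd\<close>)
      qed
    qed (use rb in auto)
  qed
  have "reach column_body s ((4 * n + 2) * U b + (U b + (U b + (U b + ((N * (5 * m + 4 * n + 7) + 2) * U b + U b)))))
    (\<lambda>s'. same col_vars s s' \<and> bdd b s' \<and> s' ''tr'' 0 = s ''tr'' 0 + colval a \<sigma> W c N i)"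
    unfolding column_body_def
    by (rule reach_Seq, rule reach_mono[OF init_loop_spec[OF s(1) n] order_refl]) (use * in blast)
  then show ?thesis by (rule reach_mono) (auto simp: algebra_simps)
qed

text \<open>The hypothesis on \<open>tr\<close> admits what the other sign has already
  contributed.\<close>

lemma column_loop_spec:
  assumes s: "bdd b s" "ready b W a c N B Q s" and sg: "s ''s'' 0 = \<sigma>" "\<bar>\<sigma>\<bar> = 1"
    and tr: "\<bar>s ''tr'' 0\<bar> \<le> int n * Q ^ N"
  shows "reach column_loop s ((n * (N * (5 * m + 4 * n + 7) + 4 * n + 10) + 2) * U b)
    (\<lambda>s'. same (insert ''i'' col_vars) s s' \<and> bdd b s' \<and> s' ''tr'' 0 = s ''tr'' 0 + (\<Sum>i<n. colval a \<sigma> W c N i))"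
proof -
  note rb = ready_bounds[OF s(2)]
  define I where "I j s' \<longleftrightarrow> same (insert ''i'' col_vars) s s' \<and> s' ''tr'' 0 = s ''tr'' 0 + (\<Sum>i<j. colval a \<sigma> W c N i)"
    for j :: nat and s'
  have n: "s ''n'' 0 = int n" using s(2) by (auto simp: ready_def graph_state_def)
  have nb: "int n < 2 ^ b" using bddD[OF s(1), of "''n''" 0] n by simp
  have step: "reach column_body s' ((N * (5 * m + 4 * n + 7) + 4 * n + 8) * U b)
      (advanced b ''i'' j I)"
    if j: "j < n" and I: "I j s'" and b: "bdd b s'" and f: "s' ''i'' 0 = int j" for j s'
  proof -
    have sm: "same (insert ''i'' col_vars) s s'" and tr': "s' ''tr'' 0 = s ''tr'' 0 + (\<Sum>i<j. colval a \<sigma> W c N i)"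
      using I by (auto simp: I_def)
    have r': "ready b W a c N B Q s'" by (rule ready_same[OF s(2) sm]) auto
    have s': "s' ''s'' 0 = \<sigma>" using sameD[OF sm, of "''s''"] sg by simp
    have "\<bar>\<Sum>i<Suc j. colval a \<sigma> W c N i\<bar> \<le> (\<Sum>i<Suc j. Q ^ N)"
      by (intro order_trans[OF sum_abs] sum_mono colval_bound[OF s(2) sg(2)]) (use j in auto)
    also have "\<dots> \<le> int n * Q ^ N" using j rb(1) by (simp add: mult_right_mono del: sum.lessThan_Suc)
    finally have "\<bar>s' ''tr'' 0 + colval a \<sigma> W c N j\<bar> < 2 ^ b"
      using tr rb(3) by (simp add: tr')
    from column_body_spec[OF b r' s' sg(2) f j this]
    show ?thesis
    proof (rule reach_mono[OF _ order_refl], elim conjE)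
      fix s'' assume a: "same col_vars s' s''" "bdd b s''" "s'' ''tr'' 0 = s' ''tr'' 0 + colval a \<sigma> W c N j"
      have "same (insert ''i'' col_vars) s s''" by (rule same_trans[OF sm a(1)]) auto
      moreover have "s'' ''i'' 0 = int j" using sameD[OF a(1), of "''i''"] f by simp
      ultimately show "advanced b ''i'' j I s''"
        using a by (simp add: I_def tr' same_upd)
    qed
  qed
  have "reach column_loop s (n * ((N * (5 * m + 4 * n + 7) + 4 * n + 8) * U b + 2 * U b) + 2 * U b)
    (\<lambda>s'. same (insert ''i'' col_vars) s s' \<and> bdd b s' \<and> s' ''tr'' 0 = s ''tr'' 0 + (\<Sum>i<n. colval a \<sigma> W c N i))"
    unfolding column_loop_def
  proof (rule reach_For[where I = I, OF s(1) _ nb])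
    show "I 0 (s(''i'' := (s ''i'')(0 := 0)))" by (auto simp: I_def intro: same_upd same_refl)
    show "aval (Var ''n'') s' = int n" if "I j s'" for j s'
      using that n by (simp add: I_def same_def)
  qed (use step in \<open>auto simp: I_def\<close>)
  then show ?thesis by (rule reach_mono) (auto simp: algebra_simps)
qed

abbreviation "eval_vars \<equiv> {''h'', ''s'', ''i'', ''v'', ''x'', ''y'', ''j'', ''acc'', ''f'', ''g'', ''tr''}"

definition eval_cost :: "nat \<Rightarrow> nat" where
  "eval_cost N = 2 * (n * (N * (5 * m + 4 * n + 7) + 4 * n + 10)) + 13"

lemma evaluate_spec:
  assumes s: "bdd b s" "ready b W a c N B Q s"
  shows "reach evaluate s (eval_cost N * U b)
    (\<lambda>s'. same eval_vars s s' \<and> bdd b s' \<and> s' ''tr'' 0 = evalval a W c N)"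
proof -
  note rb = ready_bounds[OF s(2)]
  let ?T = "(n * (N * (5 * m + 4 * n + 7) + 4 * n + 10) + 2) * U b"
  define s0 where "s0 = s(''tr'' := (s ''tr'')(0 := 0))"
  define I where "I j s' \<longleftrightarrow> same eval_vars s s' \<and> s' ''tr'' 0 = (\<Sum>h<j. \<Sum>i<n. colval a (2 * int h - 1) W c N i)"
    for j :: nat and s'
  have b0: "bdd b s0" unfolding s0_def using s(1) rb by (intro bdd_upd) auto
  have step: "reach sign_body s' (U b + ?T)
      (advanced b ''h'' j I)"
    if j: "j < 2" and I: "I j s'" and b: "bdd b s'" and f: "s' ''h'' 0 = int j" for j s'
  proof -
    have sm: "same eval_vars s s'" and tr': "s' ''tr'' 0 = (\<Sum>h<j. \<Sum>i<n. colval a (2 * int h - 1) W c N i)"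
      using I by (auto simp: I_def)
    define s1 where "s1 = s'(''s'' := (s' ''s'')(0 := 2 * int j - 1))"
    have sg: "\<bar>2 * int h - 1\<bar> = 1" if "h < 2" for h
    proof -
      have "h = 0 \<or> h = 1" using that by linarith
      then show ?thesis by auto
    qed
    have b1: "bdd b s1" unfolding s1_def using b rb j by (intro bdd_upd) auto
    have sm1: "same eval_vars s s1" unfolding s1_def using sm by (intro same_upd) auto
    have r1: "ready b W a c N B Q s1" by (rule ready_same[OF s(2) sm1]) auto
    have "\<bar>s1 ''tr'' 0\<bar> \<le> int n * Q ^ N"
    proof -
      have c: "\<bar>\<Sum>i<n. colval a (2 * int h - 1) W c N i\<bar> \<le> int n * Q ^ N" if "h < 2" for h
      proof -
        have "\<bar>\<Sum>i<n. colval a (2 * int h - 1) W c N i\<bar> \<le> (\<Sum>i<n. Q ^ N)"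
          by (intro order_trans[OF sum_abs] sum_mono colval_bound[OF s(2) sg[OF that]]) auto
        then show ?thesis by simp
      qed
      have "j = 0 \<or> j = 1" using j by auto
      then show ?thesis
      proof
        assume "j = 0"
        then show ?thesis using rb(1) by (simp add: s1_def tr')
      next
        assume "j = 1"
        then show ?thesis using c[of 0] by (simp add: s1_def tr')
      qed
    qed
    from column_loop_spec[OF b1 r1 _ sg[OF j] this]
    have cl: "reach column_loop s1 ?T (advanced b ''h'' j I)"
    proof (rule reach_mono[OF _ order_refl], simp add: s1_def, elim conjE)
      fix s'' assume a: "same (insert ''i'' col_vars) s1 s''" "bdd b s''"
        "s'' ''tr'' 0 = s1 ''tr'' 0 + (\<Sum>i<n. colval a (2 * int j - 1) W c N i)"
      have "same eval_vars s s''" by (rule same_trans[OF sm1 a(1)]) auto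
      moreover have "s'' ''h'' 0 = int j" using sameD[OF a(1), of "''h''"] f by (simp add: s1_def)
      ultimately show "advanced b ''h'' j I s''"
        using a by (simp add: I_def tr' same_upd s1_def)
    qed
    show ?thesis
      unfolding sign_body_def
    proof (rule reach_Seq, rule reach_Assign[OF b])
      have "\<bar>2 * int j - 1\<bar> < 2 ^ b" using sg[OF j] rb(6) by linarith
      then show "\<bar>aval (Sub (Mul (Num 2) (Var ''h'')) (Num 1)) s'\<bar> < 2 ^ b" by (simp add: f)
      have "s'(''s'' := (s' ''s'')(aval (Num 0) s' := aval (Sub (Mul (Num 2) (Var ''h'')) (Num 1)) s')) = s1"
        by (simp add: s1_def f)
      with cl show "reach column_loop (s'(''s'' := (s' ''s'')(aval (Num 0) s' := aval (Sub (Mul (Num 2) (Var ''h'')) (Num 1)) s')))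
        ?T (advanced b ''h'' j I)"
        by (simp only:)
    qed simp
  qed
  have loop: "reach (For ''h'' (Num 2) sign_body) s0
      (2 * ((U b + ?T) + 2 * U b) + 2 * U b) (\<lambda>s'. same eval_vars s s' \<and> bdd b s' \<and> s' ''tr'' 0 = evalval a W c N)"
  proof (rule reach_For[where I = I, OF b0])
    show "I 0 (s0(''h'' := (s0 ''h'')(0 := 0)))" by (simp add: I_def s0_def same_upd same_refl)
    show "int 2 < 2 ^ b" using rb(6) by simp
    show "same eval_vars s s' \<and> bdd b s' \<and> s' ''tr'' 0 = evalval a W c N" if "I 2 s'" "bdd b s'" for s'
      using that by (simp only: I_def evalval_def)
    show "asz (Num 2) < 2000" by simp
    show "aval (Num 2) s' = int 2" for s' by simp
  qed (erule (3) step)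
  have "reach evaluate s (U b + (2 * ((U b + ?T) + 2 * U b) + 2 * U b)) (\<lambda>s'. same eval_vars s s' \<and> bdd b s' \<and> s' ''tr'' 0 = evalval a W c N)"
    unfolding evaluate_def
  proof (rule reach_Seq, rule reach_Assign[OF s(1)])
    show "reach (For ''h'' (Num 2) sign_body)
      (s(''tr'' := (s ''tr'')(aval (Num 0) s := aval (Num 0) s)))
      (2 * ((U b + ?T) + 2 * U b) + 2 * U b) (\<lambda>s'. same eval_vars s s' \<and> bdd b s' \<and> s' ''tr'' 0 = evalval a W c N)"
      using loop by (simp only: s0_def aval.simps)
  qed simp_all
  then show ?thesis by (rule reach_mono) (simp_all add: eval_cost_def algebra_simps)
qed

end

text \<open>\<open>t\<close> is \<open>r + 1\<close> because a candidate is judged by the potential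
  after its insertion. The entry \<open>- 1\<close> of \<open>sel\<close> marks an empty
  scan.\<close>

definition select_body :: com where
  "select_body = Seq (Set ''t'' (Add (Var ''r'') (Num 1)))
     (Seq (Set ''c'' (Mul (Mul (Mul (Num 3) (Var ''d'')) (Mul (Var ''q'') (Var ''m''))) (Sub (Var ''m'') (Var ''t''))))
     (Seq (Set ''a'' (Sub (Var ''c'') (Mul (Mul (Mul (Var ''p'') (Var ''d'')) (Add (Var ''k'') (Var ''t''))) (Sub (Var ''m'') (Var ''t'')))))
     (Seq (Set ''sel'' (Num (-1)))
     (Seq candidate_loop (Assign ''out'' (Var ''sel'') (Num 1))))))"

definition select_loop :: com where
  "select_loop = For ''r'' (Var ''k'') select_body"

definition degree_body :: com where
  "degree_body = Seq (Assign ''deg'' (Read ''src'' (Var ''f'')) (Add (Read ''deg'' (Read ''src'' (Var ''f''))) (Num 1)))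
     (Seq (Assign ''deg'' (Read ''dst'' (Var ''f'')) (Add (Read ''deg'' (Read ''dst'' (Var ''f''))) (Num 1)))
     (Seq (If (Less (Var ''d'') (Read ''deg'' (Read ''src'' (Var ''f'')))) (Set ''d'' (Read ''deg'' (Read ''src'' (Var ''f'')))) Skip)
       (If (Less (Var ''d'') (Read ''deg'' (Read ''dst'' (Var ''f'')))) (Set ''d'' (Read ''deg'' (Read ''dst'' (Var ''f'')))) Skip)))"

definition degree_loop :: com where
  "degree_loop = For ''f'' (Var ''m'') degree_body"

text \<open>The rounded quotient plus \<open>1\<close> lies between
  \<open>q\<^sup>2 / p\<^sup>2\<close> and \<open>q\<^sup>2 / p\<^sup>2 + 1\<close>; the factor
  \<open>1000\<close> is that of the locale \<open>barrier\<close>.\<close>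

definition sample_exp :: aexp where
  "sample_exp = Mul (Mul (Num 1000) (Var ''n'')) (Add (Div (Mul (Var ''q'') (Var ''q'')) (Mul (Var ''p'') (Var ''p''))) (Num 1))"

definition take_all :: com where
  "take_all = For ''f'' (Var ''m'') (Assign ''out'' (Var ''f'') (Num 1))"

definition take_greedily :: com where
  "take_greedily = Seq degree_loop (Seq (Set ''N'' (Mul (Num 2) (Mul (Var ''m'') (Mul (Var ''m'') (Var ''m''))))) select_loop)"

definition sparsify :: com where
  "sparsify = Seq (Set ''k'' sample_exp)
     (If (Less (Var ''m'') (Add (Mul (Num 2) (Var ''k'')) (Num 1)))
       take_all
       take_greedily)"

section \<open>Correctness of the greedy selection\<close>

context edge_list
begin

definition out_is :: "nat set \<Rightarrow> state \<Rightarrow> bool" where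
  "out_is P s \<longleftrightarrow> (\<forall>f<m. s ''out'' (int f) = of_bool (f \<in> P))"

text \<open>For \<open>t < m\<close>, the weight \<open>wt\<close> of the barrier argument times
  \<open>q * m * (m - t)\<close>.\<close>

definition wgt :: "nat \<Rightarrow> nat \<Rightarrow> nat set \<Rightarrow> nat \<Rightarrow> int" where
  "wgt q t P f = int q * int m * (int t - int m * of_bool (f \<in> P))"

definition score :: "int \<Rightarrow> int \<Rightarrow> nat \<Rightarrow> nat \<Rightarrow> nat \<Rightarrow> nat set \<Rightarrow> int" where
  "score a c q t N P = evalval a (wgt q t P) c N"

text \<open>\<open>ready\<close> without reference to the chosen set, hence stable while a candidate
  is inserted and removed.\<close>

definition cready :: "nat \<Rightarrow> int \<Rightarrow> int \<Rightarrow> nat \<Rightarrow> nat \<Rightarrow> nat \<Rightarrow> int \<Rightarrow> state \<Rightarrow> bool" where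
  "cready b a c N q t Q s \<longleftrightarrow> graph_state s \<and> s ''q'' 0 = int q \<and> s ''t'' 0 = int t \<and> t \<le> m \<and>
     \<bar>a\<bar> + 2 * int m * (int q * int m * int m) \<le> Q \<and> \<bar>c\<bar> + 1 \<le> Q \<and> 2 * int n * Q ^ Suc N < 2 ^ b \<and> 0 < n \<and>
     (3::int) < 2 ^ b \<and> s ''a'' 0 = a \<and> s ''c'' 0 = c \<and> s ''N'' 0 = int N"

lemma cready_same: "cready b a c N q t Q s \<Longrightarrow> same X s s' \<Longrightarrow>
  X \<inter> {''n'', ''m'', ''src'', ''dst'', ''q'', ''t'', ''a'', ''c'', ''N''} = {} \<Longrightarrow> cready b a c N q t Q s'"
  unfolding cready_def by (intro conjI) (auto elim: graph_state_same simp: same_def)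

lemma ready_if_cready:
  assumes "cready b a c N q t Q s" "out_is P s"
  shows "ready b (wgt q t P) a c N (int q * int m * int m) Q s"
proof -
  have "\<bar>wgt q t P f\<bar> \<le> int q * int m * int m" for f
  proof -
    have "\<bar>int t - int m * of_bool (f \<in> P)\<bar> \<le> int m" using assms(1) by (auto simp: cready_def)
    then have "int q * int m * \<bar>int t - int m * of_bool (f \<in> P)\<bar> \<le> int q * int m * int m"
      by (intro mult_left_mono) auto
    then show ?thesis by (simp add: wgt_def abs_mult)
  qed
  then show ?thesis using assms by (auto simp: ready_def cready_def out_is_def wgt_def)
qed

abbreviation "cand_vars \<equiv> {''out'', ''best'', ''sel'', ''h'', ''s'', ''i'', ''v'', ''x'', ''y'', ''j'', ''acc'', ''f'', ''g'', ''tr''}"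

lemma candidate_body_spec:
  assumes s: "bdd b s" "cready b a c N q t Q s" "out_is P s" and j: "s ''e'' 0 = int j" "j < m"
  shows "reach candidate_body s ((eval_cost N + 6) * U b)
    (\<lambda>s'. same cand_vars s s' \<and> bdd b s' \<and> out_is P s' \<and>
      (if j \<notin> P \<and> (s ''sel'' 0 < 0 \<or> score a c q t N (insert j P) < s ''best'' 0)
       then s' ''sel'' 0 = int j \<and> s' ''best'' 0 = score a c q t N (insert j P)
       else s' ''sel'' 0 = s ''sel'' 0 \<and> s' ''best'' 0 = s ''best'' 0))"
    (is "reach _ _ _ ?Q")
proof -
  let ?v = "score a c q t N (insert j P)"
  have b3: "(3::int) < 2 ^ b" using s(2) by (simp add: cready_def)
  have outj: "s ''out'' (int j) = of_bool (j \<in> P)" using s(3) j by (simp add: out_is_def)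
  have T: "reach candidate_body s (U b + (U b + (eval_cost N * U b + (U b + (U b + (U b + U b)))))) ?Q"
    unfolding candidate_body_def
  proof (rule reach_If[OF s(1)])
    assume "bval (Less (Read ''out'' (Var ''e'')) (Num 1)) s"
    then have jP: "j \<notin> P" using outj j by (cases "j \<in> P") auto
    define s1 where "s1 = s(''out'' := (s ''out'')(int j := 1))"
    have b1: "bdd b s1" unfolding s1_def using s(1) b3 by (intro bdd_upd) auto
    have sm1: "same {''out''} s s1" by (simp add: s1_def same_upd same_refl)
    have o1: "out_is (insert j P) s1" using s(3) by (auto simp: out_is_def s1_def)
    have r1: "ready b (wgt q t (insert j P)) a c N (int q * int m * int m) Q s1"
      by (rule ready_if_cready[OF cready_same[OF s(2) sm1] o1]) auto
    have ev: "reach evaluate s1 (eval_cost N * U b) (\<lambda>s2. reach (Seq (Assign ''out'' (Var ''e'') (Num 0))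
       keep_best) s2 (U b + (U b + (U b + U b))) ?Q)"
    proof (rule reach_mono[OF evaluate_spec[OF b1 r1] order_refl], elim conjE)
      fix s2 assume s2: "same eval_vars s1 s2" "bdd b s2" "s2 ''tr'' 0 = evalval a (wgt q t (insert j P)) c N"
      have eq: "z \<notin> insert ''out'' eval_vars \<Longrightarrow> s2 z = s z" for z
        using sameD[OF s2(1), of z] by (simp add: s1_def)
      have out2: "s2 ''out'' = (s ''out'')(int j := 1)" using sameD[OF s2(1), of "''out''"] by (simp add: s1_def)
      have tr2: "s2 ''tr'' 0 = ?v" using s2(3) by (simp add: score_def)
      define s3 where "s3 = s2(''out'' := (s2 ''out'')(int j := 0))"
      have sm3: "same cand_vars s s3"
        unfolding s3_def using same_trans[OF sm1 s2(1), of cand_vars] by (intro same_upd) auto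
      have b3': "bdd b s3" unfolding s3_def using s2(2) b3 by (intro bdd_upd) auto
      have o3: "out_is P s3" using s(3) jP by (auto simp: out_is_def s3_def out2)
      have v: "s3 ''tr'' 0 = ?v" "s3 ''sel'' 0 = s ''sel'' 0" "s3 ''best'' 0 = s ''best'' 0" "s3 ''e'' 0 = int j"
        using tr2 j by (auto simp: s3_def eq)
      have vb: "\<bar>?v\<bar> < 2 ^ b" using bddD[OF b3', of "''tr''" 0] v by simp
      have jb: "\<bar>int j\<bar> < 2 ^ b" using bddD[OF b3', of "''e''" 0] v by simp
      have upd: "same cand_vars s (s3(''best'' := f, ''sel'' := g))" "out_is P (s3(''best'' := f, ''sel'' := g))" for f g
        using sm3 o3 by (simp_all add: same_upd out_is_def)
      have if3: "reach keep_best s3 (U b + (U b + U b)) ?Q"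
        unfolding keep_best_def
      proof (rule reach_If[OF b3'])
        assume "bval (And (Not (Less (Var ''sel'') (Num 0))) (Not (Less (Var ''tr'') (Var ''best'')))) s3"
        then have "?Q s3" using sm3 b3' o3 v by auto
        then show "reach Skip s3 (U b + U b) ?Q" by (intro reach_mono[OF reach_Skip[where b = b]]) auto
      next
        assume n: "\<not> bval (And (Not (Less (Var ''sel'') (Num 0))) (Not (Less (Var ''tr'') (Var ''best'')))) s3"
        show "reach (Seq (Set ''best'' (Var ''tr'')) (Set ''sel'' (Var ''e''))) s3 (U b + U b) ?Q"
        proof (intro reach_Seq reach_Assign b3')
          show "\<bar>aval (Var ''tr'') s3\<bar> < 2 ^ b" using vb v by simp
        next
          let ?s = "s3(''best'' := (s3 ''best'')(aval (Num 0) s3 := aval (Var ''tr'') s3))"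
          show "\<bar>aval (Var ''e'') ?s\<bar> < 2 ^ b" using jb v by simp
          assume "bdd b ?s" then show "bdd b ?s" .
        next
          let ?s = "s3(''best'' := (s3 ''best'')(aval (Num 0) s3 := aval (Var ''tr'') s3))"
          let ?t = "?s(''sel'' := (?s ''sel'')(aval (Num 0) ?s := aval (Var ''e'') ?s))"
          assume "bdd b ?t"
          moreover have "?t ''sel'' 0 = int j" "?t ''best'' 0 = ?v" using v by simp_all
          ultimately show "?Q ?t" using n v jP upd by auto
        qed simp_all
      qed simp
      show "reach (Seq (Assign ''out'' (Var ''e'') (Num 0))
       keep_best) s2 (U b + (U b + (U b + U b))) ?Q"
      proof (rule reach_Seq, rule reach_Assign[OF s2(2)])
        have "s2(''out'' := (s2 ''out'')(aval (Var ''e'') s2 := aval (Num 0) s2)) = s3"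
          by (simp add: s3_def eq j)
        with if3 show "reach keep_best (s2(''out'' := (s2 ''out'')(aval (Var ''e'') s2 := aval (Num 0) s2)))
          (U b + (U b + U b)) ?Q" by (simp only:)
      qed simp_all
    qed
    show "reach try_edge
       s (U b + (eval_cost N * U b + (U b + (U b + (U b + U b))))) ?Q"
      unfolding try_edge_def
    proof (rule reach_Seq, rule reach_Assign[OF s(1)], simp)
      show "\<bar>aval (Num 1) s\<bar> < 2 ^ b" using b3 by simp
      have "s(''out'' := (s ''out'')(aval (Var ''e'') s := aval (Num 1) s)) = s1" by (simp add: s1_def j)
      then show "reach (Seq evaluate (Seq (Assign ''out'' (Var ''e'') (Num 0))
       keep_best)) (s(''out'' := (s ''out'')(aval (Var ''e'') s := aval (Num 1) s)))
         (eval_cost N * U b + (U b + (U b + (U b + U b)))) ?Q"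
        using reach_Seq[OF ev] by (simp only:)
    qed
  next
    assume "\<not> bval (Less (Read ''out'' (Var ''e'')) (Num 1)) s"
    then have "j \<in> P" using outj j by (cases "j \<in> P") auto
    then have "?Q s" using s by (simp add: same_refl)
    then show "reach Skip s (U b + (eval_cost N * U b + (U b + (U b + (U b + U b))))) ?Q"
      by (intro reach_mono[OF reach_Skip[where b = b]]) auto
  qed simp
  then show ?thesis by (rule reach_mono) (simp_all add: algebra_simps)
qed

text \<open>The first alternative describes a scan that has met chosen edges only; it is excluded at
  the end if some edge is unchosen.\<close>

definition best_candidate :: "(nat set \<Rightarrow> int) \<Rightarrow> nat set \<Rightarrow> nat \<Rightarrow> state \<Rightarrow> bool" where
  "best_candidate g P j s \<longleftrightarrow> (s ''sel'' 0 = - 1 \<and> {..<j} \<subseteq> P) \<or>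
    (\<exists>e<j. e \<notin> P \<and> s ''sel'' 0 = int e \<and> s ''best'' 0 = g (insert e P) \<and>
      (\<forall>e'<j. e' \<notin> P \<longrightarrow> g (insert e P) \<le> g (insert e' P)))"

lemma best_candidate_Suc:
  assumes "best_candidate g P j s"
    and "if j \<notin> P \<and> (s ''sel'' 0 < 0 \<or> g (insert j P) < s ''best'' 0)
       then s' ''sel'' 0 = int j \<and> s' ''best'' 0 = g (insert j P)
       else s' ''sel'' 0 = s ''sel'' 0 \<and> s' ''best'' 0 = s ''best'' 0"
  shows "best_candidate g P (Suc j) s'"
  using assms(1) unfolding best_candidate_def
proof
  assume a: "s ''sel'' 0 = - 1 \<and> {..<j} \<subseteq> P"
  show "(s' ''sel'' 0 = - 1 \<and> {..<Suc j} \<subseteq> P) \<or>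
    (\<exists>e<Suc j. e \<notin> P \<and> s' ''sel'' 0 = int e \<and> s' ''best'' 0 = g (insert e P) \<and>
      (\<forall>e'<Suc j. e' \<notin> P \<longrightarrow> g (insert e P) \<le> g (insert e' P)))"
  proof (cases "j \<in> P")
    case True
    then show ?thesis using a assms(2) by (auto simp: lessThan_Suc)
  next
    case False
    then have "s' ''sel'' 0 = int j \<and> s' ''best'' 0 = g (insert j P)" using a assms(2) by simp
    moreover have "e' = j" if "e' < Suc j" "e' \<notin> P" for e'
      using a that by (cases "e' = j") (auto simp: less_Suc_eq)
    ultimately show ?thesis using False by blast
  qed
next
  assume "\<exists>e<j. e \<notin> P \<and> s ''sel'' 0 = int e \<and> s ''best'' 0 = g (insert e P) \<and>
      (\<forall>e'<j. e' \<notin> P \<longrightarrow> g (insert e P) \<le> g (insert e' P))"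
  then obtain e where e: "e < j" "e \<notin> P" "s ''sel'' 0 = int e" "s ''best'' 0 = g (insert e P)"
    "\<And>e'. e' < j \<Longrightarrow> e' \<notin> P \<Longrightarrow> g (insert e P) \<le> g (insert e' P)" by blast
  show "(s' ''sel'' 0 = - 1 \<and> {..<Suc j} \<subseteq> P) \<or>
    (\<exists>e<Suc j. e \<notin> P \<and> s' ''sel'' 0 = int e \<and> s' ''best'' 0 = g (insert e P) \<and>
      (\<forall>e'<Suc j. e' \<notin> P \<longrightarrow> g (insert e P) \<le> g (insert e' P)))"
  proof (cases "j \<notin> P \<and> g (insert j P) < g (insert e P)")
    case True
    then have "s' ''sel'' 0 = int j \<and> s' ''best'' 0 = g (insert j P)" using e assms(2) by simp
    moreover have "g (insert j P) \<le> g (insert e' P)" if "e' < Suc j" "e' \<notin> P" for e'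
      using e(5)[of e'] that True by (cases "e' = j") auto
    ultimately show ?thesis using True by blast
  next
    case False
    then have "s' ''sel'' 0 = int e \<and> s' ''best'' 0 = g (insert e P)" using e assms(2) by auto
    moreover have "g (insert e P) \<le> g (insert e' P)" if "e' < Suc j" "e' \<notin> P" for e'
      using e(5)[of e'] that False by (cases "e' = j") auto
    ultimately show ?thesis using e less_Suc_eq by blast
  qed
qed

lemma candidate_loop_spec:
  assumes s: "bdd b s" "cready b a c N q t Q s" "out_is P s" and sel: "s ''sel'' 0 = - 1"
  shows "reach candidate_loop s ((m * (eval_cost N + 8) + 2) * U b)
    (\<lambda>s'. same (insert ''e'' cand_vars) s s' \<and> bdd b s' \<and> out_is P s' \<and> best_candidate (score a c q t N) P m s')"
proof -
  define I where "I j s' \<longleftrightarrow> same (insert ''e'' cand_vars) s s' \<and> out_is P s' \<and> best_candidate (score a c q t N) P j s'"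
    for j s'
  have m: "s ''m'' 0 = int m" using s(2) by (auto simp: cready_def graph_state_def)
  have mb: "int m < 2 ^ b" using bddD[OF s(1), of "''m''" 0] m by simp
  have upd: "I j (s'(''e'' := g)) \<longleftrightarrow> I j s'" for j s' g
    by (auto simp: I_def out_is_def best_candidate_def same_def)
  have step: "reach candidate_body s' ((eval_cost N + 6) * U b)
      (advanced b ''e'' j I)"
    if j: "j < m" and I: "I j s'" and b: "bdd b s'" and f: "s' ''e'' 0 = int j" for j s'
  proof -
    have sm: "same (insert ''e'' cand_vars) s s'" and o: "out_is P s'" and bc: "best_candidate (score a c q t N) P j s'"
      using I by (auto simp: I_def)
    have r': "cready b a c N q t Q s'" by (rule cready_same[OF s(2) sm]) auto
    show ?thesis
    proof (rule reach_mono[OF candidate_body_spec[OF b r' o f j] order_refl], elim conjE)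
      fix s'' assume a: "same cand_vars s' s''" "bdd b s''" "out_is P s''"
        "if j \<notin> P \<and> (s' ''sel'' 0 < 0 \<or> score a c q t N (insert j P) < s' ''best'' 0)
       then s'' ''sel'' 0 = int j \<and> s'' ''best'' 0 = score a c q t N (insert j P)
       else s'' ''sel'' 0 = s' ''sel'' 0 \<and> s'' ''best'' 0 = s' ''best'' 0"
      have "same (insert ''e'' cand_vars) s s''" by (rule same_trans[OF sm a(1)]) auto
      moreover have "s'' ''e'' 0 = int j" using sameD[OF a(1), of "''e''"] f by simp
      moreover have "best_candidate (score a c q t N) P (Suc j) s''"
        by (rule best_candidate_Suc[OF bc]) (rule a(4))
      ultimately show "advanced b ''e'' j I s''"
        using a(2,3) unfolding upd by (simp add: I_def)
    qed
  qed
  have "reach candidate_loop s (m * ((eval_cost N + 6) * U b + 2 * U b) + 2 * U b)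
    (\<lambda>s'. same (insert ''e'' cand_vars) s s' \<and> bdd b s' \<and> out_is P s' \<and> best_candidate (score a c q t N) P m s')"
    unfolding candidate_loop_def
  proof (rule reach_For[where I = I, OF s(1) _ mb])
    show "I 0 (s(''e'' := (s ''e'')(0 := 0)))"
      unfolding upd using s(3) sel by (simp add: I_def same_refl best_candidate_def)
    show "aval (Var ''m'') s' = int m" if "I j s'" for j s'
      using that m by (simp add: I_def same_def)
    show "asz (Var ''m'') < 2000" by simp
    show "same (insert ''e'' cand_vars) s s' \<and> bdd b s' \<and> out_is P s' \<and> best_candidate (score a c q t N) P m s'"
      if "I m s'" "bdd b s'" for s'
      using that by (simp add: I_def)
  qed (erule (3) step)
  then show ?thesis by (rule reach_mono) (simp_all add: algebra_simps)
qed


text \<open>The degree of \<open>w\<close> in the graph of the first \<open>j\<close> edges.\<close>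

definition cnt :: "nat \<Rightarrow> nat \<Rightarrow> int" where
  "cnt j w = (\<Sum>f<j. of_bool (u f = w) + of_bool (v f = w))"

text \<open>The running maximum is described by two inequalities, above all degrees and below
  \<open>D\<close>. The first feeds the barrier argument, the second the final bound.\<close>

definition deg_inv :: "int \<Rightarrow> nat \<Rightarrow> state \<Rightarrow> state \<Rightarrow> bool" where
  "deg_inv D j s s' \<longleftrightarrow> same {''f'', ''deg'', ''d''} s s' \<and> s' ''d'' 0 \<le> D \<and> 0 \<le> s' ''d'' 0 \<and>
     (\<forall>w<n. s' ''deg'' (int w) = cnt j w \<and> cnt j w \<le> s' ''d'' 0)"

lemma reach_max:
  assumes "bdd b s" "\<bar>aval e s\<bar> < 2 ^ b" "asz e < 1000"
    and Q: "bdd b (s(''d'' := (s ''d'')(0 := max (s ''d'' 0) (aval e s)))) \<Longrightarrow> Q (s(''d'' := (s ''d'')(0 := max (s ''d'' 0) (aval e s))))"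
  shows "reach (If (Less (Var ''d'') e) (Set ''d'' e) Skip) s (U b + U b) Q"
proof (rule reach_If[OF assms(1)])
  show "bsz (Less (Var ''d'') e) < 5000" using assms(3) by simp
  assume "bval (Less (Var ''d'') e) s"
  then have m: "max (s ''d'' 0) (aval e s) = aval e s" by simp
  show "reach (Set ''d'' e) s (U b) Q"
    using assms(3) Q unfolding m by (intro reach_Assign assms(1,2)) simp_all
next
  assume "\<not> bval (Less (Var ''d'') e) s"
  then have "max (s ''d'' 0) (aval e s) = s ''d'' 0" by simp
  then have "Q s" using Q assms(1) by simp
  then show "reach Skip s (U b) Q" by (rule reach_Skip)
qed

lemma degree_loop_spec:
  fixes D :: int
  assumes s: "bdd b s" "graph_state s" and z: "\<And>w. w < n \<Longrightarrow> s ''deg'' (int w) = 0" "s ''d'' 0 = 0"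
    and D: "\<And>w. w < n \<Longrightarrow> cnt m w \<le> D" "0 \<le> D" "D < 2 ^ b"
  shows "reach degree_loop s ((8 * m + 2) * U b) (\<lambda>s'. bdd b s' \<and> deg_inv D m s s')"
proof -
  have m: "s ''m'' 0 = int m" using s(2) by (auto simp: graph_state_def)
  have mb: "int m < 2 ^ b" using bddD[OF s(1), of "''m''" 0] m by simp
  have cntS: "cnt (Suc j) w = cnt j w + (of_bool (u j = w) + of_bool (v j = w))" for j w
    by (simp add: cnt_def)
  have cnt0: "0 \<le> cnt j w" for j w by (auto simp: cnt_def intro: sum_nonneg)
  have cntD: "cnt j w \<le> D" if "j \<le> m" "w < n" for j w
  proof -
    have "cnt j w \<le> cnt m w" unfolding cnt_def using that(1) by (intro sum_mono2) auto
    then show ?thesis using D(1)[OF that(2)] by linarith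
  qed
  have upd: "deg_inv D j s (s'(''f'' := g)) \<longleftrightarrow> deg_inv D j s s'" for j s' g
    by (auto simp: deg_inv_def same_def)
  have step: "reach degree_body s' (U b + (U b + ((U b + U b) + (U b + U b))))
      (\<lambda>s''. bdd b s'' \<and> s'' ''f'' 0 = int j \<and> deg_inv D (Suc j) s (s''(''f'' := (s'' ''f'')(0 := int (Suc j)))))"
    if j: "j < m" and I: "deg_inv D j s s'" and b: "bdd b s'" and f: "s' ''f'' 0 = int j" for j s'
  proof -
    have sm: "same {''f'', ''deg'', ''d''} s s'" using I by (simp add: deg_inv_def)
    have dg: "s' ''deg'' (int w) = cnt j w" "cnt j w \<le> s' ''d'' 0" if "w < n" for w using I that by (auto simp: deg_inv_def)
    have uvj: "u j < n" "v j < n" "u j \<noteq> v j" using uv[OF j] by auto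
    have sd: "s' ''src'' (int j) = int (u j)" "s' ''dst'' (int j) = int (v j)"
      using sameD[OF sm, of "''src''"] sameD[OF sm, of "''dst''"] s(2) j by (auto simp: graph_state_def)
    have cS: "cnt (Suc j) (u j) = cnt j (u j) + 1" "cnt (Suc j) (v j) = cnt j (v j) + 1"
      using uvj by (auto simp: cntS)
    have cb: "cnt j (u j) + 1 \<le> D" "cnt j (v j) + 1 \<le> D" "0 \<le> cnt j (u j)" "0 \<le> cnt j (v j)"
      using cntD[of "Suc j" "u j"] cntD[of "Suc j" "v j"] cS uvj j cnt0 by auto
    define s1 where "s1 = s'(''deg'' := (s' ''deg'')(int (u j) := cnt j (u j) + 1))"
    define s2 where "s2 = s1(''deg'' := (s1 ''deg'')(int (v j) := cnt j (v j) + 1))"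
    define s3 where "s3 = s2(''d'' := (s2 ''d'')(0 := max (s2 ''d'' 0) (cnt j (u j) + 1)))"
    define s4 where "s4 = s3(''d'' := (s3 ''d'')(0 := max (s3 ''d'' 0) (cnt j (v j) + 1)))"
    have v2: "aval (Read ''deg'' (Read ''src'' (Var ''f''))) s2 = cnt j (u j) + 1"
      using uvj by (simp add: s2_def s1_def f sd)
    have v3: "aval (Read ''deg'' (Read ''dst'' (Var ''f''))) s3 = cnt j (v j) + 1"
      using uvj by (simp add: s3_def s2_def s1_def f sd)
    have bd: "\<bar>cnt j (u j) + 1\<bar> < 2 ^ b" "\<bar>cnt j (v j) + 1\<bar> < 2 ^ b" using cb D(3) by linarith+
    have b1: "bdd b s1" unfolding s1_def by (intro bdd_upd b bd)
    have b2: "bdd b s2" unfolding s2_def by (intro bdd_upd b1 bd)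
    have e1: "s'(''deg'' := (s' ''deg'')(aval (Read ''src'' (Var ''f'')) s' := aval (Add (Read ''deg'' (Read ''src'' (Var ''f''))) (Num 1)) s')) = s1"
      using uvj dg by (simp add: s1_def f sd)
    have e2: "s1(''deg'' := (s1 ''deg'')(aval (Read ''dst'' (Var ''f'')) s1 := aval (Add (Read ''deg'' (Read ''dst'' (Var ''f''))) (Num 1)) s1)) = s2"
      using uvj dg by (simp add: s2_def s1_def f sd)
    have "deg_inv D (Suc j) s s4"
      unfolding deg_inv_def
    proof (intro conjI allI impI)
      show "same {''f'', ''deg'', ''d''} s s4" using sm by (simp add: s4_def s3_def s2_def s1_def same_upd)
      show "s4 ''d'' 0 \<le> D" using I cb by (simp add: deg_inv_def s4_def s3_def s2_def s1_def)
      show "0 \<le> s4 ''d'' 0" using I cb by (simp add: deg_inv_def s4_def s3_def s2_def s1_def)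
      fix w assume w: "w < n"
      show "s4 ''deg'' (int w) = cnt (Suc j) w"
        using uvj dg[OF w] by (auto simp: s4_def s3_def s2_def s1_def cntS)
      show "cnt (Suc j) w \<le> s4 ''d'' 0"
        using uvj dg[OF w] by (cases "w = u j"; cases "w = v j") (auto simp: s4_def s3_def s2_def s1_def cntS)
    qed
    moreover have "s4 ''f'' 0 = int j" by (simp add: s4_def s3_def s2_def s1_def f)
    ultimately have Q: "bdd b s4 \<Longrightarrow> bdd b s4 \<and> s4 ''f'' 0 = int j \<and> deg_inv D (Suc j) s (s4(''f'' := (s4 ''f'')(0 := int (Suc j))))"
      unfolding upd by simp
    show ?thesis
      unfolding degree_body_def
      apply (rule reach_Seq, rule reach_Assign[OF b])
        apply simp
       apply (use bd dg uvj in \<open>simp add: f sd\<close>)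
      apply (subst e1)
      apply (rule reach_Seq, rule reach_Assign[OF b1])
        apply simp
       apply (use bd dg uvj in \<open>simp add: s1_def f sd\<close>)
      apply (subst e2)
      apply (rule reach_Seq, rule reach_max[OF b2])
        apply (simp only: v2 bd)
       apply simp
      apply (unfold v2 s3_def[symmetric])
      apply (rule reach_max, assumption)
        apply (simp only: v3 bd)
       apply simp
      apply (unfold v3 s4_def[symmetric])
      by (rule Q)
  qed
  have "reach degree_loop s (m * ((U b + (U b + ((U b + U b) + (U b + U b)))) + 2 * U b) + 2 * U b)
     (\<lambda>s'. bdd b s' \<and> deg_inv D m s s')"
    unfolding degree_loop_def
  proof (rule reach_For[where I = "\<lambda>j. deg_inv D j s", OF s(1) _ mb])
    show "deg_inv D 0 s (s(''f'' := (s ''f'')(0 := 0)))"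
      unfolding upd using z D by (simp add: deg_inv_def same_refl cnt_def)
    show "aval (Var ''m'') s' = int m" if "deg_inv D j s s'" for j s'
      using that m by (simp add: deg_inv_def same_def)
    show "asz (Var ''m'') < 2000" by simp
    show "bdd b s' \<and> deg_inv D m s s'" if "deg_inv D m s s'" "bdd b s'" for s' using that by blast
  qed (erule (3) step)
  then show ?thesis by (rule reach_mono) (simp_all add: algebra_simps)
qed

text \<open>Multiplication by \<open>q m (m - t)\<close> makes the operators integral: \<open>diag_scale\<close> is the scaled upper bound \<open>3 d\<close>
  of their spectrum, and \<open>off_scale\<close> is what remains after subtracting the scaled multiple of the identity.\<close>

definition diag_scale :: "nat \<Rightarrow> nat \<Rightarrow> nat \<Rightarrow> int" where
  "diag_scale q d t = 3 * int d * (int q * int m) * (int m - int t)"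

definition off_scale :: "nat \<Rightarrow> nat \<Rightarrow> nat \<Rightarrow> nat \<Rightarrow> nat \<Rightarrow> int" where
  "off_scale p q k d t = diag_scale q d t - int p * int d * (int k + int t) * (int m - int t)"

definition greedy_score :: "nat \<Rightarrow> nat \<Rightarrow> nat \<Rightarrow> nat \<Rightarrow> nat \<Rightarrow> nat \<Rightarrow> nat set \<Rightarrow> int" where
  "greedy_score p q k d N t = score (off_scale p q k d t) (diag_scale q d t) q t N"

text \<open>With \<open>Y = q * m ^ 3\<close>, both \<open>diag_scale\<close> and
  \<open>off_scale\<close> are at most \<open>3 * Y\<close> in absolute value and the edge part adds
  \<open>2 * Y\<close>; the rest is slack.\<close>

definition big_base :: "nat \<Rightarrow> int" where
  "big_base q = 8 * int q * int m ^ 3"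

definition sready :: "nat \<Rightarrow> nat \<Rightarrow> nat \<Rightarrow> nat \<Rightarrow> nat \<Rightarrow> nat \<Rightarrow> state \<Rightarrow> bool" where
  "sready b p q k d N s \<longleftrightarrow> graph_state s \<and> s ''p'' 0 = int p \<and> s ''q'' 0 = int q \<and> s ''k'' 0 = int k \<and>
     s ''d'' 0 = int d \<and> s ''N'' 0 = int N \<and> 0 < q \<and> p \<le> q \<and> d \<le> m \<and> 2 * k \<le> m \<and> 0 < n \<and> 0 < m \<and>
     2 * int n * big_base q ^ Suc N < 2 ^ b \<and> (3::int) < 2 ^ b"

lemma sready_same: "sready b p q k d N s \<Longrightarrow> same X s s' \<Longrightarrow>
  X \<inter> {''n'', ''m'', ''src'', ''dst'', ''p'', ''q'', ''k'', ''d'', ''N''} = {} \<Longrightarrow> sready b p q k d N s'"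
  unfolding sready_def by (intro conjI) (auto elim: graph_state_same simp: same_def)

lemma scale_bounds:
  assumes "0 < q" "p \<le> q" "d \<le> m" "2 * k \<le> m" "t \<le> k" "0 < m"
  shows "\<bar>off_scale p q k d t\<bar> + 2 * int m * (int q * int m * int m) \<le> big_base q"
    and "\<bar>diag_scale q d t\<bar> + 1 \<le> big_base q"
proof -
  define X where "X = int q * int m ^ 3"
  have X: "1 \<le> X" using assms mult_mono[of 1 "int q" 1 "int m ^ 3"] by (simp add: X_def)
  define z where "z = int p * int d * (int k + int t) * (int m - int t)"
  have c0: "0 \<le> diag_scale q d t" using assms by (simp add: diag_scale_def)
  have "3 * (int d * (int q * int m) * (int m - int t)) \<le> 3 * (int m * (int q * int m) * int m)"
    using assms by (intro mult_left_mono mult_mono) auto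
  then have c1: "diag_scale q d t \<le> 3 * X" by (simp add: diag_scale_def X_def power3_eq_cube mult_ac)
  have z0: "0 \<le> z" using assms by (simp add: z_def)
  have "z \<le> int q * int m * int m * int m"
    unfolding z_def using assms by (intro mult_mono) auto
  then have z1: "z \<le> X" by (simp add: X_def power3_eq_cube mult_ac)
  have eqs: "off_scale p q k d t = diag_scale q d t - z" "2 * int m * (int q * int m * int m) = 2 * X" "big_base q = 8 * X"
    by (simp_all add: off_scale_def z_def X_def power3_eq_cube big_base_def mult_ac)
  show "\<bar>off_scale p q k d t\<bar> + 2 * int m * (int q * int m * int m) \<le> big_base q"
    "\<bar>diag_scale q d t\<bar> + 1 \<le> big_base q"
    unfolding eqs using X c0 c1 z0 z1 by linarith+
qed

abbreviation "sel_vars \<equiv> {''r'', ''t'', ''c'', ''a'', ''e'', ''out'', ''best'', ''sel'', ''h'', ''s'', ''i'', ''v'', ''x'', ''y'', ''j'', ''acc'', ''f'', ''g'', ''tr''}"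

lemma select_body_spec:
  assumes s: "bdd b s" "sready b p q k d N s" "out_is P s" and P: "P \<subset> {..<m}" and r: "s ''r'' 0 = int r" "r < k"
  shows "reach select_body s ((m * (eval_cost N + 8) + 7) * U b)
    (\<lambda>s'. same (sel_vars - {''r''}) s s' \<and> bdd b s' \<and> (\<exists>e<m. e \<notin> P \<and> out_is (insert e P) s' \<and>
      (\<forall>e'<m. e' \<notin> P \<longrightarrow> greedy_score p q k d N (Suc r) (insert e P) \<le> greedy_score p q k d N (Suc r) (insert e' P))))"
    (is "reach _ _ _ ?Q")
proof -
  let ?c = "diag_scale q d (Suc r)" and ?a = "off_scale p q k d (Suc r)"
  have sr: "s ''p'' 0 = int p" "s ''q'' 0 = int q" "s ''k'' 0 = int k" "s ''d'' 0 = int d" "s ''m'' 0 = int m" "s ''n'' 0 = int n"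
    "0 < q" "p \<le> q" "d \<le> m" "2 * k \<le> m" "0 < n" "0 < m"
    "2 * int n * big_base q ^ Suc N < 2 ^ b" "(3::int) < 2 ^ b"
    using s(2) by (auto simp: sready_def graph_state_def)
  have sb: "\<bar>?a\<bar> + 2 * int m * (int q * int m * int m) \<le> big_base q" "\<bar>?c\<bar> + 1 \<le> big_base q"
    using scale_bounds[OF sr(7-10) _ sr(12), of "Suc r"] r by auto
  define s1 where "s1 = s(''t'' := (s ''t'')(0 := int (Suc r)))"
  define s2 where "s2 = s1(''c'' := (s1 ''c'')(0 := ?c))"
  define s3 where "s3 = s2(''a'' := (s2 ''a'')(0 := ?a))"
  define s4 where "s4 = s3(''sel'' := (s3 ''sel'')(0 := - 1))"
  have e1: "s(''t'' := (s ''t'')(aval (Num 0) s := aval (Add (Var ''r'') (Num 1)) s)) = s1"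
    by (simp add: s1_def r add.commute)
  have e2: "aval (Mul (Mul (Mul (Num 3) (Var ''d'')) (Mul (Var ''q'') (Var ''m''))) (Sub (Var ''m'') (Var ''t''))) s1 = ?c"
    by (simp add: s1_def sr diag_scale_def)
  have e3: "aval (Sub (Var ''c'') (Mul (Mul (Mul (Var ''p'') (Var ''d'')) (Add (Var ''k'') (Var ''t''))) (Sub (Var ''m'') (Var ''t'')))) s2 = ?a"
    by (simp add: s2_def s1_def sr off_scale_def)
  have n0: "aval (Num 0) z = 0" "aval (Num (-1)) z = - 1" for z by simp_all
  have big: "\<bar>?a\<bar> < 2 ^ b" "\<bar>?c\<bar> < 2 ^ b" "\<bar>int (Suc r)\<bar> < 2 ^ b"
  proof -
    have bb: "1 \<le> big_base q" using sb(2) by linarith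
    then have p: "big_base q \<le> big_base q ^ Suc N" "1 \<le> big_base q ^ Suc N"
      using power_increasing[of 1 "Suc N" "big_base q"] one_le_power[of "big_base q" "Suc N"] by (simp_all only: power_one_right)
    have "1 * big_base q ^ Suc N \<le> int n * big_base q ^ Suc N" using sr(11) p by (intro mult_right_mono) auto
    then have B: "big_base q < 2 ^ b" using sr(13) p by (simp only: mult.assoc)
    have "0 \<le> 2 * int m * (int q * int m * int m)" by simp
    then show "\<bar>?a\<bar> < 2 ^ b" "\<bar>?c\<bar> < 2 ^ b" using B sb by linarith+
    have "int m < 2 ^ b" using bddD[OF s(1), of "''m''" 0] sr by simp
    then show "\<bar>int (Suc r)\<bar> < 2 ^ b" using r sr(10) by linarith
  qed
  have b1: "bdd b s1" unfolding s1_def by (intro bdd_upd s big)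
  have b2: "bdd b s2" unfolding s2_def by (intro bdd_upd b1 big)
  have b3: "bdd b s3" unfolding s3_def by (intro bdd_upd b2 big)
  have b4: "bdd b s4" unfolding s4_def using sr(14) by (intro bdd_upd b3) simp
  have sm4: "same (sel_vars - {''r''}) s s4" by (simp add: s4_def s3_def s2_def s1_def same_upd same_refl)
  have o4: "out_is P s4" using s(3) by (simp add: out_is_def s4_def s3_def s2_def s1_def)
  have cr: "cready b ?a ?c N q (Suc r) (big_base q) s4"
    unfolding cready_def
  proof (intro conjI)
    show "graph_state s4" using s(2) by (simp add: sready_def graph_state_def s4_def s3_def s2_def s1_def)
    show "s4 ''N'' 0 = int N" using s(2) by (simp add: sready_def s4_def s3_def s2_def s1_def)
    show "Suc r \<le> m" using r sr by linarith
  qed (use sr sb in \<open>simp_all add: s4_def s3_def s2_def s1_def\<close>)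
  have last: "reach (Assign ''out'' (Var ''sel'') (Num 1)) s5 (U b) ?Q"
    if s5: "same (insert ''e'' cand_vars) s4 s5" "bdd b s5" "out_is P s5" "best_candidate (score ?a ?c q (Suc r) N) P m s5" for s5
  proof -
    \<comment> \<open>Excludes the alternative \<open>sel = - 1\<close>, so the final assignment
      marks an edge.\<close>
    have "\<not> {..<m} \<subseteq> P" using P by blast
    then obtain e where e: "e < m" "e \<notin> P" "s5 ''sel'' 0 = int e"
      "\<And>e'. e' < m \<Longrightarrow> e' \<notin> P \<Longrightarrow> greedy_score p q k d N (Suc r) (insert e P) \<le> greedy_score p q k d N (Suc r) (insert e' P)"
      using s5(4) unfolding best_candidate_def greedy_score_def by blast
    have sm5: "same (sel_vars - {''r''}) s s5" by (rule same_trans[OF sm4 s5(1)]) auto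
    show ?thesis
    proof (rule reach_Assign[OF s5(2)])
      let ?s = "s5(''out'' := (s5 ''out'')(aval (Var ''sel'') s5 := aval (Num 1) s5))"
      have "?s = s5(''out'' := (s5 ''out'')(int e := 1))" by (simp add: e)
      then have "out_is (insert e P) ?s" using s5(3) by (auto simp: out_is_def)
      moreover have "same (sel_vars - {''r''}) s ?s" using sm5 by (simp add: same_upd)
      moreover assume "bdd b ?s"
      ultimately show "?Q ?s" using e by blast
    qed (use sr in simp_all)
  qed
  have cl: "reach candidate_loop s4 ((m * (eval_cost N + 8) + 2) * U b)
      (\<lambda>s5. reach (Assign ''out'' (Var ''sel'') (Num 1)) s5 (U b) ?Q)"
    by (rule reach_mono[OF candidate_loop_spec[OF b4 cr o4] order_refl]) (simp add: s4_def, elim conjE, erule (3) last)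
  have "reach select_body s (U b + (U b + (U b + (U b + ((m * (eval_cost N + 8) + 2) * U b + U b))))) ?Q"
    unfolding select_body_def
    apply (rule reach_Seq, rule reach_Assign[OF s(1)])
      apply simp
     apply (use big(3) in \<open>simp add: r add.commute\<close>)
    apply (subst e1)
    apply (rule reach_Seq, rule reach_Assign[OF b1])
      apply simp
     apply (subst e2, rule big)
    apply (unfold e2 n0 s2_def[symmetric])
    apply (rule reach_Seq, rule reach_Assign[OF b2])
      apply simp
     apply (subst e3, rule big)
    apply (unfold e3 n0 s3_def[symmetric])
    apply (rule reach_Seq, rule reach_Assign[OF b3])
      apply simp
     apply (use sr(14) in simp)
    apply (unfold n0 s4_def[symmetric])
    apply (rule reach_Seq, rule cl)
    done
  then show ?thesis by (rule reach_mono) (simp_all add: algebra_simps)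
qed

text \<open>\<open>G\<close> is any property that every minimal choice preserves; this separates the
  execution from the analysis of the potential.\<close>

lemma select_loop_spec:
  assumes s: "bdd b s" "sready b p q k d N s" "out_is {} s"
    and G0: "G 0 {}"
    and GS: "\<And>r P e. r < k \<Longrightarrow> P \<subseteq> {..<m} \<Longrightarrow> card P = r \<Longrightarrow> G r P \<Longrightarrow> e < m \<Longrightarrow> e \<notin> P \<Longrightarrow>
      (\<And>e'. e' < m \<Longrightarrow> e' \<notin> P \<Longrightarrow> greedy_score p q k d N (Suc r) (insert e P) \<le> greedy_score p q k d N (Suc r) (insert e' P)) \<Longrightarrow>
      G (Suc r) (insert e P)"
  shows "reach select_loop s ((k * (m * (eval_cost N + 8) + 9) + 2) * U b)
    (\<lambda>s'. \<exists>P. P \<subseteq> {..<m} \<and> card P = k \<and> G k P \<and> out_is P s')"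
proof -
  define I where "I j s' \<longleftrightarrow> same sel_vars s s' \<and> (\<exists>P. P \<subseteq> {..<m} \<and> card P = j \<and> G j P \<and> out_is P s')" for j s'
  have sr: "s ''k'' 0 = int k" "2 * k \<le> m" "0 < m" using s(2) by (auto simp: sready_def)
  have kb: "int k < 2 ^ b" using bddD[OF s(1), of "''k''" 0] sr by simp
  have upd: "I j (s'(''r'' := g)) \<longleftrightarrow> I j s'" for j s' g
    by (auto simp: I_def out_is_def same_def)
  have step: "reach select_body s' ((m * (eval_cost N + 8) + 7) * U b)
      (advanced b ''r'' j I)"
    if j: "j < k" and I: "I j s'" and b: "bdd b s'" and f: "s' ''r'' 0 = int j" for j s'
  proof -
    have sm: "same sel_vars s s'" using I by (simp add: I_def)
    obtain P where P: "P \<subseteq> {..<m}" "card P = j" "G j P" "out_is P s'" using I unfolding I_def by blast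
    have finP: "finite P" using P(1) finite_subset by blast
    have r': "sready b p q k d N s'" by (rule sready_same[OF s(2) sm]) auto
    have "P \<noteq> {..<m}" using P(2) j sr by auto
    then have psub: "P \<subset> {..<m}" using P(1) by blast
    show ?thesis
    proof (rule reach_mono[OF select_body_spec[OF b r' P(4) psub f j] order_refl], elim conjE exE)
      fix s'' e assume a: "same (sel_vars - {''r''}) s' s''" "bdd b s''" "e < m" "e \<notin> P" "out_is (insert e P) s''"
        "\<forall>e'<m. e' \<notin> P \<longrightarrow> greedy_score p q k d N (Suc j) (insert e P) \<le> greedy_score p q k d N (Suc j) (insert e' P)"
      have "G (Suc j) (insert e P)" by (rule GS[OF j P(1-3) a(3,4)]) (use a(6) in blast)
      moreover have "insert e P \<subseteq> {..<m}" "card (insert e P) = Suc j" using P finP a by auto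
      moreover have "same sel_vars s s''" by (rule same_trans[OF sm a(1)]) auto
      ultimately have "I (Suc j) s''"
        using a(5) unfolding I_def by (intro conjI exI[of _ "insert e P"])
      moreover have "s'' ''r'' 0 = int j" using sameD[OF a(1), of "''r''"] f by simp
      ultimately show "advanced b ''r'' j I s''"
        using a(2) unfolding upd by (intro conjI)
    qed
  qed
  have "reach select_loop s (k * ((m * (eval_cost N + 8) + 7) * U b + 2 * U b) + 2 * U b)
    (\<lambda>s'. \<exists>P. P \<subseteq> {..<m} \<and> card P = k \<and> G k P \<and> out_is P s')"
    unfolding select_loop_def
  proof (rule reach_For[where I = I, OF s(1) _ kb])
    show "I 0 (s(''r'' := (s ''r'')(0 := 0)))"
      unfolding upd using s(3) G0 by (auto simp: I_def same_refl)
    show "aval (Var ''k'') s' = int k" if "I j s'" for j s'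
      using that sr by (simp add: I_def same_def)
    show "asz (Var ''k'') < 2000" by simp
    show "\<exists>P. P \<subseteq> {..<m} \<and> card P = k \<and> G k P \<and> out_is P s'" if "I k s'" for s'
      using that by (simp add: I_def)
  qed (erule (3) step)
  then show ?thesis by (rule reach_mono) (simp_all add: algebra_simps)
qed


definition sample_size :: "nat \<Rightarrow> nat \<Rightarrow> nat" where
  "sample_size p q = 1000 * n * (q * q div (p * p) + 1)"

text \<open>\<open>G\<close> now depends on \<open>d\<close> as well, because this parameter of the
  potential is only fixed by the degree computation at run time.\<close>

lemma sparsify_spec:
  fixes b p q D :: nat and G :: "nat \<Rightarrow> nat \<Rightarrow> nat set \<Rightarrow> bool"
  defines "k \<equiv> sample_size p q" and "N \<equiv> 2 * m ^ 3"
  assumes s: "bdd b s" "graph_state s" "s ''p'' 0 = int p" "s ''q'' 0 = int q" "out_is {} s"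
      "\<And>w. w < n \<Longrightarrow> s ''deg'' (int w) = 0" "s ''d'' 0 = 0"
    and pq: "p \<le> q" "0 < q" and D: "\<And>w. w < n \<Longrightarrow> cnt m w \<le> int D" "D \<le> m"
    and b: "2 * int n * big_base q ^ Suc N < 2 ^ b" "(3::int) < 2 ^ b" "int k < 2 ^ b" "int N < 2 ^ b"
    and G0: "\<And>d. 2 * k < m \<Longrightarrow> (\<And>w. w < n \<Longrightarrow> cnt m w \<le> int d) \<Longrightarrow> d \<le> D \<Longrightarrow> G d 0 {}"
    and GS: "\<And>d r P e. 2 * k < m \<Longrightarrow> (\<And>w. w < n \<Longrightarrow> cnt m w \<le> int d) \<Longrightarrow> d \<le> D \<Longrightarrow>
      r < k \<Longrightarrow> P \<subseteq> {..<m} \<Longrightarrow> card P = r \<Longrightarrow> G d r P \<Longrightarrow> e < m \<Longrightarrow> e \<notin> P \<Longrightarrow>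
      (\<And>e'. e' < m \<Longrightarrow> e' \<notin> P \<Longrightarrow> greedy_score p q k d N (Suc r) (insert e P) \<le> greedy_score p q k d N (Suc r) (insert e' P)) \<Longrightarrow>
      G d (Suc r) (insert e P)"
  shows "reach sparsify s ((m * (m * (eval_cost N + 8) + 9) + 8 * m + 8) * U b)
    (\<lambda>s'. (m \<le> 2 * k \<and> out_is {..<m} s') \<or>
      (2 * k < m \<and> (\<exists>d P. (\<forall>w<n. cnt m w \<le> int d) \<and> d \<le> D \<and> P \<subseteq> {..<m} \<and> card P = k \<and> G d k P \<and> out_is P s')))"
    (is "reach _ _ ?T ?Q")
proof -
  have nm: "s ''n'' 0 = int n" "s ''m'' 0 = int m" using s(2) by (auto simp: graph_state_def)
  have mb: "int m < 2 ^ b" using bddD[OF s(1), of "''m''" 0] nm by simp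
  define s1 where "s1 = s(''k'' := (s ''k'')(0 := int k))"
  have vk: "aval sample_exp s = int k"
    by (simp add: sample_exp_def nm s(3,4) k_def sample_size_def zdiv_int algebra_simps)
  have e1: "s(''k'' := (s ''k'')(aval (Num 0) s := aval sample_exp s)) = s1"
    unfolding vk by (simp add: s1_def)
  have b1: "bdd b s1" unfolding s1_def using b by (intro bdd_upd s) simp
  have g1: "graph_state s1" using s(2) by (simp add: s1_def graph_state_def)
  have nm1: "s1 ''m'' 0 = int m" "s1 ''k'' 0 = int k" by (simp_all add: s1_def nm)
  have all: "reach take_all s1 ((3 * m + 2) * U b) (out_is {..<m})"
  proof -
    define I where "I j s' \<longleftrightarrow> s' ''m'' 0 = int m \<and> (\<forall>f<j. s' ''out'' (int f) = 1)" for j :: nat and s' :: state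
    have step: "reach (Assign ''out'' (Var ''f'') (Num 1)) s' (U b)
      (advanced b ''f'' j I)"
      if j: "j < m" and I: "I j s'" and bs: "bdd b s'" and f: "s' ''f'' 0 = int j" for j s'
    proof (rule reach_Assign[OF bs])
      show "\<bar>aval (Num 1) s'\<bar> < 2 ^ b" using b by simp
    qed (use I f in \<open>auto simp: I_def less_Suc_eq\<close>)
    have "reach take_all s1 (m * (U b + 2 * U b) + 2 * U b) (out_is {..<m})"
      unfolding take_all_def
    proof (rule reach_For[where I = I, OF b1 _ mb])
      show "I 0 (s1(''f'' := (s1 ''f'')(0 := 0)))" by (simp add: I_def nm1)
      show "aval (Var ''m'') s' = int m" if "I j s'" for j s' using that by (simp add: I_def)
      show "asz (Var ''m'') < 2000" by simp
      show "out_is {..<m} s'" if "I m s'" for s' using that by (simp add: I_def out_is_def)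
    qed (erule (3) step)
    then show ?thesis by (rule reach_mono) (simp_all add: algebra_simps)
  qed
  have sel: "reach take_greedily s1
      ((8 * m + 2) * U b + (U b + (k * (m * (eval_cost N + 8) + 9) + 2) * U b)) ?Q" if km: "2 * k < m"
    unfolding take_greedily_def
  proof (rule reach_Seq)
    have m0: "0 < m" "0 < n" using km uv[of 0] by auto
    have "reach degree_loop s1 ((8 * m + 2) * U b) (\<lambda>s'. bdd b s' \<and> deg_inv (int D) m s1 s')"
    proof (rule degree_loop_spec[OF b1 g1])
      show "int D < 2 ^ b" using mb D(2) by linarith
    qed (use s D in \<open>auto simp: s1_def\<close>)
    then show "reach degree_loop s1 ((8 * m + 2) * U b) (\<lambda>s2. reach (Seq (Set ''N'' (Mul (Num 2) (Mul (Var ''m'') (Mul (Var ''m'') (Var ''m''))))) select_loop) s2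
        (U b + (k * (m * (eval_cost N + 8) + 9) + 2) * U b) ?Q)"
    proof (rule reach_mono[OF _ order_refl], elim conjE)
      fix s2 assume s2: "bdd b s2" "deg_inv (int D) m s1 s2"
      have sm: "same {''f'', ''deg'', ''d''} s1 s2" using s2(2) by (simp add: deg_inv_def)
      define d where "d = nat (s2 ''d'' 0)"
      have d: "s2 ''d'' 0 = int d" "d \<le> D" "\<And>w. w < n \<Longrightarrow> cnt m w \<le> int d"
        using s2(2) by (auto simp: deg_inv_def d_def)
      have eq: "z \<notin> {''f'', ''deg'', ''d''} \<Longrightarrow> s2 z = s1 z" for z using sm by (rule sameD)
      define s3 where "s3 = s2(''N'' := (s2 ''N'')(0 := int N))"
      have vN: "aval (Mul (Num 2) (Mul (Var ''m'') (Mul (Var ''m'') (Var ''m'')))) s2 = int N"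
        by (simp add: eq nm1 N_def power3_eq_cube)
      have b3: "bdd b s3" unfolding s3_def using b by (intro bdd_upd s2) simp
      have g3: "graph_state s3" using g1 by (simp add: s3_def graph_state_def eq)
      have "sready b p q k d N s3"
        unfolding sready_def using g3 pq D d km m0 b by (simp add: s3_def eq s1_def s(3,4))
      moreover have "out_is {} s3" using s(5) by (simp add: out_is_def s3_def eq s1_def)
      ultimately have "reach select_loop s3 ((k * (m * (eval_cost N + 8) + 9) + 2) * U b)
        (\<lambda>s'. \<exists>P. P \<subseteq> {..<m} \<and> card P = k \<and> G d k P \<and> out_is P s')"
        by (rule select_loop_spec[OF b3]) (use G0[OF km d(3,2)] GS[OF km d(3,2)] in blast)+
      then have "reach select_loop s3 ((k * (m * (eval_cost N + 8) + 9) + 2) * U b) ?Q"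
        by (rule reach_mono) (use km d in auto)
      moreover have "s2(''N'' := (s2 ''N'')(aval (Num 0) s2 := aval (Mul (Num 2) (Mul (Var ''m'') (Mul (Var ''m'') (Var ''m'')))) s2)) = s3"
        unfolding vN by (simp add: s3_def)
      ultimately show "reach (Seq (Set ''N'' (Mul (Num 2) (Mul (Var ''m'') (Mul (Var ''m'') (Var ''m''))))) select_loop) s2
        (U b + (k * (m * (eval_cost N + 8) + 9) + 2) * U b) ?Q"
        using b(4) by (intro reach_Seq reach_Assign[OF s2(1)]) (simp_all only: vN, simp_all)
    qed
  qed
  have "reach sparsify s (U b + (U b + (m * (m * (eval_cost N + 8) + 9) + 8 * m + 6) * U b)) ?Q"
    unfolding sparsify_def
  proof (rule reach_Seq, rule reach_Assign[OF s(1)])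
    show "\<bar>aval sample_exp s\<bar> < 2 ^ b"
      unfolding vk using b by simp
    show "reach (If (Less (Var ''m'') (Add (Mul (Num 2) (Var ''k'')) (Num 1)))
       take_all
       take_greedily)
      (s(''k'' := (s ''k'')(aval (Num 0) s := aval sample_exp s)))
      (U b + (m * (m * (eval_cost N + 8) + 9) + 8 * m + 6) * U b) ?Q"
      unfolding e1
    proof (rule reach_If[OF b1])
      assume "bval (Less (Var ''m'') (Add (Mul (Num 2) (Var ''k'')) (Num 1))) s1"
      then have km: "m \<le> 2 * k" by (simp add: nm1)
      have "3 * m + 2 \<le> m * (m * (eval_cost N + 8) + 9) + 8 * m + 6" by simp
      then show "reach take_all s1
          ((m * (m * (eval_cost N + 8) + 9) + 8 * m + 6) * U b) ?Q"
        using km by (intro reach_mono[OF all] mult_le_mono1) auto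
    next
      assume "\<not> bval (Less (Var ''m'') (Add (Mul (Num 2) (Var ''k'')) (Num 1))) s1"
      then have km: "2 * k < m" by (simp add: nm1)
      then have "k * (m * (eval_cost N + 8) + 9) \<le> m * (m * (eval_cost N + 8) + 9)" by (intro mult_le_mono1) simp
      then have "8 * m + 2 + (1 + (k * (m * (eval_cost N + 8) + 9) + 2)) \<le> m * (m * (eval_cost N + 8) + 9) + 8 * m + 6" by linarith
      from mult_le_mono1[OF this, of "U b"]
      show "reach take_greedily s1
          ((m * (m * (eval_cost N + 8) + 9) + 8 * m + 6) * U b) ?Q"
        by (intro reach_mono[OF sel[OF km]]) (simp_all only: distrib_right mult_1)
    qed simp
  qed (simp add: sample_exp_def)
  then show ?thesis by (rule reach_mono) (simp_all add: algebra_simps)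
qed

end

section \<open>Integer scores and the potential\<close>

text \<open>The extra factor \<open>c\<close> on the left compensates for the highest power being
  \<open>c ^ (J - 1)\<close>.\<close>

lemma accum_eq:
  assumes "c \<noteq> 0"
  shows "of_int (accum c X J) * of_int c = (of_int c :: real) ^ J * (\<Sum>j<J. of_int (X j) / of_int c ^ j)"
  using assms by (induction J) (simp_all add: field_simps)

context edge_list
begin

definition embed :: "(nat \<Rightarrow> real) \<Rightarrow> fin_vec" where
  "embed X = (\<Sum>i<n. X i *\<^sub>R unit i)"

lemma coord_embed: "coord (embed X) i = (if i < n then X i else 0)"
  by (simp add: embed_def coord_sum coord_unit if_distrib cong: if_cong)

lemma inner_embed: "embed X \<bullet> x = (\<Sum>i<n. X i * coord x i)"
  by (simp add: embed_def inner_sum_left inner_unit)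

lemma edge_vec_inner: "fv.edge_vec u v \<sigma> f \<bullet> x = coord x (u f) + \<sigma> * coord x (v f)"
  by (simp add: fv.edge_vec_def inner_add_left inner_unit)

text \<open>\<open>s\<close> is the common denominator and \<open>C = c * s\<close>: one application
  of \<open>kern\<close> is \<open>C\<close> times the contraction \<open>I - M / c\<close>, so
  \<open>j\<close> applications carry the factor \<open>C ^ j\<close>.\<close>

lemma kern_embed:
  assumes s: "s \<noteq> 0" "C = c * s" "real_of_int ci = C" "C \<noteq> 0"
    and a: "real_of_int a = C - s * \<alpha>" and W: "\<And>f. f < m \<Longrightarrow> real_of_int (W f) = s * w f"
  shows "embed (\<lambda>i. of_int (kern a \<sigma> W X i)) = C *\<^sub>R
    (embed (\<lambda>i. of_int (X i)) - (1 / c) *\<^sub>R gram \<alpha> w (fv.edge_vec u v (of_int \<sigma>)) {..<m} (embed (\<lambda>i. of_int (X i))))"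
proof (rule fin_vec_eqI)
  fix i
  let ?x = "embed (\<lambda>i. of_int (X i))"
  have Cc: "C / c = s" using s by simp
  have co: "coord (fv.edge_vec u v \<sigma>' f) i = of_bool (u f = i) + \<sigma>' * of_bool (v f = i)" for \<sigma>' f
    by (auto simp: fv.edge_vec_def coord_unit)
  have big: "coord (fv.edge_vec u v \<sigma>' f) i = 0" if "f < m" "\<not> i < n" for \<sigma>' f
    using uv[OF that(1)] that(2) by (auto simp: co)
  have x: "coord ?x (u f) = X (u f)" "coord ?x (v f) = X (v f)" if "f < m" for f
    using uv[OF that] by (simp_all add: coord_embed)
  have "coord (C *\<^sub>R (?x - (1 / c) *\<^sub>R gram \<alpha> w (fv.edge_vec u v (of_int \<sigma>)) {..<m} ?x)) i
      = C * coord ?x i - C / c * (\<alpha> * coord ?x i + (\<Sum>f<m. w f * (coord ?x (u f) + of_int \<sigma> * coord ?x (v f)) * coord (fv.edge_vec u v (of_int \<sigma>) f) i))"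
    by (simp add: gram_def coord_sum edge_vec_inner algebra_simps)
  also have "\<dots> = (C - s * \<alpha>) * coord ?x i - (\<Sum>f<m. s * w f * (coord ?x (u f) + of_int \<sigma> * coord ?x (v f)) * coord (fv.edge_vec u v (of_int \<sigma>) f) i)"
    unfolding Cc by (simp add: sum_distrib_left algebra_simps)
  also have "\<dots> = of_int a * coord ?x i - (\<Sum>f<m. of_int (W f) * (of_int (X (u f)) + of_int \<sigma> * of_int (X (v f))) * coord (fv.edge_vec u v (of_int \<sigma>) f) i)"
    using W x by (simp add: a)
  also have "\<dots> = coord (embed (\<lambda>i. of_int (kern a \<sigma> W X i))) i"
  proof (cases "i < n")
    case True
    then show ?thesis by (simp add: coord_embed kern_def co)
  next
    case False
    then show ?thesis by (simp add: coord_embed big)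
  qed
  finally show "coord (embed (\<lambda>i. of_int (kern a \<sigma> W X i))) i = coord (C *\<^sub>R (?x - (1 / c) *\<^sub>R gram \<alpha> w (fv.edge_vec u v (of_int \<sigma>)) {..<m} ?x)) i" ..
qed

text \<open>The factor between score and potential involves only \<open>ci\<close>, \<open>N\<close>
  and \<open>c\<close>, not the weights of the edges; comparing scores of candidates therefore
  compares potentials.\<close>

lemma evalval_eq:
  fixes s c \<alpha> :: real
  assumes s: "s \<noteq> 0" "of_int ci = c * s" "ci \<noteq> 0" "c \<noteq> 0"
    and a: "real_of_int a = of_int ci - s * \<alpha>" and W: "\<And>f. f < m \<Longrightarrow> real_of_int (W f) = s * w f"
  shows "of_int (evalval a W ci N) * of_int ci = (of_int ci :: real) ^ N * c *
    (\<Sum>\<sigma>\<in>{1, - 1}. fv.neumann n c N (gram \<alpha> w (fv.edge_vec u v \<sigma>) {..<m}))"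
proof -
  define T where "T \<sigma> = (\<lambda>x. x - (1 / c) *\<^sub>R gram \<alpha> w (fv.edge_vec u v \<sigma>) {..<m} x)" for \<sigma>
  have linT: "linear (T \<sigma>)" for \<sigma>
    using self_adjointD(1)[OF self_adjoint_gram[of \<alpha> w "fv.edge_vec u v \<sigma>" "{..<m}"]]
    unfolding T_def by (intro linearI) (simp_all add: linear_add linear_cmul algebra_simps)
  have iter: "embed (\<lambda>i. of_int ((kern a \<sigma> W ^^ j) (delta i0) i)) = (of_int ci ^ j) *\<^sub>R (T (of_int \<sigma>) ^^ j) (unit i0)"
    if "i0 < n" for i0 j \<sigma>
  proof (induction j)
    case 0
    show ?case using that by (intro fin_vec_eqI) (simp add: coord_embed coord_unit delta_def)
  next
    case (Suc j)
    have "embed (\<lambda>i. of_int (kern a \<sigma> W ((kern a \<sigma> W ^^ j) (delta i0)) i)) =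
        of_int ci *\<^sub>R T (of_int \<sigma>) (embed (\<lambda>i. of_int ((kern a \<sigma> W ^^ j) (delta i0) i)))"
      unfolding T_def using s a W by (intro kern_embed) auto
    then show ?case unfolding Suc by (simp add: linear_cmul[OF linT])
  qed
  have col: "of_int (colval a \<sigma> W ci N i) * of_int ci = (of_int ci :: real) ^ N * (\<Sum>j<N. unit i \<bullet> (T (of_int \<sigma>) ^^ j) (unit i))"
    if "i < n" for i \<sigma>
  proof -
    have "of_int ((kern a \<sigma> W ^^ j) (delta i) i) / of_int ci ^ j = unit i \<bullet> (T (of_int \<sigma>) ^^ j) (unit i)" for j
    proof -
      have "of_int ((kern a \<sigma> W ^^ j) (delta i) i) = coord (embed (\<lambda>i'. of_int ((kern a \<sigma> W ^^ j) (delta i) i'))) i"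
        using that by (simp add: coord_embed)
      then show ?thesis using s(3) by (simp add: iter[OF that] inner_unit)
    qed
    then show ?thesis unfolding colval_def accum_eq[OF s(3)] by simp
  qed
  have "of_int (evalval a W ci N) * of_int ci = (\<Sum>h<2. \<Sum>i<n. of_int (colval a (2 * int h - 1) W ci N i) * (of_int ci :: real))"
    by (simp add: evalval_def sum_distrib_right)
  also have "\<dots> = (\<Sum>h<2. \<Sum>i<n. of_int ci ^ N * (\<Sum>j<N. unit i \<bullet> (T (of_int (2 * int h - 1)) ^^ j) (unit i)))"
    by (intro sum.cong refl col) simp
  also have "\<dots> = (\<Sum>h<2::nat. of_int ci ^ N * (c * fv.neumann n c N (gram \<alpha> w (fv.edge_vec u v (of_int (2 * int h - 1))) {..<m})))"
  proof (intro sum.cong refl)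
    fix h
    have "(\<Sum>i<n. of_int ci ^ N * (\<Sum>j<N. unit i \<bullet> (T (of_int (2 * int h - 1)) ^^ j) (unit i))) =
      of_int ci ^ N * (\<Sum>j<N. \<Sum>i<n. unit i \<bullet> (T (of_int (2 * int h - 1)) ^^ j) (unit i))"
      unfolding sum_distrib_left[symmetric] by (subst sum.swap) simp
    also have "(\<Sum>j<N. \<Sum>i<n. unit i \<bullet> (T (of_int (2 * int h - 1)) ^^ j) (unit i)) =
      c * fv.neumann n c N (gram \<alpha> w (fv.edge_vec u v (of_int (2 * int h - 1))) {..<m})"
      using s(4) by (simp add: fv.neumann_def fv.trace_def T_def)
    finally show "(\<Sum>i<n. of_int ci ^ N * (\<Sum>j<N. unit i \<bullet> (T (of_int (2 * int h - 1)) ^^ j) (unit i))) =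
      of_int ci ^ N * (c * fv.neumann n c N (gram \<alpha> w (fv.edge_vec u v (of_int (2 * int h - 1))) {..<m}))" .
  qed
  also have "\<dots> = (of_int ci :: real) ^ N * c * (\<Sum>\<sigma>\<in>{1, - 1}. fv.neumann n c N (gram \<alpha> w (fv.edge_vec u v \<sigma>) {..<m}))"
    by (simp add: numeral_2_eq_2 algebra_simps)
  finally show ?thesis .
qed

lemma cnt_card: "cnt m w = int (card {f. f < m \<and> u f = w}) + int (card {f. f < m \<and> v f = w})"
proof -
  have "(\<Sum>f<m. of_bool (z f = w)) = int (card {f. f < m \<and> z f = w})" for z :: "nat \<Rightarrow> nat"
  proof -
    have "{..<m} \<inter> {f. z f = w} = {f. f < m \<and> z f = w}" by auto
    then show ?thesis by (simp add: of_bool_def sum.If_cases)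
  qed
  then show ?thesis by (simp add: cnt_def sum.distrib)
qed

text \<open>The ratio \<open>r\<close> lies between the integer quotient and its successor. If
  \<open>p \<le> q\<close> then \<open>1 \<le> r\<close>, so the added \<open>1\<close> at most
  doubles the bound.\<close>

lemma sample_size_bounds:
  assumes "0 < p" "0 < q"
  shows "1000 * real n \<le> (real p / real q)\<^sup>2 * real (sample_size p q)"
    and "p \<le> q \<Longrightarrow> real (sample_size p q) \<le> 2000 * real n * (real q / real p)\<^sup>2"
proof -
  define r where "r = (real q / real p)\<^sup>2"
  have r: "r = real (q * q) / real (p * p)" by (simp add: r_def power2_eq_square)
  have fl: "real (q * q div (p * p)) \<le> r" "r \<le> real (q * q div (p * p)) + 1"
  proof -
    have pp: "0 < p * p" using assms by simp
    have e: "real (q * q) = real (q * q div (p * p)) * real (p * p) + real (q * q mod (p * p))"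
      by (metis div_mult_mod_eq of_nat_add of_nat_mult)
    have "real (q * q mod (p * p)) < real (p * p)" using pp by (simp only: of_nat_less_iff mod_less_divisor)
    then show "real (q * q div (p * p)) \<le> r" "r \<le> real (q * q div (p * p)) + 1"
      unfolding r using e pp by (simp_all only: pos_le_divide_eq pos_divide_le_eq of_nat_0_less_iff distrib_right mult_1)
  qed
  have k: "real (sample_size p q) = 1000 * real n * (real (q * q div (p * p)) + 1)"
    by (simp add: sample_size_def algebra_simps)
  show "1000 * real n \<le> (real p / real q)\<^sup>2 * real (sample_size p q)"
  proof -
    have pr: "(real p / real q)\<^sup>2 * r = 1" using assms by (simp add: r_def power_divide)
    have "1000 * real n = (real p / real q)\<^sup>2 * (1000 * real n * r)" using pr by (simp add: mult_ac)
    also have "\<dots> \<le> (real p / real q)\<^sup>2 * real (sample_size p q)"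
      unfolding k using fl by (intro mult_left_mono) auto
    finally show ?thesis .
  qed
  assume "p \<le> q"
  then have "1 \<le> r" unfolding r_def using assms by (intro one_le_power) simp
  then have "real (sample_size p q) \<le> 1000 * real n * (r + r)" unfolding k using fl by (intro mult_left_mono) auto
  then show "real (sample_size p q) \<le> 2000 * real n * (real q / real p)\<^sup>2" by (simp add: r_def)
qed

end

section \<open>Quadratic forms of graph matrices\<close>

text \<open>Entry functions in place of matrices, so that sums carry no dimension
  conditions.\<close>

definition quad :: "nat \<Rightarrow> (nat \<Rightarrow> nat \<Rightarrow> real) \<Rightarrow> (nat \<Rightarrow> real) \<Rightarrow> real" where
  "quad n a x = (\<Sum>i<n. \<Sum>j<n. x i * a i j * x j)"

lemma quad_linear:
  "quad n (\<lambda>i j. a i j + b i j) x = quad n a x + quad n b x"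
  "quad n (\<lambda>i j. a i j - b i j) x = quad n a x - quad n b x"
  "quad n (\<lambda>i j. c * a i j) x = c * quad n a x"
  by (simp_all add: quad_def distrib_left distrib_right left_diff_distrib right_diff_distrib sum.distrib
      sum_subtractf sum_distrib_left mult_ac)

lemma quad_identity: "quad n (\<lambda>i j. if i = j then 1 else 0) x = (\<Sum>i<n. (x i)\<^sup>2)"
proof -
  have "(\<Sum>j<n. x i * (if i = j then 1 else 0) * x j) = (x i)\<^sup>2" if "i < n" for i
  proof -
    have "(\<Sum>j<n. x i * (if i = j then 1 else 0) * x j) = (\<Sum>j<n. if i = j then x i * x j else 0)"
      by (intro sum.cong) auto
    then show ?thesis using that by (simp add: power2_eq_square)
  qed
  then show ?thesis by (simp add: quad_def)
qed

lemma positive_semidefiniteI: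
  assumes A: "A \<in> carrier_mat n n" "\<And>i j. i < n \<Longrightarrow> j < n \<Longrightarrow> A $$ (i, j) = a i j"
    and sym: "\<And>i j. a i j = a j i" and pos: "\<And>x. 0 \<le> quad n a x"
  shows "positive_semidefinite n A"
  unfolding positive_semidefinite_def
proof (intro conjI ballI)
  show "A \<in> carrier_mat n n" by (rule A)
  show "transpose_mat A = A" using A sym by (intro eq_matI) auto
  fix x :: "real vec" assume x: "x \<in> carrier_vec n"
  have "scalar_prod x (A *\<^sub>v x) = quad n a (\<lambda>i. x $ i)"
  proof -
    have "scalar_prod x (A *\<^sub>v x) = (\<Sum>i<n. x $ i * (\<Sum>j<n. a i j * x $ j))"
      using A x by (auto simp: scalar_prod_def mult_mat_vec_def atLeast0LessThan intro!: sum.cong)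
    then show ?thesis by (simp add: quad_def sum_distrib_left mult.assoc)
  qed
  then show "0 \<le> scalar_prod x (A *\<^sub>v x)" using pos by simp
qed

definition lap :: "(nat \<times> nat) set \<Rightarrow> nat \<Rightarrow> nat \<Rightarrow> real" where
  "lap F i j = (\<Sum>(u, v)\<in>F. (of_bool (i = u) - of_bool (i = v)) * (of_bool (j = u) - of_bool (j = v)))"

lemma sum_of_bool_eq:
  fixes x :: "nat \<Rightarrow> real"
  assumes "w < n"
  shows "(\<Sum>i<n. x i * of_bool (i = w)) = x w"
proof -
  have "(\<Sum>i<n. x i * of_bool (i = w)) = (\<Sum>i<n. if i = w then x i else 0)" by (intro sum.cong) auto
  also have "\<dots> = x w" using assms by simp
  finally show ?thesis .
qed

lemma quad_lap:
  assumes "simple_graph n F"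
  shows "quad n (lap F) x = (\<Sum>(u, v)\<in>F. (x u - x v)\<^sup>2)"
proof -
  have "quad n (lap F) x = (\<Sum>i<n. \<Sum>j<n. \<Sum>(u, v)\<in>F.
      (x i * (of_bool (i = u) - of_bool (i = v))) * (x j * (of_bool (j = u) - of_bool (j = v))))"
    by (auto simp: quad_def lap_def sum_distrib_left sum_distrib_right split_beta mult_ac intro!: sum.cong)
  also have "\<dots> = (\<Sum>i<n. \<Sum>(u, v)\<in>F. \<Sum>j<n.
      (x i * (of_bool (i = u) - of_bool (i = v))) * (x j * (of_bool (j = u) - of_bool (j = v))))"
    unfolding split_beta by (intro sum.cong refl sum.swap)
  also have "\<dots> = (\<Sum>(u, v)\<in>F. \<Sum>i<n. \<Sum>j<n.
      (x i * (of_bool (i = u) - of_bool (i = v))) * (x j * (of_bool (j = u) - of_bool (j = v))))"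
    unfolding split_beta by (rule sum.swap)
  also have "\<dots> = (\<Sum>(u, v)\<in>F. (x u - x v)\<^sup>2)"
  proof (intro sum.cong refl, clarify)
    fix u v assume "(u, v) \<in> F"
    then have uv: "u < n" "v < n" using assms by (auto simp: simple_graph_def)
    have "(\<Sum>i<n. x i * (of_bool (i = u) - of_bool (i = v))) = x u - x v"
      using uv by (simp add: right_diff_distrib sum_subtractf sum_of_bool_eq del: sum_mult_of_bool_eq)
    then show "(\<Sum>i<n. \<Sum>j<n. (x i * (of_bool (i = u) - of_bool (i = v))) * (x j * (of_bool (j = u) - of_bool (j = v)))) = (x u - x v)\<^sup>2"
      by (simp add: sum_product[symmetric] power2_eq_square)
  qed
  finally show ?thesis .
qed

text \<open>There are no loops, so an edge meets \<open>w\<close> in at most one endpoint and the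
  disjunction becomes a sum.\<close>

lemma degree_eq:
  assumes "simple_graph n F" "finite F"
  shows "real (degree F w) = (\<Sum>(u, v)\<in>F. of_bool (u = w) + of_bool (v = w))"
proof -
  have "(\<Sum>(u, v)\<in>F. of_bool (u = w) + of_bool (v = w)) = (\<Sum>e\<in>F. if fst e = w \<or> snd e = w then 1 else 0 :: real)"
    using assms(1) by (intro sum.cong) (auto simp: simple_graph_def)
  also have "\<dots> = real (card (F \<inter> {e. fst e = w \<or> snd e = w}))"
    using assms(2) by (simp add: sum.If_cases)
  also have "F \<inter> {e. fst e = w \<or> snd e = w} = {e \<in> F. fst e = w \<or> snd e = w}" by auto
  finally show ?thesis by (simp add: degree_def)
qed

lemma quad_degree:
  assumes "simple_graph n F" "finite F"
  shows "quad n (\<lambda>i j. if i = j then real (degree F i) else 0) x = (\<Sum>(u, v)\<in>F. (x u)\<^sup>2 + (x v)\<^sup>2)"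
proof -
  have "(\<Sum>j<n. x i * (if i = j then real (degree F i) else 0) * x j) = (\<Sum>(u, v)\<in>F. (x i)\<^sup>2 * of_bool (i = u) + (x i)\<^sup>2 * of_bool (i = v))"
    if "i < n" for i
  proof -
    have "(\<Sum>j<n. x i * (if i = j then real (degree F i) else 0) * x j) = (\<Sum>j<n. if i = j then x i * real (degree F i) * x j else 0)"
      by (intro sum.cong) auto
    also have "\<dots> = (x i)\<^sup>2 * real (degree F i)" using that by (simp add: power2_eq_square)
    also have "\<dots> = (\<Sum>(u, v)\<in>F. (x i)\<^sup>2 * of_bool (i = u) + (x i)\<^sup>2 * of_bool (i = v))"
      unfolding degree_eq[OF assms] sum_distrib_left
      by (intro sum.cong refl) (auto simp: algebra_simps)
    finally show ?thesis .
  qed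
  then have "quad n (\<lambda>i j. if i = j then real (degree F i) else 0) x =
      (\<Sum>i<n. \<Sum>(u, v)\<in>F. (x i)\<^sup>2 * of_bool (i = u) + (x i)\<^sup>2 * of_bool (i = v))"
    by (simp add: quad_def)
  also have "\<dots> = (\<Sum>(u, v)\<in>F. \<Sum>i<n. (x i)\<^sup>2 * of_bool (i = u) + (x i)\<^sup>2 * of_bool (i = v))"
    unfolding split_beta by (rule sum.swap)
  also have "\<dots> = (\<Sum>(u, v)\<in>F. (x u)\<^sup>2 + (x v)\<^sup>2)"
    using assms(1) by (intro sum.cong refl) (auto simp: simple_graph_def sum.distrib sum_of_bool_eq simp del: sum_mult_of_bool_eq)
  finally show ?thesis .
qed

text \<open>Since \<open>L\<^sub>F - 2 D\<^sub>F\<close> is the negative of the unsigned Laplacian of \<open>F\<close>, both inequalities are upper bounds.\<close>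

lemma loewner_bounds:
  assumes E: "simple_graph n E" "finite E" and F: "simple_graph n F" "finite F"
    and le: "\<And>\<sigma> x. \<sigma> \<in> {1, - 1 :: real} \<Longrightarrow>
      r * (\<Sum>(u, v)\<in>F. (x u + \<sigma> * x v)\<^sup>2) - (\<Sum>(u, v)\<in>E. (x u + \<sigma> * x v)\<^sup>2) \<le> c * (\<Sum>i<n. (x i)\<^sup>2)"
  shows "loewner_le n ((2 * r) \<cdot>\<^sub>m degree_matrix n F - 2 \<cdot>\<^sub>m degree_matrix n E - c \<cdot>\<^sub>m 1\<^sub>m n)
      (r \<cdot>\<^sub>m laplacian n F - laplacian n E)"
    and "loewner_le n (r \<cdot>\<^sub>m laplacian n F - laplacian n E) (c \<cdot>\<^sub>m 1\<^sub>m n)"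
proof -
  have carr: "laplacian n H \<in> carrier_mat n n" "degree_matrix n H \<in> carrier_mat n n" for H
    by (simp_all add: laplacian_def degree_matrix_def mat_diag_def)
  have dims: "dim_row (laplacian n H) = n" "dim_col (laplacian n H) = n"
    "dim_row (degree_matrix n H) = n" "dim_col (degree_matrix n H) = n" for H
    using carr by auto
  have lap: "laplacian n H $$ (i, j) = lap H i j" if "i < n" "j < n" "simple_graph n H" for H i j
    using that by (auto simp: laplacian_def lap_def simple_graph_def intro!: sum.cong split: prod.splits)
  have deg: "degree_matrix n H $$ (i, j) = (if i = j then real (degree H i) else 0)" if "i < n" "j < n" for H i j
    using that by (simp add: degree_matrix_def mat_diag_def)
  have lap_sym: "lap H i j = lap H j i" for H i j
    by (simp add: lap_def mult.commute)
  let ?I = "\<lambda>i j::nat. if i = j then 1 else 0 :: real"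
  let ?D = "\<lambda>H (i::nat) j. if i = j then real (degree H i) else 0"
  have qD: "quad n (?D H) x = (\<Sum>(u, v)\<in>H. (x u)\<^sup>2 + (x v)\<^sup>2)" if "simple_graph n H" "finite H" for H x
    by (rule quad_degree[OF that])
  have un: "2 * quad n (?D H) x - quad n (lap H) x = (\<Sum>(u, v)\<in>H. (x u + 1 * x v)\<^sup>2)"
    if "simple_graph n H" "finite H" for H x
    unfolding qD[OF that] quad_lap[OF that(1)] sum_distrib_left sum_subtractf[symmetric]
    by (intro sum.cong refl) (auto simp: power2_eq_square algebra_simps)
  have "positive_semidefinite n (r \<cdot>\<^sub>m laplacian n F - laplacian n E -
      ((2 * r) \<cdot>\<^sub>m degree_matrix n F - 2 \<cdot>\<^sub>m degree_matrix n E - c \<cdot>\<^sub>m 1\<^sub>m n))"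
  proof (rule positive_semidefiniteI[where
      a = "\<lambda>i j. (r * lap F i j - lap E i j) - (((2 * r) * ?D F i j - 2 * ?D E i j) - c * ?I i j)"])
    fix x :: "nat \<Rightarrow> real"
    have "quad n (\<lambda>i j. (r * lap F i j - lap E i j) - (((2 * r) * ?D F i j - 2 * ?D E i j) - c * ?I i j)) x =
      c * (\<Sum>i<n. (x i)\<^sup>2) - (r * (2 * quad n (?D F) x - quad n (lap F) x) - (2 * quad n (?D E) x - quad n (lap E) x))"
      unfolding quad_linear quad_identity by (simp add: algebra_simps)
    then show "0 \<le> quad n (\<lambda>i j. (r * lap F i j - lap E i j) - (((2 * r) * ?D F i j - 2 * ?D E i j) - c * ?I i j)) x"
      unfolding un[OF E] un[OF F] using le[of 1 x] by simp
  qed (use carr in \<open>auto simp: dims lap[OF _ _ E(1)] lap[OF _ _ F(1)] deg lap_sym\<close>)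
  then show "loewner_le n ((2 * r) \<cdot>\<^sub>m degree_matrix n F - 2 \<cdot>\<^sub>m degree_matrix n E - c \<cdot>\<^sub>m 1\<^sub>m n)
      (r \<cdot>\<^sub>m laplacian n F - laplacian n E)"
    by (simp add: loewner_le_def carr minus_carrier_mat)
  have "positive_semidefinite n (c \<cdot>\<^sub>m 1\<^sub>m n - (r \<cdot>\<^sub>m laplacian n F - laplacian n E))"
  proof (rule positive_semidefiniteI[where a = "\<lambda>i j. c * ?I i j - (r * lap F i j - lap E i j)"])
    fix x :: "nat \<Rightarrow> real"
    show "0 \<le> quad n (\<lambda>i j. c * ?I i j - (r * lap F i j - lap E i j)) x"
      unfolding quad_linear quad_identity quad_lap[OF E(1)] quad_lap[OF F(1)] using le[of "- 1" x] by simp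
  qed (use carr in \<open>auto simp: dims lap[OF _ _ E(1)] lap[OF _ _ F(1)] lap_sym\<close>)
  then show "loewner_le n (r \<cdot>\<^sub>m laplacian n F - laplacian n E) (c \<cdot>\<^sub>m 1\<^sub>m n)"
    by (simp add: loewner_le_def carr minus_carrier_mat)
qed

section \<open>From greedy choices to the quadratic form bound\<close>

context edge_list
begin

abbreviation pot :: "nat \<Rightarrow> nat \<Rightarrow> real \<Rightarrow> nat \<Rightarrow> nat set \<Rightarrow> real" where
  "pot k d \<eta> \<equiv> barrier.pot unit n m k u v (real d) \<eta>"

text \<open>\<open>evalval_eq\<close> with \<open>s = q * m * (m - t)\<close>, which clears the
  denominators of \<open>p / q\<close>, \<open>d / m\<close> and \<open>t / (m - t)\<close>.\<close>

lemma greedy_score_eq: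
  assumes B: "barrier unit n m k u v (real d) (real p / real q)" and q: "0 < q" and t: "t \<le> k"
  shows "of_int (greedy_score p q k d (2 * m ^ 3) t P) * of_int (diag_scale q d t) =
    (of_int (diag_scale q d t) :: real) ^ (2 * m ^ 3) * (3 * real d) * pot k d (real p / real q) t P"
    and "0 < diag_scale q d t"
proof -
  interpret B: barrier unit n m k u v "real d" "real p / real q" by (rule B)
  have m: "0 < m" "t < m" using B.m_pos B.km t B.k_pos by auto
  have d: "0 < d" using B.d by simp
  show pos: "0 < diag_scale q d t" using m d q by (simp add: diag_scale_def)
  have C: "real_of_int (diag_scale q d t) = 3 * real d * (real q * real m * (real m - real t))"
    by (simp add: diag_scale_def)
  have "of_int (greedy_score p q k d (2 * m ^ 3) t P) * of_int (diag_scale q d t) =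
    (of_int (diag_scale q d t) :: real) ^ (2 * m ^ 3) * (3 * real d) *
    (\<Sum>\<sigma>\<in>{1, - 1}. fv.neumann n (3 * real d) (2 * m ^ 3)
      (gram (real p / real q * real d / m * (real k + real t)) (B.wt t P) (fv.edge_vec u v \<sigma>) {..<m}))"
    unfolding greedy_score_def score_def
  proof (rule evalval_eq[OF _ C])
    show "real_of_int (off_scale p q k d t) = real_of_int (diag_scale q d t)
      - real q * real m * (real m - real t) * (real p / real q * real d / m * (real k + real t))"
      using m q by (simp add: off_scale_def)
    show "real_of_int (wgt q t P f) = real q * real m * (real m - real t) * B.wt t P f" for f
    proof (cases "f \<in> P")
      case True
      then show ?thesis by (simp add: wgt_def B.wt_def algebra_simps)
    next
      case False
      have "real m - real t \<noteq> 0" using m by simp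
      then show ?thesis using False by (simp add: wgt_def B.wt_def)
    qed
  qed (use m q d pos in auto)
  then show "of_int (greedy_score p q k d (2 * m ^ 3) t P) * of_int (diag_scale q d t) =
    (of_int (diag_scale q d t) :: real) ^ (2 * m ^ 3) * (3 * real d) * pot k d (real p / real q) t P"
    by (simp add: B.pot_def B.M_def B.N_def)
qed

text \<open>\<open>pot_step\<close> provides some edge that respects the bound; the minimizer of the
  scores does at least as well, since scores are a common positive multiple of the
  potentials.\<close>

lemma greedy_step:
  assumes B: "barrier unit n m k u v (real d) (real p / real q)" and q: "0 < q" and r: "r < k"
    and P: "P \<subseteq> {..<m}" "card P = r" "pot k d (real p / real q) r P \<le> barrier.\<Phi> n m k (real d) (real p / real q)"
    and e: "\<And>e'. e' < m \<Longrightarrow> e' \<notin> P \<Longrightarrow>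
      greedy_score p q k d (2 * m ^ 3) (Suc r) (insert e P) \<le> greedy_score p q k d (2 * m ^ 3) (Suc r) (insert e' P)"
  shows "pot k d (real p / real q) (Suc r) (insert e P) \<le> barrier.\<Phi> n m k (real d) (real p / real q)"
proof -
  interpret B: barrier unit n m k u v "real d" "real p / real q" by (rule B)
  obtain f where f: "f < m" "f \<notin> P" "B.pot (Suc r) (insert f P) \<le> B.\<Phi>"
    using B.pot_step[OF P(1,2) r P(3)] by auto
  define c where "c = real_of_int (diag_scale q d (Suc r))"
  note eq = greedy_score_eq[OF B q, of "Suc r", folded c_def]
  have c: "0 < c" using greedy_score_eq(2)[OF B q, of "Suc r"] r by (simp add: c_def)
  have d: "0 < d" using B.d by simp
  have "of_int (greedy_score p q k d (2 * m ^ 3) (Suc r) (insert e P)) * c \<le> of_int (greedy_score p q k d (2 * m ^ 3) (Suc r) (insert f P)) * c"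
    using e[OF f(1,2)] c by (intro mult_right_mono) auto
  then have "(c ^ (2 * m ^ 3) * (3 * real d)) * B.pot (Suc r) (insert e P) \<le> (c ^ (2 * m ^ 3) * (3 * real d)) * B.pot (Suc r) (insert f P)"
    using r by (simp only: eq)
  moreover have "0 < c ^ (2 * m ^ 3) * (3 * real d)" using c d by simp
  ultimately have "B.pot (Suc r) (insert e P) \<le> B.pot (Suc r) (insert f P)"
    by (simp only: mult_le_cancel_left_pos)
  then show ?thesis using f(3) by simp
qed

text \<open>Positivity of \<open>M\<close> after \<open>k\<close> steps, multiplied by
  \<open>(m - k) / k\<close>: the weights \<open>k / (m - k)\<close> and \<open>- 1\<close> become
  \<open>1\<close> and \<open>1 - m / k\<close>, and the multiple of the identity becomes
  \<open>2 * \<eta> * d * (m - k) / m\<close>.\<close>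

lemma barrier_bound:
  assumes B: "barrier unit n m k u v d \<eta>" and P: "P \<subseteq> {..<m}"
    and pot: "barrier.pot unit n m k u v d \<eta> k P \<le> barrier.\<Phi> n m k d \<eta>" and \<sigma>: "\<sigma> \<in> {1, - 1 :: real}"
  shows "real m / real k * (\<Sum>f\<in>P. (x (u f) + \<sigma> * x (v f))\<^sup>2) - (\<Sum>f<m. (x (u f) + \<sigma> * x (v f))\<^sup>2)
    \<le> 2 * \<eta> * d * (\<Sum>i<n. (x i)\<^sup>2)"
proof -
  interpret B: barrier unit n m k u v d \<eta> by (rule B)
  define y where "y = embed x"
  define g where "g f = (x (u f) + \<sigma> * x (v f))\<^sup>2" for f
  define X where "X = (\<Sum>i<n. (x i)\<^sup>2)"
  have X: "0 \<le> X" by (simp add: X_def sum_nonneg)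
  have un: "u f < n" "v f < n" if "f < m" for f using uv[OF that] by auto
  have k: "0 < real k" "0 < real m - real k" "0 < real m" using B.k_pos B.km by auto
  have yy: "y \<bullet> y = X" by (simp add: y_def inner_embed coord_embed X_def power2_eq_square)
  have "0 \<le> y \<bullet> B.M k P \<sigma> y"
    using B.coercive[OF order_refl \<sigma> pot, of y] B.Phi_pos by (smt (verit) divide_nonneg_pos inner_ge_zero)
  also have "\<dots> = \<eta> * d / m * (real k + real k) * X + (\<Sum>f<m. B.wt k P f * g f)"
    unfolding B.M_def inner_gram yy using un
    by (intro arg_cong2[where f = plus] sum.cong refl)
      (auto simp: edge_vec_inner y_def coord_embed g_def power2_eq_square)
  finally have "0 \<le> (real m - real k) / real k * (\<eta> * d / m * (real k + real k) * X + (\<Sum>f<m. B.wt k P f * g f))"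
    using k by simp
  also have "\<dots> = 2 * \<eta> * d * ((real m - real k) / m) * X + (\<Sum>f<m. (real m - real k) / real k * B.wt k P f * g f)"
    using k by (simp add: distrib_left sum_distrib_left field_simps)
  also have "(\<Sum>f<m. (real m - real k) / real k * B.wt k P f * g f) = (\<Sum>f<m. g f - (if f \<in> P then real m / real k * g f else 0))"
  proof (intro sum.cong refl)
    fix f
    show "(real m - real k) / real k * B.wt k P f * g f = g f - (if f \<in> P then real m / real k * g f else 0)"
    proof (cases "f \<in> P")
      case True
      define a where "a = real m / real k"
      have "(real m - real k) / real k = a - 1" using k by (simp add: a_def diff_divide_distrib)
      then have "(real m - real k) / real k * B.wt k P f * g f = (a - 1) * - 1 * g f" using True by (simp add: B.wt_def)
      then show ?thesis using True by (simp add: a_def[symmetric] algebra_simps)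
    next
      case False
      then show ?thesis using k by (simp add: B.wt_def)
    qed
  qed
  also have "\<dots> = (\<Sum>f<m. g f) - real m / real k * (\<Sum>f\<in>P. g f)"
    using P by (simp add: sum_subtractf sum.If_cases sum_distrib_left Int_absorb1)
  finally have main: "real m / real k * (\<Sum>f\<in>P. g f) - (\<Sum>f<m. g f) \<le> 2 * \<eta> * d * ((real m - real k) / m) * X" by simp
  have "(real m - real k) / m \<le> 1" using k by simp
  then have "2 * \<eta> * d * ((real m - real k) / m) * X \<le> 2 * \<eta> * d * 1 * X"
    using B.eta B.d X by (intro mult_right_mono mult_left_mono) auto
  with main show ?thesis by (simp add: g_def X_def)
qed

end

text \<open>Because \<open>2 * k < m\<close> there is an edge, whose endpoints give
  \<open>0 < n\<close> and \<open>1 \<le> d\<close>.\<close>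

lemma barrier_unitI:
  assumes "edge_list n m u v" and d: "\<And>w. w < n \<Longrightarrow> edge_list.cnt u v m w \<le> int d"
    and pq: "0 < p" "p < q" and km: "2 * k < m" "k = edge_list.sample_size n p q"
  shows "barrier unit n m k u v (real d) (real p / real q)"
proof -
  interpret edge_list n m u v by (rule assms(1))
  have "0 < m" using km by simp
  then have uv0: "u 0 < v 0" "v 0 < n" using uv[of 0] by auto
  have deg: "real (card {f. f < m \<and> u f = i}) + real (card {f. f < m \<and> v f = i}) \<le> real d" if "i < n" for i
  proof -
    have "int (card {f. f < m \<and> u f = i} + card {f. f < m \<and> v f = i}) \<le> int d" using d[OF that] by (simp add: cnt_card)
    then show ?thesis by linarith
  qed
  have "0 < card {f. f < m \<and> u f = u 0}" using \<open>0 < m\<close> by (auto simp: card_gt_0_iff)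
  then have "1 \<le> real d" using deg[of "u 0"] uv0 by simp
  show ?thesis
  proof
    show "1000 * real n \<le> (real p / real q)\<^sup>2 * real k" using sample_size_bounds(1)[of p q] pq km by simp
    show "real (card {f. f < m \<and> u f = i}) + real (card {f. f < m \<and> v f = i}) \<le> real d" if "i < n" for i
      by (rule deg[OF that])
    show "u f < n \<and> v f < n" if "f < m" for f using uv[OF that] by auto
  qed (use \<open>1 \<le> real d\<close> pq km uv0 in auto)
qed

section \<open>Polynomial bounds on time and bit lengths\<close>

context edge_list
begin

text \<open>At most \<open>138 * X ^ 7\<close> elementary steps, each of cost quadratic in the bit
  bound \<open>23 * X ^ 4\<close>, give the degree \<open>15\<close>.\<close>

lemma sparsify_time_le:
  assumes "n \<le> X" "m \<le> X" "1 \<le> X"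
  shows "(m * (m * (eval_cost (2 * m ^ 3) + 8) + 9) + 8 * m + 8) * U (23 * X ^ 4) \<le> poly (monom (138 * 120000\<^sup>2) 15) X"
proof -
  have p: "X \<le> X ^ 4" "1 \<le> X ^ 4" "1 \<le> X ^ 5" "1 \<le> X ^ 6" "1 \<le> X ^ 7" "X \<le> X ^ 7"
    using assms(3) power_increasing[of 1 4 X] power_increasing[of 1 7 X] by auto
  have "2 * m ^ 3 * (5 * m + 4 * n + 7) \<le> 2 * X ^ 3 * (16 * X)"
    using assms by (intro mult_le_mono power_mono) auto
  also have "\<dots> = 32 * X ^ 4" by (simp add: power_numeral_reduce)
  finally have "2 * m ^ 3 * (5 * m + 4 * n + 7) + 4 * n + 10 \<le> 46 * X ^ 4" using p assms by linarith
  then have "n * (2 * m ^ 3 * (5 * m + 4 * n + 7) + 4 * n + 10) \<le> X * (46 * X ^ 4)"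
    using assms by (intro mult_le_mono) auto
  also have "\<dots> = 46 * X ^ 5" by (simp add: power_numeral_reduce)
  finally have "eval_cost (2 * m ^ 3) + 8 \<le> 113 * X ^ 5"
    unfolding eval_cost_def using p by linarith
  then have "m * (eval_cost (2 * m ^ 3) + 8) \<le> X * (113 * X ^ 5)"
    using assms by (intro mult_le_mono) auto
  also have "\<dots> = 113 * X ^ 6" by (simp add: power_numeral_reduce)
  finally have "m * (eval_cost (2 * m ^ 3) + 8) + 9 \<le> 122 * X ^ 6" using p by linarith
  then have "m * (m * (eval_cost (2 * m ^ 3) + 8) + 9) \<le> X * (122 * X ^ 6)"
    using assms by (intro mult_le_mono) auto
  also have "\<dots> = 122 * X ^ 7" by (simp add: power_numeral_reduce)
  finally have 1: "m * (m * (eval_cost (2 * m ^ 3) + 8) + 9) + 8 * m + 8 \<le> 138 * X ^ 7"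
    using p assms by linarith
  have 2: "U (23 * X ^ 4) \<le> (120000 * X ^ 4)\<^sup>2"
    unfolding U_def using p by (intro power_mono) auto
  have "(m * (m * (eval_cost (2 * m ^ 3) + 8) + 9) + 8 * m + 8) * U (23 * X ^ 4) \<le> (138 * X ^ 7) * (120000 * X ^ 4)\<^sup>2"
    by (intro mult_le_mono 1 2)
  also have "\<dots> = 138 * 120000\<^sup>2 * X ^ 15"
    by (simp add: power_mult_distrib flip: power_mult power_add)
  finally show ?thesis by (simp add: poly_monom)
qed

text \<open>The base \<open>big_base q\<close> is at most \<open>2 ^ (7 * X)\<close> and is raised
  to a power of at most \<open>3 * X ^ 3\<close>, which makes \<open>21 * X ^ 4\<close> bits; the
  factor \<open>2 * n\<close> takes the other \<open>2 * X ^ 4\<close>.\<close>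

lemma sparsify_sizes:
  fixes p q X :: nat
  assumes X: "n \<le> X" "m \<le> X" "1 \<le> X" "q < 2 ^ X"
  shows "2 * int n * big_base q ^ Suc (2 * m ^ 3) < 2 ^ (23 * X ^ 4)"
    and "int (sample_size p q) < 2 ^ (23 * X ^ 4)"
    and "int (2 * m ^ 3) < 2 ^ (23 * X ^ 4)" and "(3::int) < 2 ^ (23 * X ^ 4)"
    and "(2::int) ^ X \<le> 2 ^ (23 * X ^ 4)"
proof -
  have X4: "X \<le> X ^ 4" "1 \<le> X ^ 4" "X ^ 3 \<le> X ^ 4" "1 \<le> X ^ 3"
    using X power_increasing[of 1 4 X] power_increasing[of 3 4 X] by auto
  have pw: "(2::nat) ^ i \<le> 2 ^ (23 * X ^ 4)" if "i \<le> 23 * X ^ 4" for i using that by (intro power_increasing) auto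
  have nm: "n < 2 ^ X" "m < 2 ^ X" using X less_exp[of X] by linarith+
  have toint: "int a < 2 ^ (23 * X ^ 4)" if "a < 2 ^ (23 * X ^ 4)" for a
    using that by (metis of_nat_less_iff of_nat_numeral of_nat_power)
  have m3: "m ^ 3 \<le> (2 ^ X) ^ 3" using nm by (intro power_mono) auto
  have "2 * n * (8 * q * m ^ 3) ^ Suc (2 * m ^ 3) < 2 ^ (23 * X ^ 4)"
  proof -
    have "8 * q * m ^ 3 \<le> 2 ^ 3 * 2 ^ X * (2 ^ X) ^ 3" using m3 X by (intro mult_le_mono) auto
    also have "\<dots> = 2 ^ (3 + X + X * 3)" by (simp only: power_add power_mult)
    also have "\<dots> \<le> 2 ^ (7 * X)" using X by (intro power_increasing) auto
    finally have "(8 * q * m ^ 3) ^ Suc (2 * m ^ 3) \<le> (2 ^ (7 * X)) ^ Suc (2 * m ^ 3)" by (intro power_mono) auto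
    also have "\<dots> = 2 ^ (7 * X * Suc (2 * m ^ 3))" by (simp only: power_mult)
    also have "\<dots> \<le> 2 ^ (21 * X ^ 4)"
    proof (intro power_increasing)
      have "Suc (2 * m ^ 3) \<le> 3 * X ^ 3" using X4 power_mono[OF X(2), of 3] by linarith
      then have "7 * X * Suc (2 * m ^ 3) \<le> 7 * X * (3 * X ^ 3)" by (intro mult_le_mono) auto
      also have "\<dots> = 21 * X ^ 4" by (simp add: power_numeral_reduce)
      finally show "7 * X * Suc (2 * m ^ 3) \<le> 21 * X ^ 4" .
    qed simp
    finally have "2 * n * (8 * q * m ^ 3) ^ Suc (2 * m ^ 3) \<le> 2 * n * 2 ^ (21 * X ^ 4)" by (intro mult_le_mono) auto
    also have "\<dots> < 2 ^ (2 * X ^ 4) * 2 ^ (21 * X ^ 4)"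
    proof (intro mult_strict_right_mono)
      have "2 * n < 2 ^ (1 + X)" using nm by simp
      also have "\<dots> \<le> 2 ^ (2 * X ^ 4)" using X4 by (intro power_increasing) auto
      finally show "2 * n < 2 ^ (2 * X ^ 4)" .
    qed simp
    also have "\<dots> = 2 ^ (23 * X ^ 4)" by (simp flip: power_add)
    finally show ?thesis .
  qed
  from toint[OF this] show "2 * int n * big_base q ^ Suc (2 * m ^ 3) < 2 ^ (23 * X ^ 4)"
    by (simp add: big_base_def)
  show "int (sample_size p q) < 2 ^ (23 * X ^ 4)"
  proof (rule toint)
    have "q * q < 2 ^ X * 2 ^ X" using X by (intro mult_strict_mono) auto
    then have "q * q div (p * p) + 1 \<le> 2 ^ X * 2 ^ X" using div_le_dividend[of "q * q" "p * p"] by linarith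
    then have "1000 * n * (q * q div (p * p) + 1) \<le> 1000 * 2 ^ X * (2 ^ X * 2 ^ X)"
      using nm by (intro mult_le_mono) auto
    also have "\<dots> < 2 ^ 10 * 2 ^ X * (2 ^ X * 2 ^ X)" by simp
    also have "\<dots> = 2 ^ (10 + X + (X + X))" by (simp only: power_add)
    also have "\<dots> \<le> 2 ^ (23 * X ^ 4)" using X4 by (intro pw) auto
    finally show "sample_size p q < 2 ^ (23 * X ^ 4)" by (simp add: sample_size_def)
  qed
  show "int (2 * m ^ 3) < 2 ^ (23 * X ^ 4)"
  proof (rule toint)
    have "2 * m ^ 3 \<le> 2 * (2 ^ X) ^ 3" using m3 by simp
    also have "\<dots> < 2 ^ 2 * (2 ^ X) ^ 3" by simp
    also have "\<dots> = 2 ^ (2 + X * 3)" by (simp only: power_add power_mult)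
    also have "\<dots> \<le> 2 ^ (23 * X ^ 4)" using X4 by (intro pw) auto
    finally show "2 * m ^ 3 < 2 ^ (23 * X ^ 4)" .
  qed
  have "(2::int) ^ 2 \<le> 2 ^ (23 * X ^ 4)" using X4 by (intro power_increasing) auto
  then show "(3::int) < 2 ^ (23 * X ^ 4)" by simp
  show "(2::int) ^ X \<le> 2 ^ (23 * X ^ 4)" using X4 by (intro power_increasing) auto
qed

end

lemma degree_le_max_degree: "w < n \<Longrightarrow> degree E w \<le> max_degree n E"
  unfolding max_degree_def by (intro Max_ge) auto

theorem theorem4p20:
  "\<exists>K > 0. \<exists>C > 0. \<exists>(algorithm :: com) (time :: nat poly).
     \<forall>(n :: nat) (E :: (nat \<times> nat) set) (es :: (nat \<times> nat) list) (\<epsilon> :: real) (p :: nat) (q :: nat).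
       simple_graph n E \<longrightarrow> distinct es \<longrightarrow> set es = E \<longrightarrow>
       0 < \<epsilon> \<longrightarrow> \<epsilon> < 1 \<longrightarrow> represents_eps p q \<epsilon> \<longrightarrow>
       (\<exists>t s F.
          exec algorithm (input_state n es p q) t s \<and>
          t \<le> poly time (input_size n es p q) \<and>
          F = output_edges es s \<and>
          F \<subseteq> E \<and>
          (E \<noteq> {} \<longrightarrow> F \<noteq> {}) \<and>
          real (card F) \<le> C * (real n / \<epsilon>\<^sup>2) \<and>
          (let r = real (card E) / real (card F); d = real (max_degree n E) in
             loewner_le n
               ((2 * r) \<cdot>\<^sub>m degree_matrix n F - 2 \<cdot>\<^sub>m degree_matrix n E - (K * \<epsilon> * d) \<cdot>\<^sub>m 1\<^sub>m n)
               (r \<cdot>\<^sub>m laplacian n F - laplacian n E) \<and>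
             loewner_le n
               (r \<cdot>\<^sub>m laplacian n F - laplacian n E)
               ((K * \<epsilon> * d) \<cdot>\<^sub>m 1\<^sub>m n)))"
\<comment> \<open>\<open>2\<close> comes from \<open>barrier_bound\<close>. For
  \<open>16000\<close>: \<open>q / p \<le> 2 / \<epsilon>\<close> gives
  \<open>k \<le> 8000 * n / \<epsilon>\<^sup>2\<close>, and up to \<open>2 * k\<close> edges may be
  taken.\<close>
proof (rule exI[of _ 2], rule conjI, simp, rule exI[of _ 16000], rule conjI, simp, rule exI[of _ sparsify],
    rule exI[of _ "monom (138 * 120000\<^sup>2) 15"], intro allI impI)
  fix n :: nat and E :: "(nat \<times> nat) set" and es :: "(nat \<times> nat) list" and \<epsilon> :: real and p q :: nat
  assume E: "simple_graph n E" and dist: "distinct es" and es: "set es = E"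
    and eps: "0 < \<epsilon>" "\<epsilon> < 1" and rep: "represents_eps p q \<epsilon>"
  define m where "m = length es"
  define u v where "u f = fst (es ! f)" and "v f = snd (es ! f)" for f
  define s0 where "s0 = input_state n es p q"
  define X where "X = input_size n es p q"
  define b where "b = 23 * X ^ 4"
  define k where "k = edge_list.sample_size n p q"
  define D where "D = max_degree n E"
  define \<eta> where "\<eta> = real p / real q"
  have pq: "0 < p" "0 < q" "\<epsilon> / 2 \<le> \<eta>" "\<eta> \<le> \<epsilon>" using rep by (auto simp: represents_eps_def \<eta>_def)
  then have "real p \<le> \<epsilon> * real q" by (simp add: \<eta>_def field_simps)
  also have "\<dots> < 1 * real q" using eps(2) pq(2) by (intro mult_strict_right_mono) auto
  finally have pltq: "p < q" by simp
  have eta0: "0 < \<eta>" using pq by (simp add: \<eta>_def)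
  have finE: "finite E" using es by auto
  have nth: "es ! f \<in> E" if "f < m" for f using that es by (auto simp: m_def)
  have "\<forall>e\<in>E. fst e < snd e \<and> snd e < n" using E by (simp add: simple_graph_def split_beta)
  then have uvE: "u f < v f \<and> v f < n" if "f < m" for f
    using nth[OF that] by (simp add: u_def v_def)
  interpret edge_list n m u v by standard (rule uvE)
  have inj: "inj_on (\<lambda>f. es ! f) {..<m}" using dist by (auto simp: inj_on_def m_def nth_eq_iff_index_eq)
  have img: "(\<lambda>f. es ! f) ` {..<m} = E" unfolding es[symmetric] m_def set_conv_nth by auto
  have cardE: "card E = m" using card_image[OF inj] img by simp
  have cnt_deg: "cnt m w = int (degree E w)" for w
  proof -
    have "real_of_int (cnt m w) = (\<Sum>e\<in>(\<lambda>f. es ! f) ` {..<m}. of_bool (fst e = w) + of_bool (snd e = w))"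
      unfolding sum.reindex[OF inj] by (simp add: cnt_def u_def v_def)
    also have "\<dots> = real (degree E w)" unfolding img degree_eq[OF E finE] by (simp add: split_beta)
    finally show ?thesis by linarith
  qed
  have Xb: "n \<le> X" "m \<le> X" "1 \<le> X" "bit_size (int p) \<le> X" "bit_size (int q) \<le> X"
    using bit_size_pos[of "int p"] by (simp_all add: X_def input_size_def m_def)
  have pX: "int z < 2 ^ X" if "bit_size (int z) \<le> X" for z
  proof -
    have "int z < 2 ^ (bit_size (int z) - 1)" using bit_size_bound[of "int z"] by simp
    also have "\<dots> \<le> 2 ^ X" using that by (intro power_increasing) auto
    finally show ?thesis .
  qed
  have nX: "int z < 2 ^ X" if "z \<le> X" for z
    using that less_exp[of X] by (metis le_less_trans of_nat_less_iff of_nat_numeral of_nat_power)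
  have qX: "q < 2 ^ X" using pX[OF Xb(5)] by (metis of_nat_less_iff of_nat_numeral of_nat_power)
  note sizes = sparsify_sizes[OF Xb(1-3) qX, folded b_def]
  have bdd0: "bdd b s0"
  proof -
    have "\<bar>s0 x i\<bar> < 2 ^ X" for x i
    proof -
      have "int (fst (es ! nat i)) < 2 ^ X" "int (snd (es ! nat i)) < 2 ^ X" if "0 \<le> i" "i < int (length es)"
      proof -
        have "nat i < m" using that by (simp add: m_def)
        from uvE[OF this] Xb(1) have "fst (es ! nat i) \<le> X" "snd (es ! nat i) \<le> X" by (auto simp: u_def v_def)
        from this[THEN nX] show "int (fst (es ! nat i)) < 2 ^ X" "int (snd (es ! nat i)) < 2 ^ X" .
      qed
      then show ?thesis
        using nX[OF Xb(1)] nX[OF Xb(2)] pX[OF Xb(4)] pX[OF Xb(5)] by (simp add: s0_def input_state_def m_def)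
    qed
    then show ?thesis using sizes(5) unfolding bdd_def by (meson less_le_trans)
  qed
  have Dm: "D \<le> m"
  proof -
    have "degree E w \<le> m" for w
      unfolding degree_def cardE[symmetric] using finE by (intro card_mono) auto
    then show ?thesis by (auto simp: D_def max_degree_def)
  qed
  have B: "barrier unit n m k u v (real d) \<eta>" if "2 * k < m" "\<And>w. w < n \<Longrightarrow> cnt m w \<le> int d" for d
    unfolding \<eta>_def by (rule barrier_unitI[OF edge_list_axioms that(2) pq(1) pltq that(1)]) (simp_all add: k_def)
  \<comment> \<open>The invariant of the greedy loop: the potential has not risen above its initial
    bound.\<close>
  let ?G = "\<lambda>d t P. pot k d \<eta> t P \<le> barrier.\<Phi> n m k (real d) \<eta>"
  have "reach sparsify s0 ((m * (m * (eval_cost (2 * m ^ 3) + 8) + 9) + 8 * m + 8) * U b)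
    (\<lambda>s'. (m \<le> 2 * k \<and> out_is {..<m} s') \<or>
      (2 * k < m \<and> (\<exists>d P. (\<forall>w<n. cnt m w \<le> int d) \<and> d \<le> D \<and> P \<subseteq> {..<m} \<and> card P = k \<and> ?G d k P \<and> out_is P s')))"
  proof (rule sparsify_spec[where p = p and q = q and D = D and G = ?G and s = s0 and b = b, folded k_def])
    show "bdd b s0" by (rule bdd0)
    show "graph_state s0" by (simp add: graph_state_def s0_def input_state_def m_def[symmetric] u_def v_def)
    show "s0 ''p'' 0 = int p" "s0 ''q'' 0 = int q" "out_is {} s0" "s0 ''d'' 0 = 0" "s0 ''deg'' (int w) = 0" for w
      by (simp_all add: s0_def input_state_def out_is_def)
    show "cnt m w \<le> int D" if "w < n" for w
      using degree_le_max_degree[OF that, of E] by (simp add: cnt_deg D_def)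
    show "?G d 0 {}" if "2 * k < m" "\<And>w. w < n \<Longrightarrow> cnt m w \<le> int d" "d \<le> D" for d
      by (rule barrier.pot_0[OF B[OF that(1,2)]])
    show "?G d (Suc r) (insert e P)" if "2 * k < m" "\<And>w. w < n \<Longrightarrow> cnt m w \<le> int d" "d \<le> D"
      "r < k" "P \<subseteq> {..<m}" "card P = r" "?G d r P" "e < m" "e \<notin> P"
      "\<And>e'. e' < m \<Longrightarrow> e' \<notin> P \<Longrightarrow> greedy_score p q k d (2 * m ^ 3) (Suc r) (insert e P) \<le> greedy_score p q k d (2 * m ^ 3) (Suc r) (insert e' P)"
      for d r P e
      using greedy_step[OF B[OF that(1,2), unfolded \<eta>_def] pq(2) that(4-6) that(7)[unfolded \<eta>_def] that(10)]
      by (simp add: \<eta>_def)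
  qed (use pltq pq Dm sizes in \<open>simp_all add: k_def\<close>)
  then obtain t s where ex: "exec sparsify s0 t s" "t \<le> (m * (m * (eval_cost (2 * m ^ 3) + 8) + 9) + 8 * m + 8) * U b"
    and post: "(m \<le> 2 * k \<and> out_is {..<m} s) \<or>
      (2 * k < m \<and> (\<exists>d P. (\<forall>w<n. cnt m w \<le> int d) \<and> d \<le> D \<and> P \<subseteq> {..<m} \<and> card P = k \<and> ?G d k P \<and> out_is P s))"
    unfolding reach_def by blast
  define F where "F = output_edges es s"
  have F_eq: "F = (\<lambda>f. es ! f) ` P" if "out_is P s" "P \<subseteq> {..<m}" for P
  proof -
    have "i < m \<and> s ''out'' (int i) \<noteq> 0 \<longleftrightarrow> i \<in> P" for i
      using that by (auto simp: out_is_def)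
    then show ?thesis unfolding F_def output_edges_def m_def[symmetric] by auto
  qed
  \<comment> \<open>\<open>2 * k\<close> and not \<open>k\<close>, because all edges are taken when
    \<open>m \<le> 2 * k\<close>.\<close>
  have kle: "real (2 * k) \<le> 16000 * (real n / \<epsilon>\<^sup>2)"
  proof -
    have "real q / real p \<le> 2 / \<epsilon>" using pq eps by (simp add: \<eta>_def field_simps)
    then have "(real q / real p)\<^sup>2 \<le> (2 / \<epsilon>)\<^sup>2" by (intro power_mono) auto
    then have "2000 * real n * (real q / real p)\<^sup>2 \<le> 2000 * real n * (2 / \<epsilon>)\<^sup>2" by (intro mult_left_mono) auto
    moreover have "real k \<le> 2000 * real n * (real q / real p)\<^sup>2"
      using sample_size_bounds(2)[of p q] pq pltq by (simp add: k_def)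
    ultimately show ?thesis by (simp add: power_divide)
  qed
  have FE: "F \<subseteq> E" using nth by (auto simp: F_def output_edges_def m_def)
  have sF: "simple_graph n F" using E FE by (auto simp: simple_graph_def)
  have finF: "finite F" using FE finE finite_subset by blast
  have sums: "(\<Sum>(a, b)\<in>(\<lambda>f. es ! f) ` P. (x a + \<sigma> * x b)\<^sup>2) = (\<Sum>f\<in>P. (x (u f) + \<sigma> * x (v f))\<^sup>2)"
    if "P \<subseteq> {..<m}" for P \<sigma> and x :: "nat \<Rightarrow> real"
    using inj_on_subset[OF inj that] by (simp add: sum.reindex u_def v_def split_beta)
  have "(E \<noteq> {} \<longrightarrow> F \<noteq> {}) \<and> real (card F) \<le> 16000 * (real n / \<epsilon>\<^sup>2) \<and>
    (\<forall>\<sigma>\<in>{1, - 1}. \<forall>x. real (card E) / real (card F) * (\<Sum>(u, v)\<in>F. (x u + \<sigma> * x v)\<^sup>2) - (\<Sum>(u, v)\<in>E. (x u + \<sigma> * x v)\<^sup>2)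
      \<le> 2 * \<epsilon> * D * (\<Sum>i<n. (x i)\<^sup>2))"
    using post
  proof (elim disjE conjE exE)
    assume a: "m \<le> 2 * k" "out_is {..<m} s"
    have FE: "F = E" using F_eq[OF a(2)] img by simp
    \<comment> \<open>For empty \<open>E\<close> the quotient \<open>0 / 0\<close> is
      \<open>0\<close>, and the sum \<open>S\<close> vanishes; otherwise the quotient is
      \<open>1\<close> and the two terms cancel.\<close>
    have "real (card E) / real (card E) * S - S \<le> 2 * \<epsilon> * D * (\<Sum>i<n. (x i)\<^sup>2)"
      if "E = {} \<Longrightarrow> S = 0" for S and x :: "nat \<Rightarrow> real"
    proof -
      have "0 \<le> 2 * \<epsilon> * D * (\<Sum>i<n. (x i)\<^sup>2)" using eps by (simp add: sum_nonneg)
      then show ?thesis using that finE by (cases "E = {}") auto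
    qed
    moreover have "real (card E) \<le> 16000 * (real n / \<epsilon>\<^sup>2)" using a(1) kle cardE by linarith
    ultimately show ?thesis unfolding FE by auto
  next
    fix d P
    assume a: "2 * k < m" "\<forall>w<n. cnt m w \<le> int d" "d \<le> D" "P \<subseteq> {..<m}" "card P = k" "?G d k P" "out_is P s"
    have FP: "F = (\<lambda>f. es ! f) ` P" by (rule F_eq[OF a(7,4)])
    have cF: "card F = k" unfolding FP using card_image[OF inj_on_subset[OF inj a(4)]] a(5) by simp
    have Bd: "barrier unit n m k u v (real d) \<eta>" using B[OF a(1)] a(2) by blast
    have k0: "0 < k" by (rule barrier.k_pos[OF Bd])
    have "real (card E) / real (card F) * (\<Sum>(u, v)\<in>F. (x u + \<sigma> * x v)\<^sup>2) - (\<Sum>(u, v)\<in>E. (x u + \<sigma> * x v)\<^sup>2)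
      \<le> 2 * \<epsilon> * D * (\<Sum>i<n. (x i)\<^sup>2)" if "\<sigma> \<in> {1, - 1}" for \<sigma> and x :: "nat \<Rightarrow> real"
    proof -
      have "real (card E) / real (card F) * (\<Sum>(u, v)\<in>F. (x u + \<sigma> * x v)\<^sup>2) - (\<Sum>(u, v)\<in>E. (x u + \<sigma> * x v)\<^sup>2)
        \<le> 2 * \<eta> * real d * (\<Sum>i<n. (x i)\<^sup>2)"
        using barrier_bound[OF Bd a(4,6) that, of x] unfolding cF cardE unfolding FP img[symmetric] sums[OF a(4)] sums[OF subset_refl] .
      \<comment> \<open>\<open>\<eta> \<le> \<epsilon>\<close> and \<open>d \<le> D\<close> lead
        from the numbers used by the program to those of the theorem.\<close>
      also have "\<dots> \<le> 2 * \<epsilon> * real D * (\<Sum>i<n. (x i)\<^sup>2)"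
        using pq eta0 a(3) eps by (intro mult_right_mono mult_mono sum_nonneg) auto
      finally show ?thesis .
    qed
    moreover have "real (card F) \<le> 16000 * (real n / \<epsilon>\<^sup>2)" using kle by (simp add: cF)
    moreover have "F \<noteq> {}" using cF k0 by auto
    ultimately show ?thesis by blast
  qed
  then have nonempty: "E \<noteq> {} \<longrightarrow> F \<noteq> {}" and card: "real (card F) \<le> 16000 * (real n / \<epsilon>\<^sup>2)"
    and le: "\<And>\<sigma> x. \<sigma> \<in> {1, - 1} \<Longrightarrow> real (card E) / real (card F) * (\<Sum>(u, v)\<in>F. (x u + \<sigma> * x v)\<^sup>2) - (\<Sum>(u, v)\<in>E. (x u + \<sigma> * x v)\<^sup>2)
      \<le> 2 * \<epsilon> * D * (\<Sum>i<n. (x i)\<^sup>2)"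
    by blast+
  have time: "t \<le> poly (monom (138 * 120000\<^sup>2) 15) X"
    using order_trans[OF ex(2)] sparsify_time_le[OF Xb(1-3)] unfolding b_def by blast
  show "\<exists>t s F.
          exec sparsify (input_state n es p q) t s \<and>
          t \<le> poly (monom (138 * 120000\<^sup>2) 15) (input_size n es p q) \<and>
          F = output_edges es s \<and>
          F \<subseteq> E \<and>
          (E \<noteq> {} \<longrightarrow> F \<noteq> {}) \<and>
          real (card F) \<le> 16000 * (real n / \<epsilon>\<^sup>2) \<and>
          (let r = real (card E) / real (card F); d = real (max_degree n E) in
             loewner_le n
               ((2 * r) \<cdot>\<^sub>m degree_matrix n F - 2 \<cdot>\<^sub>m degree_matrix n E - (2 * \<epsilon> * d) \<cdot>\<^sub>m 1\<^sub>m n)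
               (r \<cdot>\<^sub>m laplacian n F - laplacian n E) \<and>
             loewner_le n
               (r \<cdot>\<^sub>m laplacian n F - laplacian n E)
               ((2 * \<epsilon> * d) \<cdot>\<^sub>m 1\<^sub>m n))"
    unfolding Let_def
    by (intro exI[of _ t] exI[of _ s] exI[of _ F] conjI loewner_bounds E finE sF finF le[unfolded D_def])
      (use ex time FE nonempty card in \<open>simp_all add: s0_def X_def F_def\<close>)
qed

end
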